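(* Let $s\in(0,1)$, $n\in\mathbb{N}$ with $n>2s$, $p\in\left(1,\frac{n+2s}{n-2s}\right)$, and let $\Omega\subset\mathbb{R}^n$ be a bounded smooth domain. There exist $\delta_0\in(0,1)$ and $c>0$ such that, for every $\delta\in(0,\delta_0]$ and $\varepsilon>0$, if $\xi\in\Omega_\varepsilon$ satisfies $$d:=\mathrm{dist}(\xi,\partial\Omega_\varepsilon)\in\left[2,\frac{\delta}{\varepsilon}\right],$$ then $$\mathcal{H}_\varepsilon(\xi)\ge\frac{c}{d^{n+4s}}.$$
   Context: $(-\Delta)^s$ is the fractional Laplacian on $\mathbb{R}^n$ (Fourier symbol $|\xi|^{2s}$). $\Omega_\varepsilon:=\{x/\varepsilon:\ x\in\Omega\}$. $w$ denotes the unique radial positive least energy solution of $(-\Delta)^sw+w=w^p$ in $\mathbb{R}^n$, $w\in H^s(\mathbb{R}^n)$. It is known to be smooth and bounded above and below by positive constants times $|x|^{-(n+2s)}$ for $|x|\ge1$. Set $w_\xi(x):=w(x-\xi)$. $\Gamma$ is the unique decaying fundamental solution of $(-\Delta)^s\Gamma+\Gamma=\delta_0$ in $\mathbb{R}^n$; it is known to be radial, positive, of integral $1$, and bounded above and below by positive constants times $|x|^{-(n+2s)}$ for $|x|\ge1$. For fixed $y$, $H_\varepsilon(\cdot,y)$ is the solution of $(-\Delta)^sH_\varepsilon(x,y)+H_\varepsilon(x,y)=0$ for $x\in\Omega_\varepsilon$, with $H_\varepsilon(x,y)=\Gamma(x-y)$ for $x\in\mathbb{R}^n\setminus\Omega_\varepsilon$.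 $\mathcal{H}_\varepsilon(\xi):=\int_{\Omega_\varepsilon}\int_{\Omega_\varepsilon}H_\varepsilon(x,y)\,w_\xi^p(x)\,w_\xi^p(y)\,dx\,dy$. *)

theory Defs
  imports "HOL-Analysis.Analysis"
begin

subsection \<open>Smooth functions and smooth bounded domains\<close>

text \<open>For an open set \<open>S\<close>: \<open>f\<close> has continuous derivatives up to order \<open>k\<close> on \<open>S\<close>, by recursion
  over directional derivatives.\<close>

primrec times_differentiable_on ::
  "nat \<Rightarrow> 'a::euclidean_space set \<Rightarrow> ('a \<Rightarrow> real) \<Rightarrow> bool"
where
  "times_differentiable_on 0 S f \<longleftrightarrow> continuous_on S f"
| "times_differentiable_on (Suc k) S f \<longleftrightarrow>
     (\<forall>x\<in>S. f differentiable (at x)) \<and>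
     (\<forall>v. times_differentiable_on k S (\<lambda>x. frechet_derivative f (at x) v))"

definition smooth_on :: "'a::euclidean_space set \<Rightarrow> ('a \<Rightarrow> real) \<Rightarrow> bool" where
  "smooth_on S f \<longleftrightarrow> (\<forall>k. times_differentiable_on k S f)"

text \<open>The boundary is smooth in the sense of local defining functions: near each boundary point
  the domain is a strict sublevel set of a smooth function without critical points.\<close>

definition smooth_bounded_domain :: "'a::euclidean_space set \<Rightarrow> bool" where
  "smooth_bounded_domain \<Omega> \<longleftrightarrow>
     open \<Omega> \<and> connected \<Omega> \<and> bounded \<Omega> \<and> \<Omega> \<noteq> {} \<and>
     (\<forall>z\<in>frontier \<Omega>. \<exists>U \<rho>. open U \<and> z \<in> U \<and> smooth_on U \<rho> \<and>
        (\<forall>x\<in>U. \<exists>v. frechet_derivative \<rho> (at x) v \<noteq> 0) \<and>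
        \<Omega> \<inter> U = {x\<in>U. \<rho> x < 0})"

definition rescaled :: "real \<Rightarrow> 'a::euclidean_space set \<Rightarrow> 'a set" where
  "rescaled \<epsilon> \<Omega> = (\<lambda>x. x /\<^sub>R \<epsilon>) ` \<Omega>"

subsection \<open>The fractional Laplacian\<close>

definition test_function :: "('a::euclidean_space \<Rightarrow> real) \<Rightarrow> bool" where
  "test_function \<phi> \<longleftrightarrow> smooth_on UNIV \<phi> \<and> (\<exists>K. compact K \<and> (\<forall>x. x \<notin> K \<longrightarrow> \<phi> x = 0))"

definition fourier :: "('a::euclidean_space \<Rightarrow> real) \<Rightarrow> 'a \<Rightarrow> complex" where
  "fourier \<phi> k = (LINT x|lborel. \<phi> x *\<^sub>R cis (- (k \<bullet> x)))"

text \<open>The Fourier multiplier with symbol \<open>|k|\<^sup>2\<^sup>s\<close>, applied to a test function. The symbol is real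
  and even and \<open>\<phi>\<close> is real-valued, so the inverse transform is real and \<open>Re\<close> loses nothing.\<close>

definition frac_laplacian :: "real \<Rightarrow> ('a::euclidean_space \<Rightarrow> real) \<Rightarrow> 'a \<Rightarrow> real" where
  "frac_laplacian s \<phi> x =
     Re (LINT k|lborel. (norm k powr (2 * s)) *\<^sub>R (fourier \<phi> k * cis (k \<bullet> x)))
       / (2 * pi) ^ DIM('a)"

definition square_integrable :: "('a::euclidean_space \<Rightarrow> real) \<Rightarrow> bool" where
  "square_integrable u \<longleftrightarrow>
     u \<in> borel_measurable lborel \<and> integrable lborel (\<lambda>x. (u x)\<^sup>2)"

text \<open>\<open>g\<close> is the distributional fractional Laplacian \<open>(-\<Delta>)\<^sup>\<sigma> u\<close> of \<open>u\<close>, both in \<open>L\<^sup>2\<close>.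
  Given \<open>u\<close>, it is determined almost everywhere.\<close>

definition has_weak_frac_laplacian ::
  "real \<Rightarrow> ('a::euclidean_space \<Rightarrow> real) \<Rightarrow> ('a \<Rightarrow> real) \<Rightarrow> bool"
where
  "has_weak_frac_laplacian \<sigma> u g \<longleftrightarrow>
     square_integrable u \<and> square_integrable g \<and>
     (\<forall>\<phi>. test_function \<phi> \<longrightarrow>
        (LINT x|lborel. u x * frac_laplacian \<sigma> \<phi> x) = (LINT x|lborel. g x * \<phi> x))"

text \<open>The Sobolev space \<open>H\<^sup>s\<close> on the whole space: \<open>u\<close> and \<open>(-\<Delta>)\<^sup>s\<^sup>/\<^sup>2 u\<close> are in \<open>L\<^sup>2\<close>.\<close>

definition sobolev :: "real \<Rightarrow> ('a::euclidean_space \<Rightarrow> real) set" where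
  "sobolev s = {u. \<exists>g. has_weak_frac_laplacian (s / 2) u g}"

definition half_frac_laplacian :: "real \<Rightarrow> ('a::euclidean_space \<Rightarrow> real) \<Rightarrow> 'a \<Rightarrow> real" where
  "half_frac_laplacian s u = (SOME g. has_weak_frac_laplacian (s / 2) u g)"

text \<open>The pairing of \<open>(-\<Delta>)\<^sup>s u\<close> with \<open>v\<close>, for \<open>u\<close> and \<open>v\<close> in \<open>H\<^sup>s\<close>.\<close>

definition frac_form ::
  "real \<Rightarrow> ('a::euclidean_space \<Rightarrow> real) \<Rightarrow> ('a \<Rightarrow> real) \<Rightarrow> real"
where
  "frac_form s u v =
     (LINT x|lborel. half_frac_laplacian s u x * half_frac_laplacian s v x)"

text \<open>Weak (finite energy) solutions of \<open>(-\<Delta>)\<^sup>s u + u = f\<close> in the open set \<open>U\<close>; the admissible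
  variations are the elements of \<open>H\<^sup>s\<close> that vanish outside \<open>U\<close>.\<close>

definition weak_solution ::
  "real \<Rightarrow> 'a::euclidean_space set \<Rightarrow> ('a \<Rightarrow> real) \<Rightarrow> ('a \<Rightarrow> real) \<Rightarrow> bool"
where
  "weak_solution s U u f \<longleftrightarrow>
     u \<in> sobolev s \<and>
     (\<forall>v\<in>sobolev s. (AE x in lborel. x \<notin> U \<longrightarrow> v x = 0) \<longrightarrow>
        frac_form s u v + (LINT x|lborel. u x * v x) = (LINT x|lborel. f x * v x))"

subsection \<open>The ground state\<close>

text \<open>The nonlinearity is \<open>|u|\<^sup>p\<^sup>-\<^sup>1 u\<close>, which is \<open>u\<^sup>p\<close> for positive \<open>u\<close>, so that
  sign-changing competitors are meaningful.\<close>

definition nontrivial_solution :: "real \<Rightarrow> real \<Rightarrow> ('a::euclidean_space \<Rightarrow> real) \<Rightarrow> bool" where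
  "nontrivial_solution s p u \<longleftrightarrow>
     weak_solution s UNIV u (\<lambda>x. \<bar>u x\<bar> powr (p - 1) * u x) \<and>
     \<not> (AE x in lborel. u x = 0)"

definition energy :: "real \<Rightarrow> real \<Rightarrow> ('a::euclidean_space \<Rightarrow> real) \<Rightarrow> real" where
  "energy s p u =
     (frac_form s u u + (LINT x|lborel. (u x)\<^sup>2)) / 2
       - (LINT x|lborel. \<bar>u x\<bar> powr (p + 1)) / (p + 1)"

definition least_energy_solution :: "real \<Rightarrow> real \<Rightarrow> ('a::euclidean_space \<Rightarrow> real) \<Rightarrow> bool" where
  "least_energy_solution s p (w :: 'a \<Rightarrow> real) \<longleftrightarrow>
     nontrivial_solution s p w \<and>
     (\<forall>u :: 'a \<Rightarrow> real. nontrivial_solution s p u \<longrightarrow> energy s p w \<le> energy s p u)"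

definition radial :: "('a::euclidean_space \<Rightarrow> real) \<Rightarrow> bool" where
  "radial f \<longleftrightarrow> (\<forall>x y. norm x = norm y \<longrightarrow> f x = f y)"

definition two_sided_decay :: "real \<Rightarrow> ('a::euclidean_space \<Rightarrow> real) \<Rightarrow> bool" where
  "two_sided_decay s f \<longleftrightarrow>
     (\<exists>a>0. \<exists>b>0. \<forall>x. 1 \<le> norm x \<longrightarrow>
        a * norm x powr (- (real DIM('a) + 2 * s)) \<le> f x \<and>
        f x \<le> b * norm x powr (- (real DIM('a) + 2 * s)))"

subsection \<open>The fundamental solution and the regular part of the Green function\<close>

text \<open>The equation \<open>(-\<Delta>)\<^sup>s \<Gamma> + \<Gamma> = \<delta>\<^sub>0\<close> in the sense of distributions. The value of \<open>\<Gamma>\<close> at the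
  (possibly singular) origin is irrelevant.\<close>

definition decaying_fundamental_solution ::
  "real \<Rightarrow> ('a::euclidean_space \<Rightarrow> real) \<Rightarrow> bool"
where
  "decaying_fundamental_solution s \<Gamma> \<longleftrightarrow>
     (\<forall>K. compact K \<longrightarrow> set_integrable lborel K \<Gamma>) \<and>
     (\<Gamma> \<longlongrightarrow> 0) at_infinity \<and>
     (\<forall>\<phi>. test_function \<phi> \<longrightarrow>
        (LINT x|lborel. \<Gamma> x * (frac_laplacian s \<phi> x + \<phi> x)) = \<phi> 0)"

definition regular_part ::
  "real \<Rightarrow> 'a::euclidean_space set \<Rightarrow> ('a \<Rightarrow> real) \<Rightarrow> ('a \<Rightarrow> 'a \<Rightarrow> real) \<Rightarrow> bool"
where
  "regular_part s U \<Gamma> H \<longleftrightarrow>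
     (\<forall>y\<in>U. weak_solution s U (\<lambda>x. H x y) (\<lambda>x. 0) \<and>
        (\<forall>x. x \<notin> U \<longrightarrow> H x y = \<Gamma> (x - y)))"

text \<open>The functional \<open>\<H>\<^sub>\<epsilon>(\<xi>)\<close>, for \<open>U = \<Omega>\<^sub>\<epsilon>\<close> and \<open>H = H\<^sub>\<epsilon>\<close>.\<close>

definition reduced_functional ::
  "real \<Rightarrow> ('a::euclidean_space \<Rightarrow> real) \<Rightarrow> 'a set \<Rightarrow> ('a \<Rightarrow> 'a \<Rightarrow> real) \<Rightarrow> 'a \<Rightarrow> real"
where
  "reduced_functional p w U H \<xi> =
     (LINT y:U|lborel. (LINT x:U|lborel.
        H x y * w (x - \<xi>) powr p * w (y - \<xi>) powr p))"

end

(*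
  A regular part H(.,y) is the solution in U = Omega_eps with exterior values Gamma(.-y).  By the
  maximum principle it is bounded below by a multiple of beta = Gamma * (Gamma(.-y) 1_{-U}), which
  solves the same equation and is at most a multiple of Gamma(.-y) outside U.  When d is small
  compared with 1/eps, a ball of radius comparable to d at distance comparable to d from xi lies
  outside U, so beta is at least of order d^n d^(-2(n+2s)) = d^(-(n+4s)) on the unit ball around xi,
  and w is bounded below there.

  The maximum principle comes from the Markov property of the form of (-Delta)^s: it is the
  increasing limit of the forms m <u - R_m u, u>, where R_m is convolution with the probability
  density of m (m + (-Delta)^s)^(-1), a rescaling of Gamma.  All of this takes place on the Fourier
  side, by Plancherel's theorem.

  Because the double integral is 0 unless the outer integrand is integrable, one also needs that
  y |-> int H(x,y) w(x-xi)^p dx is measurable and bounded on U.  It is continuous since solutions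
  depend continuously on exterior values, and it is bounded by sup w^p since Gamma has integral 1
  and H(.,y) is at most Gamma(.-y), up to a mollification of Gamma.
*)

theory Submission
  imports Defs "HOL-Probability.Characteristic_Functions" "HOL-Probability.Sinc_Integral"
begin

subsection \<open>Translations and dilations of Lebesgue measure\<close>

text \<open>Almost every function is kept in L1 and L2 at once. Its transform is then an honest
  integral, continuous and defined at every point, and the abstract L2 transform is required only
  for the half Laplacians, which are known through a choice operator and only up to null sets. The
  regular part qualifies because it is L2 on the bounded set U and equals \<Gamma>(x - y) outside.

  The obstacle is the singularity of \<Gamma>: neither L2 nor finite energy is available for it, so
  \<Gamma>(x - y) can be neither a competitor nor a comparison function. Two substitutes take its
  place. For continuity in y, an element of \<open>Hs\<close> that agrees with \<Gamma> off a small
  ball is borrowed from the regular part of a much smaller copy of the same domain. For the upper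
  bound, \<Gamma> is mollified; this spoils the exterior values slightly, and so the maximum
  principle is proved in a quantitative form, with an error measured in the energy norm that
  vanishes in the limit.\<close>

lemma nn_integral_lborel_affine:
  fixes f :: "'a::euclidean_space \<Rightarrow> ennreal"
  assumes [measurable]: "f \<in> borel_measurable borel" and c: "c \<noteq> 0"
  shows "(\<integral>\<^sup>+x. f x \<partial>lborel) = ennreal (\<bar>c\<bar> ^ DIM('a)) * (\<integral>\<^sup>+x. f (t + c *\<^sub>R x) \<partial>lborel)"
  by (subst lborel_affine[OF c, of t])
     (simp add: nn_integral_density nn_integral_distr nn_integral_cmult)

lemma integrable_lborel_affine:
  fixes f :: "'a::euclidean_space \<Rightarrow> 'b :: {banach, second_countable_topology}"
  assumes f: "integrable lborel f" and c: "c \<noteq> 0"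
  shows "integrable lborel (\<lambda>x. f (t + c *\<^sub>R x))"
proof -
  have m[measurable]: "f \<in> borel_measurable borel"
    using f[THEN borel_measurable_integrable] by simp
  have "(\<integral>\<^sup>+x. ennreal (norm (f x)) \<partial>lborel) < \<infinity>"
    using f unfolding integrable_iff_bounded by simp
  then show ?thesis
    unfolding integrable_iff_bounded
    by (subst (asm) nn_integral_lborel_affine[OF _ c, of _ t])
       (use c in \<open>auto simp: ennreal_mult_less_top ennreal_zero_less_mult_iff\<close>)
qed

lemma integrable_lborel_affine_iff:
  fixes f :: "'a::euclidean_space \<Rightarrow> 'b :: {banach, second_countable_topology}"
  assumes c: "c \<noteq> 0"
  shows "integrable lborel (\<lambda>x. f (t + c *\<^sub>R x)) \<longleftrightarrow> integrable lborel f"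
  using integrable_lborel_affine[of f c t] c
    integrable_lborel_affine[of "\<lambda>x. f (t + c *\<^sub>R x)" "1/c" "- t /\<^sub>R c"]
  by (auto simp: algebra_simps)

lemma integral_lborel_affine:
  fixes f :: "'a::euclidean_space \<Rightarrow> 'b :: {banach, second_countable_topology}"
  assumes c: "c \<noteq> 0"
  shows "(LINT x|lborel. f x) = \<bar>c\<bar> ^ DIM('a) *\<^sub>R (LINT x|lborel. f (t + c *\<^sub>R x))"
proof (cases "integrable lborel f")
  case True
  then have [measurable]: "f \<in> borel_measurable borel"
    using borel_measurable_integrable by fastforce
  show ?thesis
    by (subst lborel_affine[OF c, of t]) (simp add: integral_density integral_distr)
next
  case False
  then show ?thesis
    using integrable_lborel_affine_iff[OF c, of f t] by (simp add: not_integrable_integral_eq)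
qed

lemma integrable_lborel_translate_iff [simp]:
  fixes f :: "'a::euclidean_space \<Rightarrow> 'b :: {banach, second_countable_topology}"
  shows "integrable lborel (\<lambda>x. f (x + a)) \<longleftrightarrow> integrable lborel f"
    "integrable lborel (\<lambda>x. f (x - a)) \<longleftrightarrow> integrable lborel f"
    "integrable lborel (\<lambda>x. f (a - x)) \<longleftrightarrow> integrable lborel f"
  using integrable_lborel_affine_iff[of 1 f a] integrable_lborel_affine_iff[of 1 f "-a"]
    integrable_lborel_affine_iff[of "-1" f a]
  by (simp_all add: add.commute)

lemma integral_lborel_translate [simp]:
  fixes f :: "'a::euclidean_space \<Rightarrow> 'b :: {banach, second_countable_topology}"
  shows "(LINT x|lborel. f (x + a)) = (LINT x|lborel. f x)"
    "(LINT x|lborel. f (x - a)) = (LINT x|lborel. f x)"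
    "(LINT x|lborel. f (a - x)) = (LINT x|lborel. f x)"
  using integral_lborel_affine[of 1 f a] integral_lborel_affine[of 1 f "-a"]
    integral_lborel_affine[of "-1" f a]
  by (simp_all add: add.commute)

lemma integral_lborel_uminus:
  fixes f :: "'a::euclidean_space \<Rightarrow> 'b :: {banach, second_countable_topology}"
  shows "(LINT x|lborel. f (- x)) = (LINT x|lborel. f x)"
  using integral_lborel_translate(3)[of f 0] by simp

lemma integrable_lborel_uminus_iff:
  fixes f :: "'a::euclidean_space \<Rightarrow> 'b :: {banach, second_countable_topology}"
  shows "integrable lborel (\<lambda>x. f (- x)) \<longleftrightarrow> integrable lborel f"
  using integrable_lborel_translate_iff(3)[of f 0] by simp

section \<open>Continuity of translations in L1\<close>

lemma sets_and_emeasure_translate: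
  fixes A :: "'a::euclidean_space set"
  assumes "A \<in> sets borel"
  shows "{x. x + h \<in> A} \<in> sets borel" "emeasure lborel {x. x + h \<in> A} = emeasure lborel A"
proof -
  show "{x. x + h \<in> A} \<in> sets borel" using assms by measurable
  have "emeasure lborel A = emeasure (distr lborel borel ((+) h)) A" by (simp only: lborel_distr_plus)
  also have "\<dots> = emeasure lborel ((+) h -` A \<inter> space lborel)"
    by (rule emeasure_distr) (use assms in auto)
  also have "(+) h -` A \<inter> space lborel = {x. x + h \<in> A}" by (auto simp: add.commute)
  finally show "emeasure lborel {x. x + h \<in> A} = emeasure lborel A" by simp
qed

text \<open>Regularity squeezes A between a compact K and an open O'. A shift shorter than the
  distance from K to the complement of O' keeps points of K inside O'. So if x and x + h disagree
  about A, the one in A misses K, or else it lies in K and the other is in O' - A. This covers the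
  symmetric difference by four sets of measure at most e/4.\<close>

lemma L1_translation_indicator:
  fixes A :: "'a::euclidean_space set"
  assumes A: "A \<in> sets borel" "emeasure lborel A < \<infinity>" and e: "e > 0"
  shows "\<exists>r>0. \<forall>h. norm h < r \<longrightarrow> (LINT x|lborel. \<bar>indicator A (x + h) - indicator A x\<bar>) \<le> (e::real)"
proof -
  have leb: "A \<in> sets lebesgue" using A by auto
  obtain O' where O: "open O'" "A \<subseteq> O'" "O' - A \<in> lmeasurable" "emeasure lebesgue (O' - A) < ennreal (e/4)"
    using sets_lebesgue_outer_open[OF leb, of "e/4"] e by auto
  obtain C where C: "closed C" "C \<subseteq> A" "A - C \<in> lmeasurable" "emeasure lebesgue (A - C) < ennreal (e/8)"
    using sets_lebesgue_inner_closed[OF leb, of "e/8"] e by auto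
  \<comment> \<open>Inner regularity supplies only a closed C; cutting it with a large ball makes it
    compact at a further cost of e/8, so that A - K has measure at most e/4.\<close>
  have "(\<lambda>m. measure lborel (C \<inter> cball 0 (real m))) \<longlonglongrightarrow> measure lborel C"
  proof -
    have "emeasure lborel C \<le> emeasure lborel A" by (rule emeasure_mono) (use C A in auto)
    then have fin: "emeasure lborel C \<noteq> \<infinity>" using A by auto
    have U: "(\<Union>m. C \<inter> cball 0 (real m)) = C"
      using real_arch_simple by auto
    have "(\<lambda>m. measure lborel (C \<inter> cball 0 (real m))) \<longlonglongrightarrow> measure lborel (\<Union>m. C \<inter> cball 0 (real m))"
      by (rule Lim_measure_incseq) (use C fin in \<open>auto simp: incseq_def U[simplified]\<close>)
    then show ?thesis unfolding U .
  qed
  then obtain m where m: "measure lborel C - measure lborel (C \<inter> cball 0 (real m)) < e/8"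
    using LIMSEQ_D[of _ _ "e/8"] e by (smt (verit, best) le_refl real_norm_def zero_less_divide_iff)
  define K where "K = C \<inter> cball 0 (real m)"
  have K: "compact K" "K \<subseteq> A" using C by (auto simp: K_def)
  have Kb: "K \<in> sets borel" using K by (auto intro: borel_closed compact_imp_closed)
  obtain r where r: "r > 0" "\<And>x y. x \<in> K \<Longrightarrow> y \<in> - O' \<Longrightarrow> r \<le> dist x y"
  proof -
    have "K \<inter> - O' = {}" using K(2) O(2) by blast
    moreover have "closed (- O')" using O(1) by auto
    ultimately show ?thesis using separate_compact_closed[of K "- O'"] K(1) that by auto
  qed
  have fm: "X \<in> fmeasurable lborel" if "X \<in> sets borel" "X \<subseteq> O'" for X
  proof -
    have "O' - A \<in> sets borel" using O A by auto
    have "emeasure lborel O' \<le> emeasure lborel A + emeasure lborel (O' - A)"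
      using emeasure_subadditive[of A lborel "O' - A"] O A by (simp add: Un_absorb1 Un_Diff_cancel)
    also have "\<dots> < \<infinity>" using O A by (auto simp: \<open>O' - A \<in> sets borel\<close> less_top[symmetric] top_unique)
    finally have "emeasure lborel O' < \<infinity>" .
    moreover have "emeasure lborel X \<le> emeasure lborel O'" by (rule emeasure_mono) (use that O in auto)
    ultimately show ?thesis by (intro fmeasurableI) (use that in \<open>auto simp: order.strict_trans1\<close>)
  qed
  have OA: "measure lborel (O' - A) \<le> e/4"
  proof -
    have "emeasure lborel (O' - A) < ennreal (e/4)" using O A by auto
    then show ?thesis using e unfolding measure_def
      by (metis enn2real_leI less_eq_real_def divide_pos_pos zero_less_numeral less_imp_le)
  qed
  have AC: "measure lborel (A - C) \<le> e/8"
  proof -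
    have "emeasure lborel (A - C) < ennreal (e/8)" using C A by auto
    then show ?thesis using e unfolding measure_def
      by (metis enn2real_leI less_eq_real_def divide_pos_pos zero_less_numeral less_imp_le)
  qed
  have mA: "measure lborel (A - K) \<le> e/4"
  proof -
    have "measure lborel (A - K) = measure lborel A - measure lborel K"
      by (rule measure_Diff) (use A Kb K O in auto)
    moreover have "measure lborel (A - C) = measure lborel A - measure lborel C"
      by (rule measure_Diff) (use A C O in auto)
    ultimately show ?thesis using AC m by (simp add: K_def)
  qed
  have main: "(LINT x|lborel. \<bar>indicator A (x + h) - indicator A x\<bar>) \<le> (e::real)" if h: "norm h < r" for h
  proof -
    have inK: "x + h \<in> O'" if "x \<in> K" for x
      using r(2)[of x "x+h"] that h by (auto simp: dist_norm)
    have 1: "\<bar>indicator A (x + h) - indicator A x\<bar> \<le> indicator (A - K) x + (indicator (A-K) (x+h) + (indicator {x\<in>K. x + h \<in> O' - A} x + indicator {x. x + h \<in> K \<and> x \<notin> A} x) :: real)" for x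
      using inK[of x] K by (auto simp: indicator_def)
    define P where "P = {x\<in>K. x + h \<in> O' - A}"
    define Q where "Q = {x. x + h \<in> K \<and> x \<notin> A}"
    have inQ: "x \<in> O'" if "x \<in> Q" for x
      using r(2)[of "x+h" x] that h by (auto simp: dist_norm Q_def)
    have [measurable]: "A \<in> sets borel" "O' \<in> sets borel" "K \<in> sets borel" using A O Kb by auto
    have Pm: "P \<in> sets borel" and Qm: "Q \<in> sets borel"
      unfolding P_def Q_def by measurable
    have Pf: "P \<in> fmeasurable lborel" by (rule fm) (use Pm K O in \<open>auto simp: P_def\<close>)
    have Qf: "Q \<in> fmeasurable lborel" by (rule fm) (use Qm inQ in auto)
    have AK: "A - K \<in> fmeasurable lborel" by (rule fm) (use A Kb O in auto)
    have OAf: "O' - A \<in> fmeasurable lborel" by (rule fm) (use A O in auto)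
    have Pl: "measure lborel P \<le> e/4"
    proof -
      have "emeasure lborel P \<le> emeasure lborel {x. x + h \<in> O' - A}"
        by (rule emeasure_mono) (use sets_and_emeasure_translate(1)[of "O' - A" h] in \<open>auto simp: P_def\<close>)
      also have "\<dots> = emeasure lborel (O' - A)" by (rule sets_and_emeasure_translate) auto
      finally have "measure lborel P \<le> measure lborel (O' - A)"
        using OAf by (simp add: measure_def enn2real_mono fmeasurable_def less_top)
      then show ?thesis using OA by simp
    qed
    have Ql: "measure lborel Q \<le> e/4"
    proof -
      have "measure lborel Q \<le> measure lborel (O' - A)"
        by (rule measure_mono_fmeasurable) (use inQ OAf Qm in \<open>auto simp: Q_def\<close>)
      then show ?thesis using OA by simp
    qed
    have i1: "integrable lborel (indicator (A - K) :: _ \<Rightarrow> real)"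
      using AK by (auto simp: fmeasurable_def)
    have i2: "integrable lborel (\<lambda>x. indicator (A - K) (x + h) :: real)"
      using i1 by simp
    have i3: "integrable lborel (indicator P :: _ \<Rightarrow> real)" "integrable lborel (indicator Q :: _ \<Rightarrow> real)"
      using Pf Qf by (auto simp: fmeasurable_def)
    have "(LINT x|lborel. \<bar>indicator A (x + h) - indicator A x\<bar>) \<le>
       (LINT x|lborel. indicator (A - K) x + (indicator (A-K) (x+h) + (indicator P x + indicator Q x)) :: real)"
      by (rule integral_mono') (use 1 i1 i2 i3 in \<open>auto simp: P_def Q_def\<close>)
    also have "\<dots> = measure lborel (A - K) + (measure lborel (A - K) + (measure lborel P + measure lborel Q))"
      using i1 i2 i3 integral_lborel_translate(1)[of "indicator (A-K) :: _ \<Rightarrow> real" h]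
      by simp
    also have "\<dots> \<le> e" using mA Pl Ql by simp
    finally show ?thesis .
  qed
  show ?thesis using r(1) main by blast
qed

text \<open>Induction over integrable functions, starting from indicators. In the limit step the
  three errors are two copies of the L1 distance to an approximant, equal by translation invariance,
  and the approximant's own modulus of continuity.\<close>

lemma L1_translation_continuous:
  fixes f :: "'a::euclidean_space \<Rightarrow> real"
  assumes "integrable lborel f"
  shows "((\<lambda>h. LINT x|lborel. \<bar>f (x + h) - f x\<bar>) \<longlongrightarrow> 0) (at 0)"
proof -
  define P where "P f \<longleftrightarrow> (\<forall>e>0. \<exists>r>0. \<forall>h. norm h < r \<longrightarrow> (LINT x|lborel. \<bar>f (x + h) - f x\<bar>) \<le> e)"
    for f :: "'a \<Rightarrow> real"
  have "P f" using assms
  proof (induction rule: integrable_induct)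
    case (base A c)
    show ?case unfolding P_def
    proof (intro allI impI)
      fix e :: real assume e: "e > 0"
      obtain r where r: "r > 0" "\<And>h. norm h < r \<Longrightarrow>
        (LINT x|lborel. \<bar>indicator A (x + h) - indicator A x\<bar>) \<le> e / (\<bar>c\<bar> + 1)"
        using L1_translation_indicator[of A "e / (\<bar>c\<bar> + 1)"] base e by auto
      have "(LINT x|lborel. \<bar>indicator A (x + h) *\<^sub>R c - indicator A x *\<^sub>R c\<bar>) \<le> e" if h: "norm h < r" for h
      proof -
        have "(LINT x|lborel. \<bar>indicator A (x + h) *\<^sub>R c - indicator A x *\<^sub>R c\<bar>) =
          \<bar>c\<bar> * (LINT x|lborel. \<bar>indicator A (x + h) - indicator A x\<bar>)"
          unfolding integral_mult_right_zero[symmetric] abs_mult[symmetric]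
          by (simp add: algebra_simps)
        also have "\<dots> \<le> \<bar>c\<bar> * (e / (\<bar>c\<bar> + 1))" by (intro mult_left_mono r h) auto
        also have "\<dots> \<le> e" using e by (simp add: field_simps)
        finally show ?thesis .
      qed
      then show "\<exists>r>0. \<forall>h. norm h < r \<longrightarrow> (LINT x|lborel. \<bar>indicator A (x + h) *\<^sub>R c - indicator A x *\<^sub>R c\<bar>) \<le> e"
        using r(1) by blast
    qed
  next
    case (add f g)
    show ?case unfolding P_def
    proof (intro allI impI)
      fix e :: real assume e: "e > 0"
      obtain r1 where r1: "r1 > 0" "\<And>h. norm h < r1 \<Longrightarrow> (LINT x|lborel. \<bar>f (x + h) - f x\<bar>) \<le> e/2"
        using add e unfolding P_def by (meson half_gt_zero)
      obtain r2 where r2: "r2 > 0" "\<And>h. norm h < r2 \<Longrightarrow> (LINT x|lborel. \<bar>g (x + h) - g x\<bar>) \<le> e/2"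
        using add e unfolding P_def by (meson half_gt_zero)
      have "(LINT x|lborel. \<bar>f (x + h) + g (x + h) - (f x + g x)\<bar>) \<le> e" if h: "norm h < min r1 r2" for h
      proof -
        have "(LINT x|lborel. \<bar>f (x + h) + g (x + h) - (f x + g x)\<bar>) \<le> (LINT x|lborel. \<bar>f (x + h) - f x\<bar> + \<bar>g (x + h) - g x\<bar>)"
          by (rule integral_mono') (use add in auto)
        also have "\<dots> = (LINT x|lborel. \<bar>f (x + h) - f x\<bar>) + (LINT x|lborel. \<bar>g (x + h) - g x\<bar>)"
          using add by (intro Bochner_Integration.integral_add) auto
        also have "\<dots> \<le> e" using r1(2)[of h] r2(2)[of h] h by simp
        finally show ?thesis .
      qed
      then show "\<exists>r>0. \<forall>h. norm h < r \<longrightarrow> (LINT x|lborel. \<bar>f (x + h) + g (x + h) - (f x + g x)\<bar>) \<le> e"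
        using r1 r2 by (intro exI[of _ "min r1 r2"]) auto
    qed
  next
    case (lim f s)
    have lim3: "(\<lambda>i. s i x) \<longlonglongrightarrow> f x" for x using lim by auto
    have lim4: "\<bar>s i x\<bar> \<le> 2 * \<bar>f x\<bar>" for i x using lim by auto
    have lim2: "P (s i)" for i using lim by auto
    show ?case unfolding P_def
    proof (intro allI impI)
      fix e :: real assume e: "e > 0"
      have "(\<lambda>i. LINT x|lborel. \<bar>s i x - f x\<bar>) \<longlonglongrightarrow> (LINT x|(lborel::'a measure). 0)"
      proof (rule integral_dominated_convergence[where w="\<lambda>x. 3 * \<bar>f x\<bar>"])
        show "AE x in lborel. (\<lambda>i. \<bar>s i x - f x\<bar>) \<longlonglongrightarrow> 0"
          using lim3 by (auto intro!: tendsto_rabs_zero LIM_zero)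
        show "AE x in lborel. norm \<bar>s i x - f x\<bar> \<le> 3 * \<bar>f x\<bar>" for i
        proof (intro always_eventually allI)
          fix x show "norm \<bar>s i x - f x\<bar> \<le> 3 * \<bar>f x\<bar>" using lim4[of i x] by auto
        qed
      qed (use lim in auto)
      then have "\<forall>\<^sub>F i in sequentially. (LINT x|lborel. \<bar>s i x - f x\<bar>) < e/3"
        using e by (intro order_tendstoD(2)) auto
      then obtain i where i: "(LINT x|lborel. \<bar>s i x - f x\<bar>) < e/3"
        using eventually_happens' sequentially_bot by blast
      obtain r where r: "r > 0" "\<And>h. norm h < r \<Longrightarrow> (LINT x|lborel. \<bar>s i (x + h) - s i x\<bar>) \<le> e/3"
        using lim2[of i] e unfolding P_def by (metis divide_pos_pos zero_less_numeral)
      have "(LINT x|lborel. \<bar>f (x + h) - f x\<bar>) \<le> e" if h: "norm h < r" for h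
      proof -
        have i1: "integrable lborel (\<lambda>x. \<bar>s i x - f x\<bar>)" using lim by auto
        have i2: "integrable lborel (\<lambda>x. \<bar>s i (x + h) - f (x + h)\<bar>)"
          using i1 integrable_lborel_translate_iff(1)[of "\<lambda>x. \<bar>s i x - f x\<bar>" h] by blast
        have i3: "integrable lborel (\<lambda>x. \<bar>s i (x + h) - s i x\<bar>)" using lim by auto
        have "(LINT x|lborel. \<bar>f (x + h) - f x\<bar>) \<le> (LINT x|lborel. \<bar>s i (x + h) - f (x + h)\<bar> + (\<bar>s i (x + h) - s i x\<bar> + \<bar>s i x - f x\<bar>))"
          by (rule integral_mono') (use i1 i2 i3 in auto)
        also have "\<dots> = (LINT x|lborel. \<bar>s i (x + h) - f (x + h)\<bar>) + ((LINT x|lborel. \<bar>s i (x + h) - s i x\<bar>) + (LINT x|lborel. \<bar>s i x - f x\<bar>))"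
          using i1 i2 i3 by (simp del: integrable_lborel_translate_iff integral_lborel_translate)
        also have "(LINT x|lborel. \<bar>s i (x + h) - f (x + h)\<bar>) = (LINT x|lborel. \<bar>s i x - f x\<bar>)"
          using integral_lborel_translate(1)[of "\<lambda>x. \<bar>s i x - f x\<bar>" h] .
        finally show ?thesis using i r(2)[OF h] by simp
      qed
      then show "\<exists>r>0. \<forall>h. norm h < r \<longrightarrow> (LINT x|lborel. \<bar>f (x + h) - f x\<bar>) \<le> e"
        using r(1) by blast
    qed
  qed
  then show ?thesis
    unfolding P_def LIM_def
  proof (intro allI impI)
    fix e :: real assume e: "e > 0" and H: "\<forall>e>0. \<exists>r>0. \<forall>h. norm h < r \<longrightarrow> (LINT x|lborel. \<bar>f (x + h) - f x\<bar>) \<le> e"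
    obtain r where "r > 0" "\<And>h. norm h < r \<Longrightarrow> (LINT x|lborel. \<bar>f (x + h) - f x\<bar>) \<le> e/2"
      using H e by (meson half_gt_zero)
    then show "\<exists>r>0. \<forall>h. h \<noteq> 0 \<and> dist h 0 < r \<longrightarrow> dist (LINT x|lborel. \<bar>f (x + h) - f x\<bar>) 0 < e"
      using e by (intro exI[of _ r]) (fastforce simp: dist_norm)
  qed
qed

subsection \<open>Square integrable functions\<close>

text \<open>One notion for real and for complex values, since the functions are real and their
  transforms complex.\<close>

definition l2 :: "('a::euclidean_space \<Rightarrow> 'b::real_normed_field) \<Rightarrow> bool" where
  "l2 f \<longleftrightarrow> f \<in> borel_measurable borel \<and> integrable lborel (\<lambda>x. (norm (f x))\<^sup>2)"

definition l2norm :: "('a::euclidean_space \<Rightarrow> 'b::real_normed_field) \<Rightarrow> real" where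
  "l2norm f = sqrt (LINT x|lborel. (norm (f x))\<^sup>2)"

lemma l2norm_nonneg [simp]: "0 \<le> l2norm f"
  by (simp add: l2norm_def)

lemma l2norm_power2: "(l2norm f)\<^sup>2 = (LINT x|lborel. (norm (f x))\<^sup>2)"
  by (simp add: l2norm_def)

lemma square_integrable_iff_l2: "square_integrable u \<longleftrightarrow> l2 (u :: 'a::euclidean_space \<Rightarrow> real)"
  by (simp add: square_integrable_def l2_def)

lemma l2_of_real_iff:
  "l2 (\<lambda>x. complex_of_real (u x)) \<longleftrightarrow> l2 (u :: 'a::euclidean_space \<Rightarrow> real)"
proof -
  have "u \<in> borel_measurable borel" if "(\<lambda>x. complex_of_real (u x)) \<in> borel_measurable borel"
  proof -
    have "(\<lambda>x. Re (complex_of_real (u x))) \<in> borel_measurable borel" using that by measurable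
    then show ?thesis by simp
  qed
  moreover have "(\<lambda>x. complex_of_real (u x)) \<in> borel_measurable borel" if "u \<in> borel_measurable borel"
    using that by measurable
  ultimately show ?thesis unfolding l2_def norm_of_real real_norm_def by blast
qed

lemma l2D: 
  assumes "l2 f" 
  shows "f \<in> borel_measurable borel" "f \<in> borel_measurable lborel" "integrable lborel (\<lambda>x. (norm (f x))\<^sup>2)"
  using assms by (auto simp: l2_def)

lemma integrable_l2_mult:
  fixes f g :: "'a::euclidean_space \<Rightarrow> 'b::{real_normed_field,banach,second_countable_topology}"
  assumes f: "l2 f" and g: "l2 g"
  shows "integrable lborel (\<lambda>x. f x * g x)"
proof (rule Bochner_Integration.integrable_bound)
  show "integrable lborel (\<lambda>x. (norm (f x))\<^sup>2 + (norm (g x))\<^sup>2)"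
    using f g by (auto simp: l2_def)
  show "(\<lambda>x. f x * g x) \<in> borel_measurable lborel"
    using f g by (auto simp: l2_def)
  have "norm (f x * g x) \<le> (norm (f x))\<^sup>2 + (norm (g x))\<^sup>2" for x
    using sum_squares_bound[of "norm (f x)" "norm (g x)"] mult_nonneg_nonneg[OF norm_ge_zero[of "f x"] norm_ge_zero[of "g x"]] unfolding norm_mult
    by linarith
  then show "AE x in lborel. norm (f x * g x) \<le> norm ((norm (f x))\<^sup>2 + (norm (g x))\<^sup>2)" 
    by (intro always_eventually allI) (simp add: abs_of_nonneg)
qed

lemma l2_cnj [simp]: "l2 (\<lambda>x. cnj (f x)) \<longleftrightarrow> l2 f"
proof -
  have cnj_m: "cnj \<in> borel_measurable borel"
    by (intro borel_measurable_continuous_onI continuous_intros)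
  have "f \<in> borel_measurable borel" if "(\<lambda>x. cnj (f x)) \<in> borel_measurable borel"
  proof -
    have "(\<lambda>x. cnj (cnj (f x))) \<in> borel_measurable borel" 
      by (rule measurable_compose[OF that cnj_m])
    then show ?thesis by simp
  qed
  moreover have "(\<lambda>x. cnj (f x)) \<in> borel_measurable borel" if "f \<in> borel_measurable borel"
    by (rule measurable_compose[OF that cnj_m])
  ultimately show ?thesis unfolding l2_def complex_mod_cnj by blast
qed

lemma l2norm_cnj [simp]: "l2norm (\<lambda>x. cnj (f x)) = l2norm f"
  by (simp add: l2norm_def)

lemma l2_norm: "l2 f \<Longrightarrow> l2 (\<lambda>x. norm (f x))"
  by (auto simp: l2_def)

lemma l2_add:
  fixes f g :: "'a::euclidean_space \<Rightarrow> 'b::{real_normed_field,banach,second_countable_topology}"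
  assumes f: "l2 f" and g: "l2 g"
  shows "l2 (\<lambda>x. f x + g x)"
  unfolding l2_def
proof
  have [measurable]: "f \<in> borel_measurable borel" "g \<in> borel_measurable borel" using f g by (auto simp: l2_def)
  show "(\<lambda>x. f x + g x) \<in> borel_measurable borel" by measurable
  show "integrable lborel (\<lambda>x. (norm (f x + g x))\<^sup>2)"
  proof (rule Bochner_Integration.integrable_bound)
    show "integrable lborel (\<lambda>x. 2 * (norm (f x))\<^sup>2 + 2 * (norm (g x))\<^sup>2)"
      using f g by (auto simp: l2_def)
    have "(norm (f x + g x))\<^sup>2 \<le> 2 * (norm (f x))\<^sup>2 + 2 * (norm (g x))\<^sup>2" for x
    proof -
      have "(norm (f x + g x))\<^sup>2 \<le> (norm (f x) + norm (g x))\<^sup>2"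
        by (intro power_mono norm_triangle_ineq) auto
      also have "\<dots> \<le> 2 * (norm (f x))\<^sup>2 + 2 * (norm (g x))\<^sup>2"
        using sum_squares_bound[of "norm (f x)" "norm (g x)"] by (simp add: power2_sum)
      finally show ?thesis .
    qed
    then show "AE x in lborel. norm ((norm (f x + g x))\<^sup>2) \<le> norm (2 * (norm (f x))\<^sup>2 + 2 * (norm (g x))\<^sup>2)"
      by (intro always_eventually allI) (simp add: abs_of_nonneg)
  qed measurable
qed

lemma l2_cmult:
  fixes f :: "'a::euclidean_space \<Rightarrow> 'b::{real_normed_field,banach,second_countable_topology}"
  assumes f: "l2 f"
  shows "l2 (\<lambda>x. c * f x)"
  using f by (auto simp: l2_def norm_mult power_mult_distrib)

lemma l2_diff:
  fixes f g :: "'a::euclidean_space \<Rightarrow> 'b::{real_normed_field,banach,second_countable_topology}"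
  assumes f: "l2 f" and g: "l2 g"
  shows "l2 (\<lambda>x. f x - g x)"
  using l2_add[OF f l2_cmult[OF g, of "-1"]] by simp

lemma l2_bound:
  fixes f :: "'a::euclidean_space \<Rightarrow> 'b::real_normed_field" and g :: "'a \<Rightarrow> 'c::real_normed_field"
  assumes "l2 f" "g \<in> borel_measurable borel" "AE x in lborel. norm (g x) \<le> norm (f x)"
  shows "l2 g"
  unfolding l2_def
proof
  have [measurable]: "g \<in> borel_measurable borel" by fact
  show "integrable lborel (\<lambda>x. (norm (g x))\<^sup>2)"
    by (rule Bochner_Integration.integrable_bound[OF l2D(3)[OF assms(1)]])
       (use assms(3) in \<open>auto elim!: eventually_mono intro: power_mono\<close>)
qed fact

lemma l2_translate:
  "l2 f \<Longrightarrow> l2 (\<lambda>x. f (x + a))" "l2 f \<Longrightarrow> l2 (\<lambda>x. f (x - a))" "l2 f \<Longrightarrow> l2 (\<lambda>x. f (a - x))"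
  unfolding l2_def using integrable_lborel_translate_iff[of "\<lambda>x. (norm (f x))\<^sup>2" a]
  by auto

lemma l2_uminus: "l2 f \<Longrightarrow> l2 (\<lambda>x. f (- x))"
  using l2_translate(3)[of f 0] by simp

lemma bounded_integrable_l2:
  fixes f :: "'a::euclidean_space \<Rightarrow> 'b::{real_normed_field,banach,second_countable_topology}"
  assumes "integrable lborel f" "\<And>x. norm (f x) \<le> B"
  shows "l2 f"
proof -
  have m[measurable]: "f \<in> borel_measurable borel" using borel_measurable_integrable[OF assms(1)] by simp
  have "integrable lborel (\<lambda>x. (norm (f x))\<^sup>2)"
  proof (rule Bochner_Integration.integrable_bound)
    show "integrable lborel (\<lambda>x. B * norm (f x))" using assms by auto
    have "(norm (f x))\<^sup>2 \<le> B * norm (f x)" for x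
      unfolding power2_eq_square by (intro mult_right_mono assms) auto
    then show "AE x in lborel. norm ((norm (f x))\<^sup>2) \<le> norm (B * norm (f x))"
      by (intro always_eventually allI) (auto intro: order_trans[OF _ abs_ge_self])
  qed measurable
  then show ?thesis by (simp add: l2_def)
qed

text \<open>Integrate 2ab \<le> t a^2 + b^2 / t and take for t the ratio of the norms. If a norm
  vanishes this ratio degenerates; then a finite t, chosen in terms of the integral I itself,
  contradicts I > 0.\<close>

lemma l2_Cauchy_Schwarz_norm:
  fixes f :: "'a::euclidean_space \<Rightarrow> 'b::{real_normed_field,banach,second_countable_topology}"
    and g :: "'a::euclidean_space \<Rightarrow> 'c::{real_normed_field,banach,second_countable_topology}"
  assumes f: "l2 f" and g: "l2 g"
  shows "(LINT x|lborel. norm (f x) * norm (g x)) \<le> l2norm f * l2norm g"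
proof -
  define I where "I = (LINT x|lborel. norm (f x) * norm (g x))"
  have int: "integrable lborel (\<lambda>x. norm (f x) * norm (g x))"
    using integrable_l2_mult[OF l2_norm[OF f] l2_norm[OF g]] .
  have key: "2 * I \<le> t * (l2norm f)\<^sup>2 + (l2norm g)\<^sup>2 / t" if t: "t > 0" for t
  proof -
    have "2 * I = (LINT x|lborel. 2 * (norm (f x) * norm (g x)))" by (simp add: I_def)
    also have "\<dots> \<le> (LINT x|lborel. t * (norm (f x))\<^sup>2 + (norm (g x))\<^sup>2 / t)"
    proof (rule integral_mono)
      fix x
      have "0 \<le> (sqrt t * norm (f x) - norm (g x) / sqrt t)\<^sup>2" by simp
      also have "\<dots> = t * (norm (f x))\<^sup>2 + (norm (g x))\<^sup>2 / t - 2 * (norm (f x) * norm (g x))"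
        using t by (simp add: power2_diff power_mult_distrib power_divide)
      finally show "2 * (norm (f x) * norm (g x)) \<le> t * (norm (f x))\<^sup>2 + (norm (g x))\<^sup>2 / t" by simp
    qed (use int f g in \<open>auto simp: l2_def\<close>)
    also have "\<dots> = t * (l2norm f)\<^sup>2 + (l2norm g)\<^sup>2 / t"
      using f g by (simp add: l2norm_power2 l2_def)
    finally show ?thesis .
  qed
  show ?thesis
  proof (cases "l2norm f = 0 \<or> l2norm g = 0")
    case True
    have "I \<le> 0"
    proof (rule ccontr)
      assume "\<not> I \<le> 0"
      then have I: "I > 0" by simp
      from True show False
      proof
        assume "l2norm f = 0"
        then have "2 * I \<le> (l2norm g)\<^sup>2 / ((l2norm g)\<^sup>2 / I + 1)"
          using key[of "(l2norm g)\<^sup>2 / I + 1"] I by (simp add: add_nonneg_pos)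
        also have "\<dots> < 2 * I" using I by (simp add: field_simps add_pos_nonneg)
        finally show False by simp
      next
        assume "l2norm g = 0"
        then have "2 * I \<le> I / ((l2norm f)\<^sup>2 + 1) * (l2norm f)\<^sup>2"
          using key[of "I / ((l2norm f)\<^sup>2 + 1)"] I by (simp add: add_nonneg_pos)
        also have "\<dots> \<le> I" using I by (simp add: field_simps add_pos_nonneg)
        finally show False using I by simp
      qed
    qed
    then show ?thesis using True by (auto simp: I_def)
  next
    case False
    then have p: "l2norm f > 0" "l2norm g > 0" by (simp_all add: order_less_le)
    have "2 * I \<le> l2norm g / l2norm f * (l2norm f)\<^sup>2 + (l2norm g)\<^sup>2 / (l2norm g / l2norm f)"
      using key[of "l2norm g / l2norm f"] p by simp
    also have "\<dots> = 2 * (l2norm f * l2norm g)" using p by (simp add: field_simps power2_eq_square)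
    finally show ?thesis by (simp add: I_def)
  qed
qed

lemma l2_Cauchy_Schwarz:
  fixes f g :: "'a::euclidean_space \<Rightarrow> 'b::{real_normed_field,banach,second_countable_topology}"
  assumes f: "l2 f" and g: "l2 g"
  shows "norm (LINT x|lborel. f x * g x) \<le> l2norm f * l2norm g"
proof -
  have "norm (LINT x|lborel. f x * g x) \<le> (LINT x|lborel. norm (f x * g x))"
    by (rule integral_norm_bound)
  also have "\<dots> \<le> l2norm f * l2norm g"
    using l2_Cauchy_Schwarz_norm[OF f g] by (simp add: norm_mult)
  finally show ?thesis .
qed

lemma l2norm_triangle:
  fixes f g :: "'a::euclidean_space \<Rightarrow> 'b::{real_normed_field,banach,second_countable_topology}"
  assumes f: "l2 f" and g: "l2 g"
  shows "l2norm (\<lambda>x. f x + g x) \<le> l2norm f + l2norm g"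
proof (rule power2_le_imp_le)
  have i: "integrable lborel (\<lambda>x. norm (f x) * norm (g x))"
    using integrable_l2_mult[OF l2_norm[OF f] l2_norm[OF g]] .
  have "(l2norm (\<lambda>x. f x + g x))\<^sup>2 \<le> (LINT x|lborel. (norm (f x))\<^sup>2 + (norm (g x))\<^sup>2 + 2 * (norm (f x) * norm (g x)))"
    unfolding l2norm_power2
  proof (rule integral_mono)
    fix x
    have "(norm (f x + g x))\<^sup>2 \<le> (norm (f x) + norm (g x))\<^sup>2"
      by (intro power_mono norm_triangle_ineq) auto
    then show "(norm (f x + g x))\<^sup>2 \<le> (norm (f x))\<^sup>2 + (norm (g x))\<^sup>2 + 2 * (norm (f x) * norm (g x))"
      by (simp add: power2_sum algebra_simps)
  qed (use i l2_add[OF f g] f g in \<open>auto simp: l2_def\<close>)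
  also have "\<dots> = (l2norm f)\<^sup>2 + (l2norm g)\<^sup>2 + 2 * (LINT x|lborel. norm (f x) * norm (g x))"
    using f g i by (simp add: l2norm_power2 l2_def)
  also have "\<dots> \<le> (l2norm f + l2norm g)\<^sup>2"
    using l2_Cauchy_Schwarz_norm[OF f g] by (simp add: power2_sum)
  finally show "(l2norm (\<lambda>x. f x + g x))\<^sup>2 \<le> (l2norm f + l2norm g)\<^sup>2" .
qed simp

lemma l2_eq_0_AE:
  assumes "l2 f" "l2norm f = 0"
  shows "AE x in lborel. f x = 0"
proof -
  have "(LINT x|lborel. (norm (f x))\<^sup>2) = 0" using assms(2) by (simp add: l2norm_def)
  then have "AE x in lborel. (norm (f x))\<^sup>2 = 0"
    using integral_nonneg_eq_0_iff_AE[OF l2D(3)[OF assms(1)]] by auto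
  then show ?thesis by eventually_elim simp
qed

text \<open>Reduction to L1: f |f| is integrable, and the squared increment of f is at most twice
  the increment of f |f|.\<close>

lemma l2_translation_continuous_real:
  fixes f :: "'a::euclidean_space \<Rightarrow> real"
  assumes f: "l2 f"
  shows "((\<lambda>h. LINT x|lborel. (f (x + h) - f x)\<^sup>2) \<longlongrightarrow> 0) (at 0)"
proof (rule tendsto_sandwich[where f="\<lambda>_. 0" and h="\<lambda>h. 2 * (LINT x|lborel. \<bar>f (x + h) * \<bar>f (x + h)\<bar> - f x * \<bar>f x\<bar>\<bar>)"])
  have [measurable]: "f \<in> borel_measurable borel" using f by (auto simp: l2_def)
  have i: "integrable lborel (\<lambda>x. f x * \<bar>f x\<bar>)"
    by (rule Bochner_Integration.integrable_bound[OF l2D(3)[OF f]])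
       (auto simp: abs_mult power2_eq_square)
  show "((\<lambda>h. 2 * (LINT x|lborel. \<bar>f (x + h) * \<bar>f (x + h)\<bar> - f x * \<bar>f x\<bar>\<bar>)) \<longlongrightarrow> 0) (at 0)"
    using tendsto_mult_left[OF L1_translation_continuous[OF i], of 2] by simp
  \<comment> \<open>For equal signs the right side contains the factor |a + b|, which dominates |a -
    b|; for opposite signs it is 2 (a^2 + b^2).\<close>
  have el: "(a - b)\<^sup>2 \<le> 2 * \<bar>a * \<bar>a\<bar> - b * \<bar>b\<bar>\<bar>" for a b :: real
  proof -
    have A: "(a - b)\<^sup>2 \<le> 2 * \<bar>a * \<bar>a\<bar> - b * \<bar>b\<bar>\<bar>" if "b \<le> a" for a b :: real
    proof -
      consider "0 \<le> b" | "b < 0" "0 \<le> a" | "a < 0" using that by linarith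
      then show ?thesis
      proof cases
        case 1
        have "(a - b) * (a - b) \<le> (a - b) * (a + b)" using that 1 by (intro mult_left_mono) auto
        moreover have "0 \<le> (a-b)*(a+b)" using that 1 by auto
        ultimately show ?thesis using that 1 by (auto simp: algebra_simps power2_eq_square)
      next
        case 2
        have "(a - b)\<^sup>2 \<le> 2 * (a*a + b*b)" using zero_le_power2[of "a+b"] by (simp add: algebra_simps power2_eq_square)
        then show ?thesis using 2 by simp
      next
        case 3
        have "(a - b) * (a - b) \<le> (a - b) * (- a - b)" using that 3 by (intro mult_left_mono) auto
        moreover have nn: "0 \<le> (a-b)*(-a-b)" using that 3 by auto
        moreover have eq: "a * \<bar>a\<bar> - b * \<bar>b\<bar> = (a - b) * (- a - b)"
          using that 3 by (simp add: algebra_simps)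
        ultimately show ?thesis unfolding power2_eq_square eq abs_of_nonneg[OF nn] by linarith
      qed
    qed
    show ?thesis
    proof (cases "b \<le> a")
      case True then show ?thesis by (rule A)
    next
      case False
      then show ?thesis using A[of a b] by (simp add: power2_commute abs_minus_commute)
    qed
  qed
  have "(LINT x|lborel. (f (x + h) - f x)\<^sup>2) \<le> 2 * (LINT x|lborel. \<bar>f (x + h) * \<bar>f (x + h)\<bar> - f x * \<bar>f x\<bar>\<bar>)" for h
  proof -
    have i2: "integrable lborel (\<lambda>x. f (x + h) * \<bar>f (x + h)\<bar>)"
      using i integrable_lborel_translate_iff(1)[of "\<lambda>x. f x * \<bar>f x\<bar>" h] by blast
    show ?thesis
      unfolding integral_mult_right_zero[symmetric]
      by (rule integral_mono') (use i i2 el in auto)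
  qed
  then show "\<forall>\<^sub>F h in at 0. (LINT x|lborel. (f (x + h) - f x)\<^sup>2) \<le> 2 * (LINT x|lborel. \<bar>f (x + h) * \<bar>f (x + h)\<bar> - f x * \<bar>f x\<bar>\<bar>)"
    by simp
qed auto

lemma l2_Re_Im:
  assumes "l2 f"
  shows "l2 (\<lambda>x. Re (f x))" "l2 (\<lambda>x. Im (f x))"
proof -
  have [measurable]: "f \<in> borel_measurable borel" using assms by (auto simp: l2_def)
  show "l2 (\<lambda>x. Re (f x))" "l2 (\<lambda>x. Im (f x))"
    by (rule l2_bound[OF assms]; auto simp: abs_Re_le_cmod abs_Im_le_cmod)+
qed

lemma l2_translation_continuous:
  fixes f :: "'a::euclidean_space \<Rightarrow> complex"
  assumes f: "l2 f"
  shows "((\<lambda>h. l2norm (\<lambda>x. f (x + h) - f x)) \<longlongrightarrow> 0) (at 0)"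
proof -
  note ri = l2_Re_Im[OF f]
  have "((\<lambda>h. sqrt ((LINT x|lborel. (Re (f (x + h)) - Re (f x))\<^sup>2) + (LINT x|lborel. (Im (f (x + h)) - Im (f x))\<^sup>2))) \<longlongrightarrow> sqrt (0 + 0)) (at 0)"
    by (intro tendsto_real_sqrt tendsto_add l2_translation_continuous_real ri)
  moreover have "l2norm (\<lambda>x. f (x + h) - f x) = sqrt ((LINT x|lborel. (Re (f (x + h)) - Re (f x))\<^sup>2) + (LINT x|lborel. (Im (f (x + h)) - Im (f x))\<^sup>2))" for h
  proof -
    have "integrable lborel (\<lambda>x. (Re (f (x + h)) - Re (f x))\<^sup>2)" "integrable lborel (\<lambda>x. (Im (f (x + h)) - Im (f x))\<^sup>2)"
      using l2D(3)[OF l2_diff[OF l2_translate(1)[OF ri(1)] ri(1)]] l2D(3)[OF l2_diff[OF l2_translate(1)[OF ri(2)] ri(2)]]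
      by auto
    then show ?thesis by (simp add: l2norm_def cmod_power2)
  qed
  ultimately show ?thesis by simp
qed

subsection \<open>The Fourier transform and Plancherel's theorem\<close>

lemma cis_inner_measurable [measurable]:
  "(\<lambda>x::'a::euclidean_space. cis (k \<bullet> x)) \<in> borel_measurable borel"
  by (intro borel_measurable_continuous_onI continuous_intros)

lemma cis_borel_measurable [measurable]: "cis \<in> borel_measurable borel"
  by (intro borel_measurable_continuous_onI continuous_intros)

text \<open>The normalization of \<open>fourier\<close>, without a constant in front; hence the
  factor (2 pi)^n in Plancherel's identity.\<close>

definition ft :: "('a::euclidean_space \<Rightarrow> complex) \<Rightarrow> 'a \<Rightarrow> complex" where
  "ft f k = (LINT x|lborel. f x * cis (- (k \<bullet> x)))"

lemma fourier_eq_ft: "fourier \<phi> = ft (\<lambda>x. complex_of_real (\<phi> x))"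
  by (simp add: fun_eq_iff fourier_def ft_def scaleR_conv_of_real)

lemma integrable_ft:
  assumes "integrable lborel f"
  shows "integrable lborel (\<lambda>x. f x * cis (- (k \<bullet> x)))" "integrable lborel (\<lambda>x. f x * cis (k \<bullet> x))"
  by (rule Bochner_Integration.integrable_bound[OF assms];
      use borel_measurable_integrable[OF assms] in \<open>simp add: norm_mult\<close>)+

lemma ft_measurable [measurable]:
  assumes "integrable lborel f"
  shows "ft f \<in> borel_measurable borel"
proof -
  have [measurable]: "f \<in> borel_measurable borel" using borel_measurable_integrable[OF assms] by simp
  show ?thesis unfolding ft_def[abs_def] by measurable
qed

lemma norm_ft_le: "norm (ft f k) \<le> (LINT x|lborel. norm (f x))"
proof -
  have "norm (ft f k) \<le> (LINT x|lborel. norm (f x * cis (- (k \<bullet> x))))"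
    unfolding ft_def by (rule integral_norm_bound)
  then show ?thesis by (simp add: norm_mult)
qed

lemma ft_add: "integrable lborel f \<Longrightarrow> integrable lborel g \<Longrightarrow> ft (\<lambda>x. f x + g x) k = ft f k + ft g k"
  unfolding ft_def distrib_right by (intro Bochner_Integration.integral_add integrable_ft)

lemma ft_diff: "integrable lborel f \<Longrightarrow> integrable lborel g \<Longrightarrow> ft (\<lambda>x. f x - g x) k = ft f k - ft g k"
  unfolding ft_def left_diff_distrib by (intro Bochner_Integration.integral_diff integrable_ft)

lemma ft_cmult: "ft (\<lambda>x. c * f x) k = c * ft f k"
  unfolding ft_def mult.assoc by simp

lemma ft_translate: "ft (\<lambda>x. f (x - a)) k = cis (- (k \<bullet> a)) * ft f k"
proof -
  have "ft (\<lambda>x. f (x - a)) k = (LINT x|lborel. (\<lambda>x. f x * cis (- (k \<bullet> (x + a)))) (x - a))"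
    by (simp add: ft_def)
  also have "\<dots> = (LINT x|lborel. f x * cis (- (k \<bullet> (x + a))))"
    by (rule integral_lborel_translate(2))
  also have "\<dots> = (LINT x|lborel. cis (- (k \<bullet> a)) * (f x * cis (- (k \<bullet> x))))"
  proof -
    have "cis (- (k \<bullet> (x + a))) = cis (- (k \<bullet> a)) * cis (- (k \<bullet> x))" for x
      unfolding cis_mult inner_add_right by (simp add: algebra_simps)
    then show ?thesis by (simp only: mult.left_commute)
  qed
  finally show ?thesis by (simp add: ft_def)
qed

lemma ft_cnj_uminus: "ft (\<lambda>x. cnj (f (- x))) k = cnj (ft f k)"
proof -
  have "ft (\<lambda>x. cnj (f (- x))) k = (LINT x|lborel. (\<lambda>x. cnj (f (- x)) * cis (- (k \<bullet> x))) (- x))"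
    unfolding ft_def by (rule integral_lborel_uminus[symmetric])
  also have "\<dots> = (LINT x|lborel. cnj (f x * cis (- (k \<bullet> x))))"
    by (simp add: cis_cnj)
  also have "\<dots> = cnj (LINT x|lborel. f x * cis (- (k \<bullet> x)))"
    by (rule Bochner_Integration.integral_cnj)
  finally show ?thesis by (simp add: ft_def)
qed

lemma ft_uminus_real: "ft (\<lambda>x. complex_of_real (f x)) (- k) = cnj (ft (\<lambda>x. complex_of_real (f x)) k)"
proof -
  have "ft (\<lambda>x. complex_of_real (f x)) (- k) = (LINT x|lborel. cnj (complex_of_real (f x) * cis (- (k \<bullet> x))))"
    by (simp add: ft_def cis_cnj)
  also have "\<dots> = cnj (ft (\<lambda>x. complex_of_real (f x)) k)"
    unfolding ft_def by (rule Bochner_Integration.integral_cnj)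
  finally show ?thesis .
qed

lemma ft_scale:
  fixes f :: "'a::euclidean_space \<Rightarrow> complex"
  assumes "c \<noteq> 0"
  shows "ft (\<lambda>x. f (c *\<^sub>R x)) k = ft f (k /\<^sub>R c) /\<^sub>R \<bar>c\<bar> ^ DIM('a)"
proof -
  have "ft f (k /\<^sub>R c) = \<bar>c\<bar> ^ DIM('a) *\<^sub>R ft (\<lambda>x. f (c *\<^sub>R x)) k"
    unfolding ft_def using assms integral_lborel_affine[OF assms, of "\<lambda>x. f x * cis (- ((k /\<^sub>R c) \<bullet> x))" 0]
    by (simp add: mult.assoc[symmetric])
  then show ?thesis using assms by simp
qed

lemma integrable_product:
  fixes f g :: "'a::euclidean_space \<Rightarrow> 'b::{real_normed_field,banach,second_countable_topology}"
  assumes f: "integrable lborel f" and g: "integrable lborel g"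
  shows "integrable (lborel \<Otimes>\<^sub>M lborel) (\<lambda>(x, y). f x * g y)"
proof -
  have [measurable]: "f \<in> borel_measurable borel" "g \<in> borel_measurable borel"
    using borel_measurable_integrable[OF f] borel_measurable_integrable[OF g] by auto
  show ?thesis
    by (rule lborel_pair.Fubini_integrable) (use f g in \<open>auto simp: norm_mult\<close>)
qed

text \<open>Fubini. With a wide Gaussian as one factor it gives inversion at a point; with a
  weighted transform of a test function it evaluates pairings with
  \<open>frac_laplacian\<close>.\<close>

lemma ft_mult_formula:
  assumes f: "integrable lborel f" and g: "integrable lborel g"
  shows "(LINT k|lborel. ft f k * g k) = (LINT x|lborel. f x * ft g x)"
proof -
  have [measurable]: "f \<in> borel_measurable borel" "g \<in> borel_measurable borel"
    using borel_measurable_integrable[OF f] borel_measurable_integrable[OF g] by auto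
  have i: "integrable (lborel \<Otimes>\<^sub>M lborel) (\<lambda>(x, k). f x * g k * cis (- (k \<bullet> x)))"
    by (rule Bochner_Integration.integrable_bound[OF integrable_product[OF f g]])
       (auto simp: norm_mult split_beta)
  have "(LINT k|lborel. ft f k * g k) = (LINT k|lborel. LINT x|lborel. f x * g k * cis (- (k \<bullet> x)))"
    unfolding ft_def integral_mult_left_zero[symmetric] by (simp add: ac_simps)
  also have "\<dots> = (LINT x|lborel. LINT k|lborel. f x * g k * cis (- (k \<bullet> x)))"
    by (rule lborel_pair.Fubini_integral[OF i])
  also have "\<dots> = (LINT x|lborel. f x * ft g x)"
    unfolding ft_def integral_mult_right_zero[symmetric] by (simp add: ac_simps inner_commute)
  finally show ?thesis .
qed

definition conv :: "('a::euclidean_space \<Rightarrow> 'b) \<Rightarrow> ('a \<Rightarrow> 'b) \<Rightarrow> 'a \<Rightarrow> 'b::{real_normed_field,banach,second_countable_topology}" where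
  "conv f g x = (LINT y|lborel. f (x - y) * g y)"

lemma integrable_conv_pair:
  fixes f g :: "'a::euclidean_space \<Rightarrow> 'b::{real_normed_field,banach,second_countable_topology}"
  assumes f: "integrable lborel f" and g: "integrable lborel g"
  shows "integrable (lborel \<Otimes>\<^sub>M lborel) (\<lambda>(y, x). f (x - y) * g y)"
proof -
  have [measurable]: "f \<in> borel_measurable borel" "g \<in> borel_measurable borel"
    using borel_measurable_integrable[OF f] borel_measurable_integrable[OF g] by auto
  show ?thesis
  proof (rule lborel_pair.Fubini_integrable)
    have "(LINT x|lborel. norm (f (x - y))) = (LINT x|lborel. norm (f x))" for y
      using integral_lborel_translate(2)[of "\<lambda>x. norm (f x)" y] .
    then show "integrable lborel (\<lambda>y. LINT x|lborel. norm (case (y, x) of (y, x) \<Rightarrow> f (x - y) * g y))"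
      using f g by (simp add: norm_mult)
  qed (use f g in auto)
qed

lemma conv_measurable [measurable]:
  fixes f g :: "'a::euclidean_space \<Rightarrow> 'b::{real_normed_field,banach,second_countable_topology}"
  assumes [measurable]: "f \<in> borel_measurable borel" "g \<in> borel_measurable borel"
  shows "conv f g \<in> borel_measurable borel"
  unfolding conv_def[abs_def] by measurable

lemma integrable_conv:
  fixes f g :: "'a::euclidean_space \<Rightarrow> 'b::{real_normed_field,banach,second_countable_topology}"
  assumes f: "integrable lborel f" and g: "integrable lborel g"
  shows "integrable lborel (conv f g)"
  unfolding conv_def[abs_def]
  using lborel_pair.integrable_snd[of "\<lambda>y x. f (x - y) * g y"] integrable_conv_pair[OF f g] by simp

lemma ft_conv:
  assumes f: "integrable lborel f" and g: "integrable lborel g"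
  shows "ft (conv f g) k = ft f k * ft g k"
proof -
  have [measurable]: "f \<in> borel_measurable borel" "g \<in> borel_measurable borel"
    using borel_measurable_integrable[OF f] borel_measurable_integrable[OF g] by auto
  have i: "integrable (lborel \<Otimes>\<^sub>M lborel) (\<lambda>(y, x). f (x - y) * g y * cis (- (k \<bullet> x)))"
    by (rule Bochner_Integration.integrable_bound[OF integrable_conv_pair[OF f g]])
       (auto simp: norm_mult split_beta)
  have "ft (conv f g) k = (LINT x|lborel. LINT y|lborel. f (x - y) * g y * cis (- (k \<bullet> x)))"
    unfolding ft_def conv_def by simp
  also have "\<dots> = (LINT y|lborel. LINT x|lborel. f (x - y) * g y * cis (- (k \<bullet> x)))"
    by (rule lborel_pair.Fubini_integral[OF i])
  also have "\<dots> = (LINT y|lborel. g y * ft (\<lambda>x. f (x - y)) k)"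
    unfolding ft_def integral_mult_right_zero[symmetric] by (simp add: ac_simps)
  also have "\<dots> = (LINT y|lborel. ft f k * (g y * cis (- (k \<bullet> y))))"
    unfolding ft_translate by (simp add: ac_simps)
  also have "\<dots> = ft f k * ft g k" by (simp add: ft_def)
  finally show ?thesis .
qed

section \<open>Gaussians, Gauss summability and Plancherel's identity\<close>

lemma integral_normal_density_cis:
  "(LINT t|lborel. complex_of_real (exp (- t\<^sup>2 / 2)) * cis (- (a * t))) = of_real (sqrt (2 * pi) * exp (- a\<^sup>2 / 2))"
proof -
  have "complex_of_real (exp (- a\<^sup>2 / 2)) = char std_normal_distribution (- a)"
    unfolding char_std_normal_distribution by simp
  also have "\<dots> = (LINT t|lborel. std_normal_density t *\<^sub>R cis (- (a * t)))"
    unfolding char_def by (subst integral_density) (auto simp: cis_conv_exp normal_density_nonneg)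
  also have "\<dots> = (LINT t|lborel. (1 / of_real (sqrt (2 * pi))) * (complex_of_real (exp (- t\<^sup>2 / 2)) * cis (- (a * t))))"
    by (intro Bochner_Integration.integral_cong) (auto simp: std_normal_density_def scaleR_conv_of_real)
  also have "\<dots> = (1 / of_real (sqrt (2 * pi))) * (LINT t|lborel. complex_of_real (exp (- t\<^sup>2 / 2)) * cis (- (a * t)))"
    by simp
  finally show ?thesis by (simp add: field_simps)
qed

lemma integrable_normal_cis:
  "integrable lborel (\<lambda>t. complex_of_real (exp (- t\<^sup>2 / 2)) * cis (- (a * t)))"
proof (rule Bochner_Integration.integrable_bound)
  have "integrable lborel (\<lambda>t. sqrt (2 * pi) * std_normal_density t)"
    using integrable_std_normal_moment[of 0] by simp
  then show "integrable lborel (\<lambda>t::real. exp (- t\<^sup>2 / 2))"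
    by (simp add: std_normal_density_def)
qed (auto simp: norm_mult)

definition gauss :: "'a::euclidean_space \<Rightarrow> real" where
  "gauss x = exp (- (x \<bullet> x) / 2)"

lemma gauss_measurable [measurable]: "gauss \<in> borel_measurable borel"
  unfolding gauss_def[abs_def] by measurable

text \<open>The integrand factorizes over the coordinates, so both claims follow from the
  characteristic function of the one-dimensional normal distribution through the product
  representation of \<open>lborel\<close>.\<close>

lemma
  fixes k :: "'a::euclidean_space"
  shows ft_gauss: "ft (\<lambda>x. complex_of_real (gauss x)) k = of_real (sqrt (2 * pi) ^ DIM('a) * gauss k)"
    and integrable_gauss: "integrable lborel (gauss :: 'a \<Rightarrow> real)"
proof -
  interpret P: product_sigma_finite "\<lambda>_::'a. lborel::real measure" ..
  let ?T = "\<lambda>f. \<Sum>b\<in>(Basis::'a set). f b *\<^sub>R b"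
  have T[measurable]: "?T \<in> (\<Pi>\<^sub>M b\<in>Basis. lborel) \<rightarrow>\<^sub>M borel" by measurable
  have prod: "complex_of_real (gauss (?T f)) * cis (- (l \<bullet> ?T f)) =
      (\<Prod>b\<in>Basis. complex_of_real (exp (- (f b)\<^sup>2 / 2)) * cis (- ((l \<bullet> b) * f b)))" for f :: "'a \<Rightarrow> real" and l :: 'a
  proof -
    have 1: "gauss (?T f) = (\<Prod>b\<in>Basis. exp (- (f b)\<^sup>2 / 2))"
      unfolding gauss_def
      by (subst euclidean_inner) (simp add: exp_sum[symmetric] sum_negf[symmetric] sum_divide_distrib power2_eq_square)
    have "l \<bullet> ?T f = (\<Sum>b\<in>Basis. (l \<bullet> b) * f b)"
      by (subst euclidean_inner) simp
    then have 2: "cis (- (l \<bullet> ?T f)) = (\<Prod>b\<in>Basis. cis (- ((l \<bullet> b) * f b)))"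
      by (simp add: cis_conv_exp exp_sum[symmetric] sum_distrib_left sum_negf[symmetric])
    show ?thesis unfolding 1 2 by (simp add: prod.distrib)
  qed
  have int: "integrable (\<Pi>\<^sub>M b\<in>(Basis::'a set). lborel) (\<lambda>f. \<Prod>b\<in>Basis. complex_of_real (exp (- (f b)\<^sup>2 / 2)) * cis (- ((l \<bullet> b) * f b)))" for l :: 'a
    by (rule P.product_integrable_prod) (use integrable_normal_cis in auto)
  have gm: "(\<lambda>x::'a. complex_of_real (gauss x) * cis (- (l \<bullet> x))) \<in> borel_measurable borel" for l
    by measurable
  \<comment> \<open>At frequency 0 the character is 1, so this case is the integrability of the
    Gaussian itself.\<close>
  have "integrable lborel (\<lambda>x::'a. complex_of_real (gauss x) * cis (- (0 \<bullet> x)))"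
    by (subst lborel_eq, subst integrable_distr_eq[OF T gm]) (use int[of 0] in \<open>simp only: prod\<close>)
  then have "integrable lborel (\<lambda>x::'a. Re (complex_of_real (gauss x) * cis (- (0 \<bullet> x))))"
    by (rule integrable_Re)
  then show "integrable lborel (gauss :: 'a \<Rightarrow> real)" by simp
  have "ft (\<lambda>x. complex_of_real (gauss x)) k = (\<Prod>b\<in>Basis. of_real (sqrt (2 * pi) * exp (- (k \<bullet> b)\<^sup>2 / 2)))"
    unfolding ft_def
    by (subst lborel_eq, subst integral_distr[OF T gm], unfold prod, subst P.product_integral_prod)
       (simp_all only: finite_Basis integrable_normal_cis integral_normal_density_cis)
  also have "\<dots> = of_real (sqrt (2 * pi) ^ DIM('a) * gauss k)"
    unfolding gauss_def
    by (subst euclidean_inner) (simp add: prod.distrib exp_sum[symmetric] sum_negf[symmetric] sum_divide_distrib power2_eq_square exp_of_real[symmetric] del: exp_of_real of_real_prod add: of_real_prod[symmetric])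
  finally show "ft (\<lambda>x. complex_of_real (gauss x)) k = of_real (sqrt (2 * pi) ^ DIM('a) * gauss k)" .
qed

lemma integral_gauss: "(LINT x|lborel. gauss (x::'a::euclidean_space)) = sqrt (2 * pi) ^ DIM('a)"
proof -
  have "complex_of_real (LINT x|lborel. gauss (x::'a)) = ft (\<lambda>x::'a. complex_of_real (gauss x)) 0"
    by (simp add: ft_def)
  also have "\<dots> = complex_of_real (sqrt (2 * pi) ^ DIM('a))"
    unfolding ft_gauss by (simp add: gauss_def)
  finally show ?thesis unfolding of_real_eq_iff .
qed

lemma gauss_bounds: "0 < gauss x" "gauss x \<le> 1"
  by (auto simp: gauss_def)

text \<open>Convergence factors: they increase to 1, so monotone convergence applies, while their
  transforms concentrate at the origin.\<close>

definition wide_gauss :: "nat \<Rightarrow> 'a::euclidean_space \<Rightarrow> real" where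
  "wide_gauss m x = gauss ((1 / real (Suc m)) *\<^sub>R x)"

lemma integrable_wide_gauss: "integrable lborel (wide_gauss m :: 'a::euclidean_space \<Rightarrow> real)"
  unfolding wide_gauss_def[abs_def]
  using integrable_lborel_affine_iff[of "1 / real (Suc m)" gauss "0::'a"] integrable_gauss by simp

lemma wide_gauss_measurable [measurable]: "wide_gauss m \<in> borel_measurable borel"
  using borel_measurable_integrable[OF integrable_wide_gauss] by simp

lemma wide_gauss_bounds: "0 < wide_gauss m x" "wide_gauss m x \<le> 1"
  unfolding wide_gauss_def by (rule gauss_bounds)+

lemma ft_wide_gauss:
  fixes h :: "'a::euclidean_space"
  shows "ft (\<lambda>x. complex_of_real (wide_gauss m x)) h =
    of_real (real (Suc m) ^ DIM('a) * (sqrt (2 * pi) ^ DIM('a) * gauss (real (Suc m) *\<^sub>R h)))"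
  unfolding wide_gauss_def
  by (subst ft_scale) (auto simp: ft_gauss scaleR_conv_of_real power_one_over divide_inverse simp flip: power_inverse)

lemma mono_wide_gauss: "mono (\<lambda>m. wide_gauss m k)"
proof (intro monoI)
  fix m n :: nat assume "m \<le> n"
  then have "1 / real (Suc n) \<le> 1 / real (Suc m)" by (simp add: field_simps)
  then have "(1 / real (Suc n)) * (1 / real (Suc n)) \<le> (1 / real (Suc m)) * (1 / real (Suc m))"
    by (intro mult_mono) auto
  then have "((1 / real (Suc n)) * (1 / real (Suc n))) * (k \<bullet> k) \<le> ((1 / real (Suc m)) * (1 / real (Suc m))) * (k \<bullet> k)"
    by (intro mult_right_mono) auto
  then show "wide_gauss m k \<le> wide_gauss n k"
    unfolding wide_gauss_def gauss_def exp_le_cancel_iff inner_scaleR_left inner_scaleR_right mult.assoc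
    by (rule divide_right_mono[OF le_imp_neg_le]) simp
qed

lemma tendsto_wide_gauss: "(\<lambda>m. wide_gauss m k) \<longlonglongrightarrow> 1"
proof -
  have "(\<lambda>m. inverse (real (Suc m)) *\<^sub>R k) \<longlonglongrightarrow> 0 *\<^sub>R k"
    by (intro tendsto_scaleR LIMSEQ_inverse_real_of_nat tendsto_const)
  moreover have "isCont gauss (0 *\<^sub>R k)"
    unfolding gauss_def[abs_def] by (intro continuous_intros) auto
  ultimately have "(\<lambda>m. gauss (inverse (real (Suc m)) *\<^sub>R k)) \<longlonglongrightarrow> gauss (0 *\<^sub>R k)"
    by (rule isCont_tendsto_compose[rotated])
  then show ?thesis
    unfolding wide_gauss_def divide_inverse mult_1_left by (simp add: gauss_def[of 0])
qed

text \<open>Inversion at the origin without integrability of \<open>ft A\<close>: the multiplication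
  formula turns the damped integral into a Gaussian average of A at the shrinking scale 1 / (m + 1),
  whose limit is governed by boundedness and by continuity at 0.\<close>

lemma gauss_summability:
  fixes A :: "'a::euclidean_space \<Rightarrow> complex"
  assumes A: "integrable lborel A" and Ab: "\<And>h. norm (A h) \<le> B" and cont: "isCont A 0"
  shows "(\<lambda>m. LINT k|lborel. ft A k * wide_gauss m k) \<longlonglongrightarrow> (2 * pi) ^ DIM('a) * A 0"
proof -
  have [measurable]: "A \<in> borel_measurable borel" using borel_measurable_integrable[OF A] by simp
  have eq: "(LINT k|lborel. ft A k * wide_gauss m k) = of_real (sqrt (2 * pi) ^ DIM('a)) * (LINT z|lborel. A (z /\<^sub>R real (Suc m)) * gauss z)" for m
  proof -
    have "(LINT k|lborel. ft A k * wide_gauss m k) = (LINT x|lborel. A x * ft (\<lambda>x. complex_of_real (wide_gauss m x)) x)"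
      by (rule ft_mult_formula) (use A integrable_wide_gauss in auto)
    also have "\<dots> = real (Suc m) ^ DIM('a) * (of_real (sqrt (2 * pi) ^ DIM('a)) * (LINT x|lborel. A x * gauss (real (Suc m) *\<^sub>R x)))"
      unfolding ft_wide_gauss integral_mult_right_zero[symmetric] by (simp add: ac_simps)
    also have "(LINT x|lborel. A x * gauss (real (Suc m) *\<^sub>R x)) = (LINT z|lborel. A (z /\<^sub>R real (Suc m)) * gauss z) / real (Suc m) ^ DIM('a)"
      using integral_lborel_affine[of "1 / real (Suc m)" "\<lambda>x. A x * complex_of_real (gauss (real (Suc m) *\<^sub>R x))" 0]
      by (simp add: scaleR_conv_of_real power_one_over divide_inverse power_inverse)
    finally show ?thesis
      using of_nat_neq_0[where 'a=complex, of m] by (simp add: field_simps)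
  qed
  have B: "0 \<le> B" using Ab[of 0] norm_ge_zero order_trans by blast
  have "(\<lambda>m. LINT z|lborel. A (z /\<^sub>R real (Suc m)) * gauss z) \<longlonglongrightarrow> (LINT (z::'a)|lborel. A 0 * gauss z)"
  proof (rule integral_dominated_convergence[where w="\<lambda>z::'a. B * gauss z"])
    show "integrable lborel (\<lambda>z::'a. B * gauss z)" using integrable_gauss by auto
    show "AE z in lborel. (\<lambda>m. A (z /\<^sub>R real (Suc m)) * complex_of_real (gauss z)) \<longlonglongrightarrow> A 0 * complex_of_real (gauss z)"
    proof (intro always_eventually allI tendsto_mult tendsto_const)
      fix z :: 'a
      have "(\<lambda>m. inverse (real (Suc m)) *\<^sub>R z) \<longlonglongrightarrow> 0 *\<^sub>R z"
        by (intro tendsto_scaleR LIMSEQ_inverse_real_of_nat tendsto_const)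
      then show "(\<lambda>m. A (z /\<^sub>R real (Suc m))) \<longlonglongrightarrow> A 0"
        using isCont_tendsto_compose[OF cont] by simp
    qed
    show "AE z in lborel. norm (A (z /\<^sub>R real (Suc m)) * complex_of_real (gauss z)) \<le> B * gauss z" for m
      using Ab by (intro always_eventually allI)
        (simp add: norm_mult abs_of_nonneg gauss_bounds(1)[THEN less_imp_le] mult_right_mono)
  qed measurable
  then have "(\<lambda>m. LINT k|lborel. ft A k * wide_gauss m k) \<longlonglongrightarrow> of_real (sqrt (2 * pi) ^ DIM('a)) * (LINT z|lborel. A 0 * gauss (z::'a))"
    unfolding eq by (intro tendsto_mult_left)
  also have "(LINT z|lborel. A 0 * gauss (z::'a)) = A 0 * of_real (sqrt (2 * pi) ^ DIM('a))"
    by (simp add: integral_gauss)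
  also have "of_real (sqrt (2 * pi) ^ DIM('a)) * (A 0 * of_real (sqrt (2 * pi) ^ DIM('a))) = (2 * pi) ^ DIM('a) * A 0"
  proof -
    have "sqrt (2 * pi) ^ DIM('a) * sqrt (2 * pi) ^ DIM('a) = (2 * pi) ^ DIM('a)"
      unfolding power_mult_distrib[symmetric] by simp
    then show ?thesis by (metis of_real_mult mult.assoc mult.commute)
  qed
  finally show ?thesis .
qed

text \<open>\<open>|ft f|\<^sup>2\<close> is the transform of the autocorrelation of \<open>f\<close>, which is continuous at the origin
  with value \<open>\<parallel>f\<parallel>\<^sup>2\<close>.\<close>

lemma Plancherel:
  fixes f :: "'a::euclidean_space \<Rightarrow> complex"
  assumes f: "integrable lborel f" "l2 f"
  shows "l2 (ft f)" "(LINT k|lborel. (norm (ft f k))\<^sup>2) = (2 * pi) ^ DIM('a) * (LINT x|lborel. (norm (f x))\<^sup>2)"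
proof -
  define f' where "f' x = cnj (f (- x))" for x
  have f': "integrable lborel f'" "l2 f'"
    unfolding f'_def using f integrable_lborel_uminus_iff[of f] l2_uminus[of f] by (auto simp: f'_def)
  have [measurable]: "f \<in> borel_measurable borel" "f' \<in> borel_measurable borel"
    using l2D f f' by auto
  define A where "A = conv f f'"
  have A: "integrable lborel A" unfolding A_def by (rule integrable_conv) fact+
  have [measurable]: "A \<in> borel_measurable borel" unfolding A_def by measurable
  have ftA: "ft A k = of_real ((norm (ft f k))\<^sup>2)" for k
    unfolding A_def ft_conv[OF f(1) f'(1)] f'_def ft_cnj_uminus by (simp add: complex_norm_square[symmetric])
  have A_eq: "A h = (LINT y|lborel. f (y + h) * cnj (f y))" for h
    unfolding A_def conv_def f'_def
    using integral_lborel_uminus[of "\<lambda>y. f (y + h) * cnj (f y)"] by (simp add: algebra_simps)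
  have Ab: "norm (A h) \<le> l2norm f * l2norm f" for h
  proof -
    have "norm (A h) \<le> l2norm (\<lambda>y. f (y + h)) * l2norm (\<lambda>y. cnj (f y))"
      unfolding A_eq by (rule l2_Cauchy_Schwarz) (use f l2_translate in auto)
    also have "l2norm (\<lambda>y. f (y + h)) = l2norm f"
      unfolding l2norm_def using integral_lborel_translate(1)[of "\<lambda>x. (norm (f x))\<^sup>2" h] by simp
    finally show ?thesis by simp
  qed
  have A0: "A 0 = of_real ((l2norm f)\<^sup>2)"
    unfolding A_eq l2norm_power2 by (simp add: complex_norm_square[symmetric] del: of_real_power)
  have "((\<lambda>h. A h - A 0) \<longlongrightarrow> 0) (at 0)"
  proof (rule tendsto_0_le[where K=1])
    show "((\<lambda>h. l2norm (\<lambda>x. f (x + h) - f x) * l2norm f) \<longlongrightarrow> 0) (at 0)"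
      using tendsto_mult_left_zero[OF l2_translation_continuous[OF f(2)]] .
    have "norm (A h - A 0) \<le> l2norm (\<lambda>x. f (x + h) - f x) * l2norm f" for h
    proof -
      have "A h - A 0 = (LINT y|lborel. f (y + h) * cnj (f y) - f y * cnj (f y))"
        unfolding A_eq using integrable_l2_mult[OF l2_translate(1)[OF f(2)], of "\<lambda>y. cnj (f y)" h]
           integrable_l2_mult[OF f(2), of "\<lambda>y. cnj (f y)"] f(2) by simp
      also have "\<dots> = (LINT y|lborel. (f (y + h) - f y) * cnj (f y))"
        by (simp add: left_diff_distrib)
      also have "norm \<dots> \<le> l2norm (\<lambda>x. f (x + h) - f x) * l2norm (\<lambda>y. cnj (f y))"
        by (rule l2_Cauchy_Schwarz) (use f l2_diff[OF l2_translate(1)[OF f(2)] f(2)] in auto)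
      finally show ?thesis by simp
    qed
    then show "\<forall>\<^sub>F h in at 0. norm (A h - A 0) \<le> norm (l2norm (\<lambda>x. f (x + h) - f x) * l2norm f) * 1"
      by (intro always_eventually allI) (simp add: abs_of_nonneg)
  qed
  then have "(A \<longlongrightarrow> A 0) (at 0)" by (rule LIM_zero_cancel)
  then have cont: "isCont A 0" by (simp add: isCont_def)
  have eq: "complex_of_real (LINT k|lborel. (norm (ft f k))\<^sup>2 * wide_gauss m k) = (LINT k|lborel. ft A k * wide_gauss m k)" for m
    unfolding ftA by (simp flip: of_real_mult of_real_power)
  have "(\<lambda>m. complex_of_real (LINT k|lborel. (norm (ft f k))\<^sup>2 * wide_gauss m k)) \<longlonglongrightarrow> (2 * pi) ^ DIM('a) * A 0"
    unfolding eq by (rule gauss_summability[OF A Ab cont])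
  then have "(\<lambda>m. Re (complex_of_real (LINT k|lborel. (norm (ft f k))\<^sup>2 * wide_gauss m k))) \<longlonglongrightarrow> Re ((2 * pi) ^ DIM('a) * A 0)"
    by (rule tendsto_Re)
  then have lim: "(\<lambda>m. LINT k|lborel. (norm (ft f k))\<^sup>2 * wide_gauss m k) \<longlonglongrightarrow> (2 * pi) ^ DIM('a) * (LINT x|lborel. (norm (f x))\<^sup>2)"
    unfolding A0 l2norm_power2 of_real_power[symmetric] of_real_mult[symmetric] Re_complex_of_real .
  have [measurable]: "ft f \<in> borel_measurable borel"
    using f by (auto intro: ft_measurable)
  have B: "norm (ft f k) \<le> (LINT x|lborel. norm (f x))" for k by (rule norm_ft_le)
  have i: "integrable lborel (\<lambda>k. (norm (ft f k))\<^sup>2 * wide_gauss m k)" for m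
  proof (rule Bochner_Integration.integrable_bound)
    show "integrable lborel (\<lambda>k::'a. (LINT x|lborel. norm (f x))\<^sup>2 * wide_gauss m k)" using integrable_wide_gauss by auto
    show "AE k in lborel. norm ((norm (ft f k))\<^sup>2 * wide_gauss m k) \<le> norm ((LINT x|lborel. norm (f x))\<^sup>2 * wide_gauss m k)"
      unfolding norm_mult
      by (intro always_eventually allI mult_right_mono) (auto intro!: power_mono B)
  qed measurable
  \<comment> \<open>The transform of A is nonnegative, so monotone convergence yields both the
    integrability of its undamped version and the value of the integral.\<close>
  have mono: "AE k in lborel. mono (\<lambda>m. (norm (ft f k))\<^sup>2 * wide_gauss m k)"
    using mono_wide_gauss by (intro always_eventually allI monoI mult_left_mono) (auto simp: mono_def)
  have conv: "AE k in lborel. (\<lambda>m. (norm (ft f k))\<^sup>2 * wide_gauss m k) \<longlonglongrightarrow> (norm (ft f k))\<^sup>2"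
  proof (intro always_eventually allI)
    fix k :: 'a
    show "(\<lambda>m. (norm (ft f k))\<^sup>2 * wide_gauss m k) \<longlonglongrightarrow> (norm (ft f k))\<^sup>2"
      using tendsto_mult_left[OF tendsto_wide_gauss[of k], of "(norm (ft f k))\<^sup>2"] unfolding mult_1_right .
  qed
  show "(LINT k|lborel. (norm (ft f k))\<^sup>2) = (2 * pi) ^ DIM('a) * (LINT x|lborel. (norm (f x))\<^sup>2)"
    by (rule integral_monotone_convergence[OF i mono conv lim]) measurable
  have "integrable lborel (\<lambda>k. (norm (ft f k))\<^sup>2)"
    by (rule integrable_monotone_convergence[OF i mono conv lim]) measurable
  then show "l2 (ft f)" unfolding l2_def by auto
qed

subsection \<open>The Fourier transform on square integrable functions\<close>

lemma l2norm_minus_commute: "l2norm (\<lambda>x. f x - g x) = l2norm (\<lambda>x. g x - f x)"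
  by (simp add: l2norm_def norm_minus_commute)

lemma l2_nn_integral:
  assumes "l2 f"
  shows "(\<integral>\<^sup>+x. ennreal ((norm (f x))\<^sup>2) \<partial>lborel) = ennreal ((l2norm f)\<^sup>2)"
  unfolding l2norm_power2 by (rule nn_integral_eq_integral[OF l2D(3)[OF assms]]) auto

lemma l2I_nn_integral:
  assumes "f \<in> borel_measurable borel" "(\<integral>\<^sup>+x. ennreal ((norm (f x))\<^sup>2) \<partial>lborel) \<le> ennreal (B\<^sup>2)" "B \<ge> 0"
  shows "l2 f" "l2norm f \<le> B"
proof -
  have fin: "(\<integral>\<^sup>+x. ennreal ((norm (f x))\<^sup>2) \<partial>lborel) < \<infinity>"
    using assms(2) by (rule order.strict_trans1) simp
  show l2: "l2 f" unfolding l2_def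
  proof
    show "integrable lborel (\<lambda>x. (norm (f x))\<^sup>2)"
      by (rule integrableI_bounded) (use assms(1) fin in auto)
  qed fact
  have "ennreal ((l2norm f)\<^sup>2) \<le> ennreal (B\<^sup>2)" using assms(2) l2_nn_integral[OF l2] by simp
  then have "(l2norm f)\<^sup>2 \<le> B\<^sup>2" by simp
  then show "l2norm f \<le> B" using assms(3) by (rule power2_le_imp_le)
qed

text \<open>Riesz-Fischer. Along a subsequence whose increments have norm at most 2^-j, the squares
  can be weighted by \<open>sqrt 2 ^ j\<close> and still have finite total integral, hence a finite
  sum almost everywhere, which forces pointwise convergence. Fatou's lemma converts the pointwise
  limit into a limit in norm.\<close>

lemma l2_complete:
  fixes F :: "nat \<Rightarrow> 'a::euclidean_space \<Rightarrow> 'b::{real_normed_field,banach,second_countable_topology}"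
  assumes F: "\<And>m. l2 (F m)"
    and Cauchy: "\<And>e. e > 0 \<Longrightarrow> \<exists>M. \<forall>m\<ge>M. \<forall>n\<ge>M. l2norm (\<lambda>x. F m x - F n x) \<le> e"
  shows "\<exists>G. l2 G \<and> (\<lambda>m. l2norm (\<lambda>x. F m x - G x)) \<longlonglongrightarrow> 0"
proof -
  have [measurable]: "F m \<in> borel_measurable borel" for m using l2D(1)[OF F] .
  have "\<exists>M. \<forall>m\<ge>M. \<forall>n\<ge>M. l2norm (\<lambda>x. F m x - F n x) \<le> (1/2)^j" for j :: nat
    by (rule Cauchy) auto
  then obtain N where N: "\<And>j m n. m \<ge> N j \<Longrightarrow> n \<ge> N j \<Longrightarrow> l2norm (\<lambda>x. F m x - F n x) \<le> (1/2)^j"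
    by metis
  \<comment> \<open>Summation makes the thresholds N monotone, so that \<open>r j\<close> is at
    least \<open>N i\<close> for all i \<le> j.\<close>
  define r where "r j = (\<Sum>i\<le>j. N i)" for j
  have r: "r j \<ge> N j" "r (Suc j) \<ge> r j" for j
    unfolding r_def by (auto intro!: member_le_sum)
  define D where "D j x = F (r (Suc j)) x - F (r j) x" for j x
  have Dl2: "l2 (D j)" for j unfolding D_def by (intro l2_diff F)
  have [measurable]: "D j \<in> borel_measurable borel" for j using l2D(1)[OF Dl2] .
  have Dn: "l2norm (D j) \<le> (1/2)^j" for j
    unfolding D_def by (rule N) (use r[of j] in auto)
  have "(\<integral>\<^sup>+x. (\<Sum>j. ennreal (sqrt 2 ^ j * (norm (D j x))\<^sup>2)) \<partial>lborel) = (\<Sum>j. \<integral>\<^sup>+x. ennreal (sqrt 2 ^ j * (norm (D j x))\<^sup>2) \<partial>lborel)"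
    by (rule nn_integral_suminf) measurable
  also have "\<dots> \<le> (\<Sum>j. ennreal ((sqrt 2 / 4) ^ j))"
  proof (rule suminf_le)
    fix j
    have "(\<integral>\<^sup>+x. ennreal (sqrt 2 ^ j * (norm (D j x))\<^sup>2) \<partial>lborel) = ennreal (sqrt 2 ^ j) * ennreal ((l2norm (D j))\<^sup>2)"
      by (simp add: ennreal_mult nn_integral_cmult l2_nn_integral[OF Dl2, symmetric])
    also have "\<dots> = ennreal (sqrt 2 ^ j * (l2norm (D j))\<^sup>2)"
      by (simp add: ennreal_mult)
    also have "\<dots> \<le> ennreal ((sqrt 2 / 4) ^ j)"
    proof (rule ennreal_leI)
      have "(l2norm (D j))\<^sup>2 \<le> ((1/2)^j)\<^sup>2" by (intro power_mono Dn) auto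
      also have "\<dots> = (1/4)^j" by (simp add: power2_eq_square power_mult_distrib[symmetric])
      finally have "sqrt 2 ^ j * (l2norm (D j))\<^sup>2 \<le> sqrt 2 ^ j * (1/4)^j" by (intro mult_left_mono) auto
      then show "sqrt 2 ^ j * (l2norm (D j))\<^sup>2 \<le> (sqrt 2 / 4) ^ j" by (simp add: power_divide)
    qed
    finally show "(\<integral>\<^sup>+x. ennreal (sqrt 2 ^ j * (norm (D j x))\<^sup>2) \<partial>lborel) \<le> ennreal ((sqrt 2 / 4) ^ j)" .
  qed auto
  also have "\<dots> = ennreal (\<Sum>j. (sqrt 2 / 4) ^ j)"
  proof (rule suminf_ennreal2)
    have "sqrt 2 < 4" using sqrt2_less_2 by linarith
    then show "summable (\<lambda>j. (sqrt 2 / 4) ^ j)" by (intro summable_geometric) auto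
  qed auto
  also have "\<dots> < \<infinity>" by simp
  finally have "AE x in lborel. (\<Sum>j. ennreal (sqrt 2 ^ j * (norm (D j x))\<^sup>2)) \<noteq> \<infinity>"
    by (intro nn_integral_PInf_AE) auto
  then have "AE x in lborel. convergent (\<lambda>j. F (r j) x)"
  proof eventually_elim
    case (elim x)
    then have s: "summable (\<lambda>j. sqrt 2 ^ j * (norm (D j x))\<^sup>2)"
      by (intro summable_suminf_not_top) auto
    have "summable (\<lambda>j. (1 / sqrt 2) ^ j + sqrt 2 ^ j * (norm (D j x))\<^sup>2)"
      by (intro summable_add s summable_geometric) auto
    \<comment> \<open>Either the increment is below the geometric term, or \<open>sqrt 2 ^ j\<close>
      times it is at least 1 and the weighted square dominates it.\<close>
    moreover have "norm (D j x) \<le> (1 / sqrt 2) ^ j + sqrt 2 ^ j * (norm (D j x))\<^sup>2" for j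
    proof (cases "norm (D j x) \<le> (1 / sqrt 2) ^ j")
      case True
      then show ?thesis by (smt (verit) mult_nonneg_nonneg zero_le_power real_sqrt_ge_zero zero_le_power2)
    next
      case False
      have "1 = sqrt 2 ^ j * (1 / sqrt 2) ^ j" by (simp add: power_mult_distrib[symmetric])
      also have "\<dots> \<le> sqrt 2 ^ j * norm (D j x)" using False by (intro mult_left_mono) auto
      finally have "1 * norm (D j x) \<le> sqrt 2 ^ j * norm (D j x) * norm (D j x)"
        by (intro mult_right_mono) auto
      moreover have "(1 / sqrt 2) ^ j \<ge> 0" by simp
      ultimately show ?thesis unfolding power2_eq_square mult.assoc by linarith
    qed
    ultimately have "summable (\<lambda>j. D j x)"
      by (intro summable_comparison_test'[of _ 0 "\<lambda>j. D j x"]) auto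
    then have "convergent (\<lambda>n. F (r 0) x + (\<Sum>j<n. D j x))"
      by (intro convergent_add convergent_const) (simp add: summable_iff_convergent)
    moreover have "F (r 0) x + (\<Sum>j<n. D j x) = F (r n) x" for n
      unfolding D_def using sum_lessThan_telescope[of "\<lambda>j. F (r j) x" n] by simp
    ultimately show ?case by simp
  qed
  then have lim: "AE x in lborel. (\<lambda>j. F (r j) x) \<longlonglongrightarrow> lim (\<lambda>j. F (r j) x)"
    by (simp add: convergent_LIMSEQ_iff)
  define G where "G x = lim (\<lambda>j. F (r j) x)" for x
  have [measurable]: "G \<in> borel_measurable borel" unfolding G_def[abs_def] by measurable
  have bound: "l2 (\<lambda>x. F m x - G x) \<and> l2norm (\<lambda>x. F m x - G x) \<le> (1/2)^i" if m: "m \<ge> N i" for m i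
  proof -
    have rj: "r j \<ge> N i" if "j \<ge> i" for j
    proof -
      have "incseq r" by (rule incseq_SucI) (rule r)
      then have "r i \<le> r j" using that by (simp add: incseq_def)
      then show ?thesis using r(1)[of i] by simp
    qed
    have "(\<integral>\<^sup>+x. ennreal ((norm (F m x - G x))\<^sup>2) \<partial>lborel) = (\<integral>\<^sup>+x. liminf (\<lambda>j. ennreal ((norm (F m x - F (r j) x))\<^sup>2)) \<partial>lborel)"
    proof (rule nn_integral_cong_AE)
      show "AE x in lborel. ennreal ((norm (F m x - G x))\<^sup>2) = liminf (\<lambda>j. ennreal ((norm (F m x - F (r j) x))\<^sup>2))"
        using lim
      proof eventually_elim
        case (elim x)
        have "(\<lambda>j. ennreal ((norm (F m x - F (r j) x))\<^sup>2)) \<longlonglongrightarrow> ennreal ((norm (F m x - G x))\<^sup>2)"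
          unfolding G_def by (intro tendsto_intros tendsto_ennrealI elim)
        then show ?case by (rule lim_imp_Liminf[OF sequentially_bot, symmetric])
      qed
    qed
    also have "\<dots> \<le> liminf (\<lambda>j. \<integral>\<^sup>+x. ennreal ((norm (F m x - F (r j) x))\<^sup>2) \<partial>lborel)"
      by (rule nn_integral_liminf) measurable
    also have "\<dots> \<le> limsup (\<lambda>j. \<integral>\<^sup>+x. ennreal ((norm (F m x - F (r j) x))\<^sup>2) \<partial>lborel)"
      by (rule Liminf_le_Limsup) auto
    also have "\<dots> \<le> ennreal (((1/2)^i)\<^sup>2)"
    proof (rule Limsup_bounded)
      show "\<forall>\<^sub>F j in sequentially. (\<integral>\<^sup>+x. ennreal ((norm (F m x - F (r j) x))\<^sup>2) \<partial>lborel) \<le> ennreal (((1/2)^i)\<^sup>2)"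
        using eventually_ge_at_top[of i]
      proof eventually_elim
        case (elim j)
        have "(\<integral>\<^sup>+x. ennreal ((norm (F m x - F (r j) x))\<^sup>2) \<partial>lborel) = ennreal ((l2norm (\<lambda>x. F m x - F (r j) x))\<^sup>2)"
          by (intro l2_nn_integral l2_diff F)
        also have "\<dots> \<le> ennreal (((1/2)^i)\<^sup>2)"
          by (intro ennreal_leI power_mono N m rj elim) auto
        finally show ?case .
      qed
    qed
    finally have "(\<integral>\<^sup>+x. ennreal ((norm (F m x - G x))\<^sup>2) \<partial>lborel) \<le> ennreal (((1/2)^i)\<^sup>2)" .
    from l2I_nn_integral[OF _ this] show ?thesis by auto
  qed
  have "l2 (\<lambda>x. F (N 0) x - (F (N 0) x - G x))"
    using l2_diff[OF F[of "N 0"], of "\<lambda>x. F (N 0) x - G x"] bound[of 0 "N 0"] by blast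
  then have "l2 G" by simp
  moreover have "(\<lambda>m. l2norm (\<lambda>x. F m x - G x)) \<longlonglongrightarrow> 0"
  proof (rule LIMSEQ_I)
    fix e :: real assume "e > 0"
    then obtain i where "(1/2::real)^i < e" using real_arch_pow_inv[of e "1/2"] by auto
    then show "\<exists>no. \<forall>n\<ge>no. norm (l2norm (\<lambda>x. F n x - G x) - 0) < e"
      using bound by (intro exI[of _ "N i"]) (fastforce intro: le_less_trans)
  qed
  ultimately show ?thesis by blast
qed

lemma Plancherel_norm:
  fixes f :: "'a::euclidean_space \<Rightarrow> complex"
  assumes f: "integrable lborel f" "l2 f"
  shows "l2norm (ft f) = sqrt ((2 * pi) ^ DIM('a)) * l2norm f"
  unfolding l2norm_def Plancherel(2)[OF f] by (rule real_sqrt_mult)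

section \<open>Parseval's identity and its extension to L2\<close>

lemma polarization:
  fixes z w :: complex
  shows "z * cnj w = (of_real ((norm (z + w))\<^sup>2) - of_real ((norm (z - w))\<^sup>2)
     + \<i> * of_real ((norm (z + \<i> * w))\<^sup>2) - \<i> * of_real ((norm (z - \<i> * w))\<^sup>2)) / 4"
  unfolding complex_norm_square by (simp add: algebra_simps)

lemma integral_polarization:
  fixes f g :: "'a::euclidean_space \<Rightarrow> complex"
  assumes f: "l2 f" and g: "l2 g"
  shows "(LINT x|lborel. f x * cnj (g x)) = (of_real ((l2norm (\<lambda>x. f x + g x))\<^sup>2) - of_real ((l2norm (\<lambda>x. f x - g x))\<^sup>2)
     + \<i> * of_real ((l2norm (\<lambda>x. f x + \<i> * g x))\<^sup>2) - \<i> * of_real ((l2norm (\<lambda>x. f x - \<i> * g x))\<^sup>2)) / 4"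
proof -
  note ig = l2_cmult[OF g, of \<i>]
  note i = l2D(3)[OF l2_add[OF f g]] l2D(3)[OF l2_diff[OF f g]] l2D(3)[OF l2_add[OF f ig]] l2D(3)[OF l2_diff[OF f ig]]
  note i' = i[THEN integrable_of_real[where 'a=complex]]
  show ?thesis
    unfolding polarization l2norm_power2 of_real_power[symmetric] using i'
    by (simp add: integral_complex_of_real[symmetric] del: of_real_power integral_complex_of_real)
qed

lemma Parseval_L1:
  fixes f g :: "'a::euclidean_space \<Rightarrow> complex"
  assumes f: "integrable lborel f" "l2 f" and g: "integrable lborel g" "l2 g"
  shows "(LINT k|lborel. ft f k * cnj (ft g k)) = (2 * pi) ^ DIM('a) * (LINT x|lborel. f x * cnj (g x))"
proof -
  have ig: "integrable lborel (\<lambda>x. \<i> * g x)" "l2 (\<lambda>x. \<i> * g x)" using g l2_cmult by auto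
  have n: "(l2norm (ft h))\<^sup>2 = (2 * pi) ^ DIM('a) * (l2norm h)\<^sup>2" if "integrable lborel h" "l2 h" for h :: "'a \<Rightarrow> complex"
    unfolding l2norm_power2 by (rule Plancherel(2)[OF that])
  have 1: "(\<lambda>x. ft f x + ft g x) = ft (\<lambda>x. f x + g x)" "(\<lambda>x. ft f x - ft g x) = ft (\<lambda>x. f x - g x)"
    "(\<lambda>x. ft f x + \<i> * ft g x) = ft (\<lambda>x. f x + \<i> * g x)" "(\<lambda>x. ft f x - \<i> * ft g x) = ft (\<lambda>x. f x - \<i> * g x)"
    using f g ig by (auto simp: fun_eq_iff ft_add ft_diff ft_cmult)
  show ?thesis
    unfolding integral_polarization[OF Plancherel(1)[OF f] Plancherel(1)[OF g]] integral_polarization[OF f(2) g(2)] 1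
    by (subst (1 2 3 4) n) (use f g ig l2_add l2_diff in \<open>auto simp: algebra_simps\<close>)
qed

lemma tendsto_inner_l2:
  fixes f g :: "'a::euclidean_space \<Rightarrow> complex"
  assumes f: "\<And>m. l2 (fs m)" "l2 f" "(\<lambda>m. l2norm (\<lambda>x. fs m x - f x)) \<longlonglongrightarrow> 0"
    and g: "\<And>m. l2 (gs m)" "l2 g" "(\<lambda>m. l2norm (\<lambda>x. gs m x - g x)) \<longlonglongrightarrow> 0"
  shows "(\<lambda>m. LINT x|lborel. fs m x * gs m x) \<longlonglongrightarrow> (LINT x|lborel. f x * g x)"
proof (rule LIM_zero_cancel, rule Lim_null_comparison)
  let ?d = "\<lambda>m. l2norm (\<lambda>x. fs m x - f x)" and ?e = "\<lambda>m. l2norm (\<lambda>x. gs m x - g x)"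
  show "(\<lambda>m. ?d m * (?e m + l2norm g) + l2norm f * ?e m) \<longlonglongrightarrow> 0"
    using tendsto_add[OF tendsto_mult[OF f(3) tendsto_add[OF g(3) tendsto_const[of "l2norm g"]]] tendsto_mult[OF tendsto_const[of "l2norm f"] g(3)]]
    by simp
  have "norm ((LINT x|lborel. fs m x * gs m x) - (LINT x|lborel. f x * g x)) \<le> ?d m * (?e m + l2norm g) + l2norm f * ?e m" for m
  proof -
    note df = l2_diff[OF f(1)[of m] f(2)] and dg = l2_diff[OF g(1)[of m] g(2)]
    have "(LINT x|lborel. fs m x * gs m x) - (LINT x|lborel. f x * g x) = (LINT x|lborel. fs m x * gs m x - f x * g x)"
      using integrable_l2_mult[OF f(1) g(1)] integrable_l2_mult[OF f(2) g(2)] by simp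
    also have "\<dots> = (LINT x|lborel. (fs m x - f x) * (gs m x - g x) + ((fs m x - f x) * g x + f x * (gs m x - g x)))"
      by (simp add: algebra_simps)
    also have "\<dots> = (LINT x|lborel. (fs m x - f x) * (gs m x - g x)) + ((LINT x|lborel. (fs m x - f x) * g x) + (LINT x|lborel. f x * (gs m x - g x)))"
      using integrable_l2_mult[OF df dg] integrable_l2_mult[OF df g(2)] integrable_l2_mult[OF f(2) dg]
      by (simp only: Bochner_Integration.integral_add Bochner_Integration.integrable_add)
    finally have eq: "(LINT x|lborel. fs m x * gs m x) - (LINT x|lborel. f x * g x) = (LINT x|lborel. (fs m x - f x) * (gs m x - g x)) + ((LINT x|lborel. (fs m x - f x) * g x) + (LINT x|lborel. f x * (gs m x - g x)))" .
    have "norm ((LINT x|lborel. fs m x * gs m x) - (LINT x|lborel. f x * g x)) \<le> ?d m * ?e m + (?d m * l2norm g + l2norm f * ?e m)"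
      unfolding eq by (intro norm_triangle_mono l2_Cauchy_Schwarz df dg f g)
    then show ?thesis by (simp add: algebra_simps)
  qed
  then show "\<forall>\<^sub>F m in sequentially. norm ((LINT x|lborel. fs m x * gs m x) - (LINT x|lborel. f x * g x)) \<le> ?d m * (?e m + l2norm g) + l2norm f * ?e m"
    by simp
qed

text \<open>The approximants that define the transform of an L2 function: bounded support makes it
  integrable.\<close>

definition trunc :: "nat \<Rightarrow> ('a::euclidean_space \<Rightarrow> complex) \<Rightarrow> 'a \<Rightarrow> complex" where
  "trunc m f x = indicator (cball 0 (real m)) x * f x"

lemma trunc:
  assumes f: "l2 f"
  shows "integrable lborel (trunc m f)" "l2 (trunc m f)" "(\<lambda>m. l2norm (\<lambda>x. trunc m f x - f x)) \<longlonglongrightarrow> 0"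
proof -
  have fm[measurable]: "f \<in> borel_measurable borel" using l2D f by auto
  have [measurable]: "trunc m f \<in> borel_measurable borel" for m
    unfolding trunc_def[abs_def] by (intro borel_measurable_times borel_measurable_indicator fm) auto
  have "l2 (indicator (cball 0 (real m)) :: 'a \<Rightarrow> complex)" for m
  proof -
    have "emeasure lborel (cball (0::'a) (real m)) < \<infinity>"
      by (intro emeasure_bounded_finite) auto
    then have "integrable lborel (\<lambda>x::'a. complex_of_real (indicator (cball 0 (real m)) x))"
      by (intro integrable_of_real integrable_real_indicator) auto
    moreover have "(\<lambda>x::'a. complex_of_real (indicator (cball 0 (real m)) x)) = indicator (cball 0 (real m))"
      by (auto simp: indicator_def)
    ultimately have "integrable lborel (indicator (cball 0 (real m)) :: 'a \<Rightarrow> complex)"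
      by simp
    then show ?thesis by (rule bounded_integrable_l2[where B=1]) (auto simp: indicator_def)
  qed
  from integrable_l2_mult[OF this f] show "integrable lborel (trunc m f)"
    by (simp add: trunc_def[abs_def])
  show "l2 (trunc m f)"
    by (rule l2_bound[OF f]) (auto simp: trunc_def indicator_def)
  have "(\<lambda>m. LINT x|lborel. (norm (trunc m f x - f x))\<^sup>2) \<longlonglongrightarrow> (LINT x|(lborel::'a measure). 0)"
  proof (rule integral_dominated_convergence[where w="\<lambda>x. (norm (f x))\<^sup>2"])
    show "AE x in lborel. (\<lambda>m. (norm (trunc m f x - f x))\<^sup>2) \<longlonglongrightarrow> 0"
    proof (intro always_eventually allI)
      fix x :: 'a
      obtain M where M: "norm x \<le> real M" using real_arch_simple by blast
      have "\<forall>\<^sub>F m in sequentially. (norm (trunc m f x - f x))\<^sup>2 = 0"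
        using eventually_ge_at_top[of M]
        by eventually_elim (use M in \<open>auto simp: trunc_def indicator_def\<close>)
      then show "(\<lambda>m. (norm (trunc m f x - f x))\<^sup>2) \<longlonglongrightarrow> 0"
        by (rule tendsto_eventually)
    qed
  qed (use l2D(3)[OF f] in \<open>auto simp: trunc_def indicator_def\<close>)
  then show "(\<lambda>m. l2norm (\<lambda>x. trunc m f x - f x)) \<longlonglongrightarrow> 0"
    unfolding l2norm_def using tendsto_real_sqrt by fastforce
qed

text \<open>A relation instead of a function, because the L2 transform is fixed only up to null
  sets; any representative F serves.\<close>

definition is_ft :: "('a::euclidean_space \<Rightarrow> complex) \<Rightarrow> ('a \<Rightarrow> complex) \<Rightarrow> bool" where
  "is_ft f F \<longleftrightarrow> l2 f \<and> l2 F \<and> (\<lambda>m. l2norm (\<lambda>k. ft (trunc m f) k - F k)) \<longlonglongrightarrow> 0"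

lemma is_ftD: "is_ft f F \<Longrightarrow> l2 f" "is_ft f F \<Longrightarrow> l2 F"
  by (auto simp: is_ft_def)

text \<open>By Plancherel the transforms of the truncations are a Cauchy sequence, and L2 is
  complete.\<close>

lemma is_ft_exists:
  fixes f :: "'a::euclidean_space \<Rightarrow> complex"
  assumes f: "l2 f"
  shows "\<exists>F. is_ft f F"
proof -
  have "\<exists>G. l2 G \<and> (\<lambda>m. l2norm (\<lambda>x. ft (trunc m f) x - G x)) \<longlonglongrightarrow> 0"
  proof (rule l2_complete)
    show "l2 (ft (trunc m f))" for m by (intro Plancherel trunc f)
    fix e :: real assume e: "e > 0"
    let ?c = "sqrt ((2 * pi) ^ DIM('a))"
    have c: "?c > 0" by simp
    have "\<forall>\<^sub>F m in sequentially. l2norm (\<lambda>x. trunc m f x - f x) < e / ?c / 2"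
      using order_tendstoD(2)[OF trunc(3)[OF f], of "e / ?c / 2"] e by simp
    then obtain M where M: "\<And>m. m \<ge> M \<Longrightarrow> l2norm (\<lambda>x. trunc m f x - f x) < e / ?c / 2"
      unfolding eventually_sequentially by blast
    have "l2norm (\<lambda>x. ft (trunc m f) x - ft (trunc n f) x) \<le> e" if mn: "m \<ge> M" "n \<ge> M" for m n
    proof -
      have "(\<lambda>x. ft (trunc m f) x - ft (trunc n f) x) = ft (\<lambda>x. trunc m f x - trunc n f x)"
        using trunc[OF f] by (simp add: fun_eq_iff ft_diff)
      then have "l2norm (\<lambda>x. ft (trunc m f) x - ft (trunc n f) x) = ?c * l2norm (\<lambda>x. trunc m f x - trunc n f x)"
        using Plancherel_norm[of "\<lambda>x. trunc m f x - trunc n f x"] trunc[OF f]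
          l2_diff[OF trunc(2)[OF f] trunc(2)[OF f]] by simp
      also have "l2norm (\<lambda>x. trunc m f x - trunc n f x) = l2norm (\<lambda>x. (trunc m f x - f x) + (f x - trunc n f x))" by simp
      also have "\<dots> \<le> l2norm (\<lambda>x. trunc m f x - f x) + l2norm (\<lambda>x. f x - trunc n f x)"
        by (rule l2norm_triangle) (use trunc[OF f] f l2_diff in auto)
      also have "\<dots> \<le> e / ?c" using M[OF mn(1)] M[OF mn(2)] l2norm_minus_commute[of f "trunc n f"] by simp
      finally show ?thesis using c by (simp add: field_simps)
    qed
    then show "\<exists>M. \<forall>m\<ge>M. \<forall>n\<ge>M. l2norm (\<lambda>x. ft (trunc m f) x - ft (trunc n f) x) \<le> e" by blast
  qed
  then show ?thesis using f by (auto simp: is_ft_def)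
qed

lemma is_ft_L1:
  fixes f :: "'a::euclidean_space \<Rightarrow> complex"
  assumes f: "integrable lborel f" "l2 f"
  shows "is_ft f (ft f)"
  unfolding is_ft_def
proof (intro conjI f Plancherel)
  have "l2norm (\<lambda>k. ft (trunc m f) k - ft f k) = sqrt ((2 * pi) ^ DIM('a)) * l2norm (\<lambda>x. trunc m f x - f x)" for m
  proof -
    have "(\<lambda>k. ft (trunc m f) k - ft f k) = ft (\<lambda>x. trunc m f x - f x)"
      using trunc[OF f(2)] f by (simp add: fun_eq_iff ft_diff)
    then show ?thesis using Plancherel_norm[of "\<lambda>x. trunc m f x - f x"] trunc[OF f(2)] f
        l2_diff[OF trunc(2)[OF f(2)] f(2)] by simp
  qed
  then show "(\<lambda>m. l2norm (\<lambda>k. ft (trunc m f) k - ft f k)) \<longlonglongrightarrow> 0"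
    using tendsto_mult_right_zero[OF trunc(3)[OF f(2)]] by simp
qed

lemma Parseval:
  fixes f g :: "'a::euclidean_space \<Rightarrow> complex"
  assumes f: "is_ft f F" and g: "is_ft g G"
  shows "(LINT k|lborel. F k * cnj (G k)) = (2 * pi) ^ DIM('a) * (LINT x|lborel. f x * cnj (g x))"
proof (rule LIMSEQ_unique)
  note l2 = is_ftD[OF f] is_ftD[OF g]
  have c: "l2norm (\<lambda>x. cnj (p x) - cnj (q x)) = l2norm (\<lambda>x. p x - q x)" for p q :: "'a \<Rightarrow> complex"
    using l2norm_cnj[of "\<lambda>x. p x - q x"] by simp
  show "(\<lambda>m. LINT k|lborel. ft (trunc m f) k * cnj (ft (trunc m g) k)) \<longlonglongrightarrow> (LINT k|lborel. F k * cnj (G k))"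
    by (rule tendsto_inner_l2) (use f g l2 in \<open>auto simp: c is_ft_def intro!: Plancherel(1) trunc\<close>)
  have "(\<lambda>m. (2 * pi) ^ DIM('a) * (LINT x|lborel. trunc m f x * cnj (trunc m g x))) \<longlonglongrightarrow> (2 * pi) ^ DIM('a) * (LINT x|lborel. f x * cnj (g x))"
    by (intro tendsto_mult_left tendsto_inner_l2) (use l2 trunc in \<open>auto simp: c\<close>)
  then show "(\<lambda>m. LINT k|lborel. ft (trunc m f) k * cnj (ft (trunc m g) k)) \<longlonglongrightarrow> (2 * pi) ^ DIM('a) * (LINT x|lborel. f x * cnj (g x))"
    by (subst Parseval_L1) (use l2 trunc in auto)
qed

lemma is_ft_mult_formula:
  fixes f :: "'a::euclidean_space \<Rightarrow> complex"
  assumes f: "is_ft f F" and g: "integrable lborel g" "l2 g"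
  shows "(LINT k|lborel. F k * g k) = (LINT x|lborel. f x * ft g x)"
proof (rule LIMSEQ_unique)
  note l2 = is_ftD[OF f]
  have z: "l2norm (\<lambda>x. h x - h x :: complex) = 0" for h :: "'a \<Rightarrow> complex" by (simp add: l2norm_def)
  show "(\<lambda>m. LINT k|lborel. ft (trunc m f) k * g k) \<longlonglongrightarrow> (LINT k|lborel. F k * g k)"
    by (rule tendsto_inner_l2) (use f g l2 z[of g] in \<open>auto simp: is_ft_def intro!: Plancherel(1) trunc\<close>)
  have "(\<lambda>m. (LINT x|lborel. trunc m f x * ft g x)) \<longlonglongrightarrow> (LINT x|lborel. f x * ft g x)"
    by (rule tendsto_inner_l2) (use l2 trunc Plancherel(1)[OF g] z[of "ft g"] in auto)
  then show "(\<lambda>m. LINT k|lborel. ft (trunc m f) k * g k) \<longlonglongrightarrow> (LINT x|lborel. f x * ft g x)"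
    by (subst ft_mult_formula) (use l2 trunc g in auto)
qed

text \<open>The inverse transform is obtained from the forward one as the conjugate of the transform
  of \<open>cnj F\<close>, divided by (2 pi)^n. It is characterized through pairings, which is the
  form in which a weak fractional Laplacian is tested.\<close>

lemma inverse_ft_exists:
  fixes F :: "'a::euclidean_space \<Rightarrow> complex"
  assumes F: "l2 F"
  shows "\<exists>g. l2 g \<and> (\<forall>\<phi>. integrable lborel \<phi> \<and> l2 \<phi> \<longrightarrow>
     (2 * pi) ^ DIM('a) * (LINT x|lborel. g x * cnj (\<phi> x)) = (LINT k|lborel. F k * cnj (ft \<phi> k)))"
proof -
  obtain F2 where F2: "is_ft (\<lambda>k. cnj (F k)) F2" using is_ft_exists[of "\<lambda>k. cnj (F k)"] F by auto
  let ?c = "(2 * pi) ^ DIM('a)"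
  define g where "g x = (1 / complex_of_real ?c) * cnj (F2 x)" for x
  have c: "complex_of_real ?c \<noteq> 0" by simp
  show ?thesis
  proof (intro exI[of _ g] conjI allI impI)
    show "l2 g" unfolding g_def using is_ftD(2)[OF F2] by (intro l2_cmult) auto
    fix \<phi> :: "'a \<Rightarrow> complex" assume p: "integrable lborel \<phi> \<and> l2 \<phi>"
    have "?c * (LINT x|lborel. g x * cnj (\<phi> x)) = (LINT x|lborel. cnj (F2 x * \<phi> x))"
      unfolding g_def mult.assoc using c by simp
    also have "\<dots> = cnj (LINT x|lborel. F2 x * \<phi> x)" by (rule Bochner_Integration.integral_cnj)
    also have "\<dots> = cnj (LINT k|lborel. cnj (F k) * ft \<phi> k)" using is_ft_mult_formula[OF F2] p by simp
    also have "\<dots> = (LINT k|lborel. F k * cnj (ft \<phi> k))"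
      unfolding Bochner_Integration.integral_cnj[symmetric] by simp
    finally show "?c * (LINT x|lborel. g x * cnj (\<phi> x)) = (LINT k|lborel. F k * cnj (ft \<phi> k))" .
  qed
qed

lemma ft_eq_0_imp_AE:
  fixes f :: "'a::euclidean_space \<Rightarrow> complex"
  assumes f: "integrable lborel f" "l2 f" and z: "\<And>k. ft f k = 0"
  shows "AE x in lborel. f x = 0"
proof (rule l2_eq_0_AE[OF f(2)])
  have "ft f = (\<lambda>k. 0)" using z by auto
  then have "l2norm (ft f) = 0" by (simp add: l2norm_def)
  then show "l2norm f = 0" unfolding Plancherel_norm[OF f] by simp
qed

subsection \<open>Test functions\<close>

text \<open>The powers of t in the denominator make the span of these functions closed under
  differentiation.\<close>

definition flat :: "nat \<Rightarrow> real \<Rightarrow> real" where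
  "flat m t = (if t \<le> 0 then 0 else exp (- (1 / t)) / t ^ m)"

lemma flat_tendsto_0: "((\<lambda>t. flat m t) \<longlongrightarrow> 0) (at 0)"
proof -
  have "((\<lambda>t. inverse t ^ m / exp (inverse t)) \<longlongrightarrow> (0::real)) (at_right 0)"
    by (rule filterlim_compose[OF tendsto_power_div_exp_0 filterlim_inverse_at_top_right])
  moreover have "\<forall>\<^sub>F t in at_right 0. inverse t ^ m / exp (inverse t) = flat m t"
    using eventually_at_right_less[of "0::real"]
    by eventually_elim (simp add: flat_def exp_minus divide_inverse power_inverse mult.commute)
  ultimately have r: "((\<lambda>t. flat m t) \<longlongrightarrow> 0) (at_right 0)"
    by (rule Lim_transform_eventually)
  have "\<forall>\<^sub>F t in at_left 0. 0 = flat m t"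
    by (simp add: eventually_at_filter flat_def)
  then have l: "((\<lambda>t. flat m t) \<longlongrightarrow> 0) (at_left 0)"
    by (rule Lim_transform_eventually[OF tendsto_const])
  show ?thesis using l r by (simp add: filterlim_at_split)
qed

lemma flat_deriv: "(flat m has_real_derivative flat (m + 2) t - real m * flat (m + 1) t) (at t)"
proof -
  consider "t < 0" | "t = 0" | "t > 0" by linarith
  then show ?thesis
  proof cases
    case 1
    have "((\<lambda>_. 0) has_real_derivative 0) (at t)" by simp
    then have "(flat m has_real_derivative 0) (at t)"
      by (rule has_field_derivative_transform_within[where S=UNIV and d="- t"]) (use 1 in \<open>auto simp: flat_def dist_real_def\<close>)
    then show ?thesis using 1 by (simp add: flat_def)
  next
    case 2
    have "((\<lambda>h. flat (m + 1) h) \<longlongrightarrow> 0) (at 0)" by (rule flat_tendsto_0)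
    \<comment> \<open>The difference quotient at 0 is again a member of the family, with m raised by
      one.\<close>
    moreover have "(flat m (0 + h) - flat m 0) / h = flat (m + 1) h" for h
      by (simp add: flat_def)
    ultimately have "(flat m has_real_derivative 0) (at 0)" by (simp add: DERIV_def)
    then show ?thesis using 2 by (simp add: flat_def)
  next
    case 3
    have "((\<lambda>t. exp (- (1 / t)) / t ^ m) has_real_derivative exp (- (1 / t)) / t ^ (m + 2) - real m * (exp (- (1 / t)) / t ^ (m + 1))) (at t)"
      using 3 by (auto intro!: derivative_eq_intros simp: field_simps power2_eq_square) 
         (cases m; simp add: field_simps)
    then have "(flat m has_real_derivative exp (- (1 / t)) / t ^ (m + 2) - real m * (exp (- (1 / t)) / t ^ (m + 1))) (at t)"
      by (rule has_field_derivative_transform_within[where S=UNIV and d=t]) (use 3 in \<open>auto simp: flat_def dist_real_def\<close>)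
    then show ?thesis using 3 by (simp add: flat_def)
  qed
qed

text \<open>A class of functions containing the bumps \<open>exp (- 1 / (r\<^sup>2 - |x - a|\<^sup>2))\<close> and closed under
  directional derivatives.\<close>

inductive bump_class :: "'a::euclidean_space \<Rightarrow> real \<Rightarrow> ('a \<Rightarrow> real) \<Rightarrow> bool" for a r where
  base: "bump_class a r (\<lambda>x. flat m (r\<^sup>2 - (x - a) \<bullet> (x - a)))"
| times: "bump_class a r f \<Longrightarrow> bump_class a r (\<lambda>x. ((x - a) \<bullet> v) * f x)"
| add: "bump_class a r f \<Longrightarrow> bump_class a r g \<Longrightarrow> bump_class a r (\<lambda>x. f x + g x)"
| scale: "bump_class a r f \<Longrightarrow> bump_class a r (\<lambda>x. c * f x)"

lemma bump_class_deriv: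
  assumes "bump_class a r f"
  shows "\<exists>f'. (\<forall>x. (f has_derivative f' x) (at x)) \<and> (\<forall>v. bump_class a r (\<lambda>x. f' x v))"
  using assms
proof induction
  case (base m)
  let ?g = "\<lambda>x. r\<^sup>2 - (x - a) \<bullet> (x - a)"
  let ?f' = "\<lambda>x v. (flat (m + 2) (?g x) - real m * flat (m + 1) (?g x)) * (- 2 * ((x - a) \<bullet> v))"
  have "((\<lambda>x. flat m (?g x)) has_derivative ?f' x) (at x)" for x
  proof -
    have g: "(?g has_derivative (\<lambda>v. - 2 * ((x - a) \<bullet> v))) (at x)"
      by (auto intro!: derivative_eq_intros simp: inner_commute)
    have "(flat m has_derivative (*) (flat (m + 2) (?g x) - real m * flat (m + 1) (?g x))) (at (?g x))"
      using flat_deriv[of m "?g x"] by (simp add: has_field_derivative_def)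
    from has_derivative_compose[OF g this] show ?thesis .
  qed
  moreover have "bump_class a r (\<lambda>x. ?f' x v)" for v
  proof -
    have "bump_class a r (\<lambda>x. (- 2) * (((x - a) \<bullet> v) * (flat (m + 2) (?g x) + (- real m) * flat (m + 1) (?g x))))"
      by (intro bump_class.intros)
    then show ?thesis by (simp add: algebra_simps)
  qed
  ultimately show ?case by (intro exI[of _ ?f'] conjI allI)
next
  case (times f w)
  then obtain f' where f': "\<And>x. (f has_derivative f' x) (at x)" "\<And>v. bump_class a r (\<lambda>x. f' x v)" by blast
  have "((\<lambda>x. ((x - a) \<bullet> w) * f x) has_derivative (\<lambda>v. ((x - a) \<bullet> w) * f' x v + (v \<bullet> w) * f x)) (at x)" for x
    by (auto intro!: derivative_eq_intros f')
  moreover have "bump_class a r (\<lambda>x. ((x - a) \<bullet> w) * f' x v + (v \<bullet> w) * f x)" for v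
    using times.hyps f'(2) by (intro bump_class.intros)
  ultimately show ?case by (intro exI[of _ "\<lambda>x v. ((x - a) \<bullet> w) * f' x v + (v \<bullet> w) * f x"]) blast
next
  case (add f g)
  obtain f' where f': "\<And>x. (f has_derivative f' x) (at x)" "\<And>v. bump_class a r (\<lambda>x. f' x v)" using add by blast
  obtain g' where g': "\<And>x. (g has_derivative g' x) (at x)" "\<And>v. bump_class a r (\<lambda>x. g' x v)" using add by blast
  show ?case
    by (intro exI[of _ "\<lambda>x v. f' x v + g' x v"] conjI allI has_derivative_add f' g' bump_class.intros)
next
  case (scale f c)
  then obtain f' where f': "\<And>x. (f has_derivative f' x) (at x)" "\<And>v. bump_class a r (\<lambda>x. f' x v)" by blast
  show ?case
    by (intro exI[of _ "\<lambda>x v. c * f' x v"] conjI allI has_derivative_mult_right f' bump_class.intros)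
qed

lemma bump_class_smooth: "bump_class a r f \<Longrightarrow> smooth_on UNIV f"
proof -
  have "\<forall>f. bump_class a r f \<longrightarrow> times_differentiable_on k UNIV f" for k
  proof (induction k)
    case 0
    show ?case
    proof (intro allI impI)
      fix f assume "bump_class a r f"
      then obtain f' where "\<And>x. (f has_derivative f' x) (at x)" using bump_class_deriv by blast
      then show "times_differentiable_on 0 UNIV f"
        by (auto intro!: continuous_at_imp_continuous_on has_derivative_continuous)
    qed
  next
    case (Suc k)
    show ?case
    proof (intro allI impI)
      fix f assume "bump_class a r f"
      then obtain f' where f': "\<And>x. (f has_derivative f' x) (at x)" "\<And>v. bump_class a r (\<lambda>x. f' x v)"
        using bump_class_deriv by blast
      have "frechet_derivative f (at x) = f' x" for x using frechet_derivative_at[OF f'(1)] by simp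
      then show "times_differentiable_on (Suc k) UNIV f"
        using f' Suc by (auto simp: differentiable_def)
    qed
  qed
  then show "bump_class a r f \<Longrightarrow> smooth_on UNIV f" by (simp add: smooth_on_def)
qed

definition bump :: "'a::euclidean_space \<Rightarrow> real \<Rightarrow> 'a \<Rightarrow> real" where
  "bump a r x = flat 0 (r\<^sup>2 - (x - a) \<bullet> (x - a))"

lemma bump_nonneg: "0 \<le> bump a r x"
  by (simp add: bump_def flat_def)

lemma bump_pos_iff:
  assumes "r > 0"
  shows "0 < bump a r x \<longleftrightarrow> norm (x - a) < r"
proof -
  have "(x - a) \<bullet> (x - a) < r\<^sup>2 \<longleftrightarrow> norm (x - a) < r"
    unfolding power2_norm_eq_inner[symmetric] using assms
    by (metis norm_ge_zero power2_less_imp_less power_strict_mono less_imp_le zero_less_numeral)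
  then show ?thesis
    unfolding bump_def flat_def by (cases "(x - a) \<bullet> (x - a) < r\<^sup>2") (auto simp: not_less)
qed

lemma bump_eq_0: "r > 0 \<Longrightarrow> r \<le> norm (x - a) \<Longrightarrow> bump a r x = 0"
  using bump_pos_iff[of r a x] bump_nonneg[of a r x] by linarith

lemma test_function_bump: "r > 0 \<Longrightarrow> test_function (bump a r)"
  unfolding test_function_def
proof
  show "smooth_on UNIV (bump a r)"
    using bump_class_smooth[OF bump_class.base[of a r 0]] by (simp add: bump_def[abs_def])
  assume "r > 0"
  then show "\<exists>K. compact K \<and> (\<forall>x. x \<notin> K \<longrightarrow> bump a r x = 0)"
    by (intro exI[of _ "cball a r"]) (auto simp: dist_norm norm_minus_commute intro!: bump_eq_0)
qed

lemma bump_translate: "bump a r x = bump 0 r (x - a)"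
  by (simp add: bump_def)

section \<open>Integrability and derivatives of test functions\<close>

lemma test_function_continuous: "test_function \<phi> \<Longrightarrow> continuous_on UNIV \<phi>"
  unfolding test_function_def smooth_on_def using times_differentiable_on.simps(1) by blast

lemma test_function_measurable [measurable_dest]: "test_function \<phi> \<Longrightarrow> \<phi> \<in> borel_measurable borel"
  by (intro borel_measurable_continuous_onI test_function_continuous)

lemma test_function_bounded: "test_function \<phi> \<Longrightarrow> \<exists>B\<ge>0. \<forall>x. \<bar>\<phi> x\<bar> \<le> B"
proof -
  assume t: "test_function \<phi>"
  then obtain K where K: "compact K" "\<And>x. x \<notin> K \<Longrightarrow> \<phi> x = 0" unfolding test_function_def by blast
  have "compact (\<phi> ` K)"
    using K test_function_continuous[OF t] by (intro compact_continuous_image) (auto intro: continuous_on_subset)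
  then obtain B where B: "\<And>y. y \<in> \<phi> ` K \<Longrightarrow> norm y \<le> B"
    using compact_imp_bounded bounded_iff by metis
  have "\<bar>\<phi> x\<bar> \<le> max B 0" for x
    using B[of "\<phi> x"] K(2)[of x] by (cases "x \<in> K") auto
  then show ?thesis by (intro exI[of _ "max B 0"]) auto
qed

lemma integrable_test_function:
  assumes t: "test_function \<phi>"
  shows "integrable lborel \<phi>" "l2 \<phi>"
proof -
  obtain K where K: "compact K" "\<And>x. x \<notin> K \<Longrightarrow> \<phi> x = 0" using t unfolding test_function_def by blast
  obtain B where B: "\<And>x. \<bar>\<phi> x\<bar> \<le> B" using test_function_bounded[OF t] by blast
  show i: "integrable lborel \<phi>"
  proof (rule Bochner_Integration.integrable_bound)
    have "emeasure lborel K < \<infinity>" by (rule emeasure_bounded_finite) (use K compact_imp_bounded in auto)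
    then show "integrable lborel (\<lambda>x. indicator K x * B)"
      using K by (intro integrable_mult_left integrable_real_indicator) (auto simp: compact_imp_closed)
    show "AE x in lborel. norm (\<phi> x) \<le> norm (indicator K x * B)"
      using B K(2) by (intro always_eventually allI) (auto simp: indicator_def intro: order_trans[OF _ abs_ge_self])
    show "\<phi> \<in> borel_measurable lborel" using test_function_measurable[OF t] by simp
  qed
  show "l2 \<phi>" by (rule bounded_integrable_l2[OF i]) (use B in auto)
qed

lemma integrable_test_function_complex:
  assumes t: "test_function \<phi>"
  shows "integrable lborel (\<lambda>x. complex_of_real (\<phi> x))" "l2 (\<lambda>x. complex_of_real (\<phi> x))"
  using integrable_test_function[OF t] by (auto simp: l2_of_real_iff)

lemma test_function_has_derivative:
  "test_function \<phi> \<Longrightarrow> (\<phi> has_derivative frechet_derivative \<phi> (at x)) (at x)"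
  unfolding test_function_def smooth_on_def
  using times_differentiable_on.simps(2)[of 0 UNIV \<phi>] frechet_derivative_works by blast

lemma test_function_derivative:
  assumes t: "test_function \<phi>"
  shows "test_function (\<lambda>x. frechet_derivative \<phi> (at x) v)"
proof -
  obtain K where K: "compact K" "\<And>x. x \<notin> K \<Longrightarrow> \<phi> x = 0" using t unfolding test_function_def by blast
  have "smooth_on UNIV (\<lambda>x. frechet_derivative \<phi> (at x) v)"
    using t unfolding test_function_def smooth_on_def by (metis times_differentiable_on.simps(2))
  moreover have "frechet_derivative \<phi> (at x) v = 0" if x: "x \<notin> K" for x
  proof -
    have "((\<lambda>_. 0::real) has_derivative (\<lambda>_. 0)) (at x)" by simp
    then have "(\<phi> has_derivative (\<lambda>_. 0)) (at x)"
      by (rule has_derivative_transform_within_open[where s="- K"])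
         (use K x in \<open>auto simp: compact_imp_closed open_Compl\<close>)
    then show ?thesis using frechet_derivative_at by metis
  qed
  ultimately show ?thesis using K(1) unfolding test_function_def by blast
qed

text \<open>The mean value theorem along v; it supplies the dominating bound for the difference
  quotients in \<open>fourier_derivative\<close>.\<close>

lemma test_function_diff_le:
  assumes t: "test_function \<phi>" and B: "\<And>x. \<bar>frechet_derivative \<phi> (at x) v\<bar> \<le> B" and h: "h > 0"
  shows "\<bar>\<phi> (x + h *\<^sub>R v) - \<phi> x\<bar> \<le> h * B"
proof -
  have d: "((\<lambda>u. \<phi> (x + u *\<^sub>R v)) has_real_derivative frechet_derivative \<phi> (at (x + u *\<^sub>R v)) v) (at u)" for u
  proof -
    have "((\<lambda>u. x + u *\<^sub>R v) has_derivative (\<lambda>u. u *\<^sub>R v)) (at u)" by (auto intro!: derivative_eq_intros)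
    from has_derivative_compose[OF this test_function_has_derivative[OF t]]
    have "((\<lambda>u. \<phi> (x + u *\<^sub>R v)) has_derivative (\<lambda>w. frechet_derivative \<phi> (at (x + u *\<^sub>R v)) (w *\<^sub>R v))) (at u)" .
    moreover have "frechet_derivative \<phi> (at (x + u *\<^sub>R v)) (w *\<^sub>R v) = frechet_derivative \<phi> (at (x + u *\<^sub>R v)) v * w" for w
      using linear_frechet_derivative[of \<phi> "at (x + u *\<^sub>R v)"] test_function_has_derivative[OF t]
      by (simp add: linear_cmul differentiable_def mult.commute) (metis linear_cmul scaleR_conv_of_real real_scaleR_def mult.commute differentiableI)
    ultimately show ?thesis by (simp add: has_field_derivative_def)
  qed
  obtain z where "\<phi> (x + h *\<^sub>R v) - \<phi> (x + 0 *\<^sub>R v) = (h - 0) * frechet_derivative \<phi> (at (x + z *\<^sub>R v)) v"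
    using MVT2[OF h, of "\<lambda>u. \<phi> (x + u *\<^sub>R v)" "\<lambda>u. frechet_derivative \<phi> (at (x + u *\<^sub>R v)) v"] d by blast
  then have "\<bar>\<phi> (x + h *\<^sub>R v) - \<phi> x\<bar> = h * \<bar>frechet_derivative \<phi> (at (x + z *\<^sub>R v)) v\<bar>"
    using h by (simp add: abs_mult)
  also have "\<dots> \<le> h * B" using B h by (intro mult_left_mono) auto
  finally show ?thesis .
qed

text \<open>In place of integration by parts, difference quotients: a translation multiplies the
  transform by a character in k, and the difference quotient of that character at 0 tends to i times
  the inner product of k and v.\<close>

lemma fourier_derivative:
  fixes \<phi> :: "'a::euclidean_space \<Rightarrow> real"
  assumes t: "test_function \<phi>"
  shows "fourier (\<lambda>x. frechet_derivative \<phi> (at x) v) k = \<i> * of_real (k \<bullet> v) * fourier \<phi> k"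
proof (rule LIMSEQ_unique)
  define h where "h m = inverse (real (Suc m))" for m
  have h: "h m > 0" "h m \<le> 1" "h \<longlonglongrightarrow> 0" for m
    using LIMSEQ_inverse_real_of_nat unfolding h_def[abs_def] by (auto simp: field_simps)
  have hn: "filterlim h (at 0) sequentially"
    using h by (auto simp: filterlim_at intro!: always_eventually) (metis less_irrefl)
  define q where "q m x = (\<phi> (x + h m *\<^sub>R v) - \<phi> x) / h m" for m x
  obtain K where K: "compact K" "\<And>x. x \<notin> K \<Longrightarrow> \<phi> x = 0" using t unfolding test_function_def by blast
  obtain R where R: "\<And>x. x \<in> K \<Longrightarrow> norm x \<le> R" using compact_imp_bounded[OF K(1)] bounded_iff by metis
  obtain B where B: "0 \<le> B" "\<And>x. \<bar>frechet_derivative \<phi> (at x) v\<bar> \<le> B"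
    using test_function_bounded[OF test_function_derivative[OF t, of v]] by blast
  have [measurable]: "\<phi> \<in> borel_measurable borel" "(\<lambda>x. frechet_derivative \<phi> (at x) v) \<in> borel_measurable borel"
    using test_function_measurable t test_function_derivative by blast+
  have lim: "(\<lambda>m. q m x) \<longlonglongrightarrow> frechet_derivative \<phi> (at x) v" for x
  proof -
    have "((\<lambda>u. \<phi> (x + u *\<^sub>R v)) has_derivative (\<lambda>w. frechet_derivative \<phi> (at (x + 0 *\<^sub>R v)) (w *\<^sub>R v))) (at 0)"
    proof -
      have "((\<lambda>u. x + u *\<^sub>R v) has_derivative (\<lambda>u. u *\<^sub>R v)) (at 0)" by (auto intro!: derivative_eq_intros)
      from has_derivative_compose[OF this test_function_has_derivative[OF t]] show ?thesis .
    qed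
    moreover have "frechet_derivative \<phi> (at x) (w *\<^sub>R v) = frechet_derivative \<phi> (at x) v * w" for w
      using has_derivative_linear[OF test_function_has_derivative[OF t, of x]] linear_cmul[of "frechet_derivative \<phi> (at x)" w v]
      by (simp add: mult.commute)
    ultimately have "((\<lambda>u. \<phi> (x + u *\<^sub>R v)) has_real_derivative frechet_derivative \<phi> (at x) v) (at 0)"
      by (simp add: has_field_derivative_def)
    then have "((\<lambda>u. (\<phi> (x + u *\<^sub>R v) - \<phi> x) / u) \<longlongrightarrow> frechet_derivative \<phi> (at x) v) (at 0)"
      by (simp add: DERIV_def)
    from filterlim_compose[OF this hn] show ?thesis by (simp add: q_def)
  qed
  show "(\<lambda>m. fourier (q m) k) \<longlonglongrightarrow> fourier (\<lambda>x. frechet_derivative \<phi> (at x) v) k"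
    unfolding fourier_def
  \<comment> \<open>The step sizes are at most 1, so all quotients vanish outside the ball of radius
    \<open>R + norm v\<close>.\<close>
  proof (rule integral_dominated_convergence[where w="\<lambda>x. indicator (cball 0 (R + norm v)) x * B"])
    have "emeasure lborel (cball 0 (R + norm v) :: 'a set) < \<infinity>" by (rule emeasure_bounded_finite) auto
    then show "integrable lborel (\<lambda>x::'a. indicator (cball 0 (R + norm v)) x * B)"
      by (intro integrable_mult_left integrable_real_indicator) auto
    show "AE x in lborel. (\<lambda>m. q m x *\<^sub>R cis (- (k \<bullet> x))) \<longlonglongrightarrow> frechet_derivative \<phi> (at x) v *\<^sub>R cis (- (k \<bullet> x))"
      by (intro always_eventually allI tendsto_scaleR lim tendsto_const)
    show "AE x in lborel. norm (q m x *\<^sub>R cis (- (k \<bullet> x))) \<le> indicator (cball 0 (R + norm v)) x * B" for m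
    proof (intro always_eventually allI)
      fix x :: 'a
      have "\<bar>q m x\<bar> \<le> indicator (cball 0 (R + norm v)) x * B"
      proof (cases "x \<in> cball 0 (R + norm v)")
        case True
        have "\<bar>q m x\<bar> \<le> B"
          unfolding q_def abs_divide using test_function_diff_le[OF t B(2) h(1), of x m] h(1)[of m]
          by (simp add: pos_divide_le_eq mult.commute)
        then show ?thesis using True by simp
      next
        case False
        have "norm x \<le> norm (x + h m *\<^sub>R v) + norm (h m *\<^sub>R v)"
          by (metis add_diff_cancel norm_triangle_ineq4)
        moreover have "norm (h m *\<^sub>R v) \<le> norm v" using h(1,2)[of m] by (simp add: mult_left_le_one_le)
        ultimately have "x + h m *\<^sub>R v \<notin> K" "x \<notin> K" using False R[of x] R[of "x + h m *\<^sub>R v"] norm_ge_zero[of v]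
          by (auto simp del: norm_ge_zero)
        then show ?thesis using K(2) False by (simp add: q_def)
      qed
      then show "norm (q m x *\<^sub>R cis (- (k \<bullet> x))) \<le> indicator (cball 0 (R + norm v)) x * B" by simp
    qed
  qed (unfold q_def, measurable)
  have "fourier (q m) k = ((cis (h m * (k \<bullet> v)) - 1) / h m) * fourier \<phi> k" for m
  proof -
    note i = integrable_test_function_complex[OF t]
    have i2: "integrable lborel (\<lambda>x. complex_of_real (\<phi> (x + h m *\<^sub>R v)))"
      using i(1) integrable_lborel_translate_iff(1)[of "\<lambda>x. complex_of_real (\<phi> x)" "h m *\<^sub>R v"] by blast
    have "fourier (q m) k = (1 / of_real (h m)) * ft (\<lambda>x. complex_of_real (\<phi> (x - (- h m *\<^sub>R v))) - complex_of_real (\<phi> x)) k"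
      unfolding fourier_eq_ft ft_cmult[symmetric] q_def by simp
    also have "\<dots> = (1 / of_real (h m)) * (cis (h m * (k \<bullet> v)) * ft (\<lambda>x. complex_of_real (\<phi> x)) k - ft (\<lambda>x. complex_of_real (\<phi> x)) k)"
      using i i2 ft_translate[of "\<lambda>x. complex_of_real (\<phi> x)" "- h m *\<^sub>R v" k] by (simp add: ft_diff)
    finally show ?thesis by (simp add: fourier_eq_ft algebra_simps diff_divide_distrib)
  qed
  moreover have "(\<lambda>m. ((cis (h m * (k \<bullet> v)) - 1) / h m) * fourier \<phi> k) \<longlonglongrightarrow> \<i> * of_real (k \<bullet> v) * fourier \<phi> k"
  proof (rule tendsto_mult_right)
    have "((\<lambda>z. exp (\<i> * of_real (k \<bullet> v) * z)) has_field_derivative \<i> * of_real (k \<bullet> v)) (at 0)"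
      by (auto intro!: derivative_eq_intros)
    then have "((\<lambda>z. (exp (\<i> * of_real (k \<bullet> v) * z) - 1) / z) \<longlongrightarrow> \<i> * of_real (k \<bullet> v)) (at 0)"
      by (simp add: DERIV_def)
    moreover have "filterlim (\<lambda>m. complex_of_real (h m)) (at 0) sequentially"
      using h by (auto simp: filterlim_at intro!: always_eventually tendsto_of_real[of h 0, simplified]) (metis less_irrefl)
    ultimately have "(\<lambda>m. (exp (\<i> * of_real (k \<bullet> v) * of_real (h m)) - 1) / of_real (h m)) \<longlonglongrightarrow> \<i> * of_real (k \<bullet> v)"
      by (rule filterlim_compose)
    then show "(\<lambda>m. (cis (h m * (k \<bullet> v)) - 1) / complex_of_real (h m)) \<longlonglongrightarrow> \<i> * complex_of_real (k \<bullet> v)"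
      by (simp add: cis_conv_exp mult_ac)
  qed
  ultimately show "(\<lambda>m. fourier (q m) k) \<longlonglongrightarrow> \<i> * of_real (k \<bullet> v) * fourier \<phi> k" by simp
qed

subsection \<open>Fourier transforms of test functions\<close>

text \<open>Each derivative in direction v brings one factor \<open>k \<bullet> v\<close>, while
  transforms of test functions are bounded.\<close>

lemma fourier_decay_direction:
  assumes "test_function \<phi>"
  shows "\<exists>C\<ge>0. \<forall>k. \<bar>k \<bullet> v\<bar> ^ N * norm (fourier \<phi> k) \<le> C"
  using assms
proof (induction N arbitrary: \<phi>)
  case 0
  then show ?case
    using norm_ft_le[of "\<lambda>x. complex_of_real (\<phi> x)"]
    by (intro exI[of _ "LINT x|lborel. norm (complex_of_real (\<phi> x))"]) (auto simp: fourier_eq_ft)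
next
  case (Suc N)
  from Suc.IH[OF test_function_derivative[OF Suc.prems, of v]]
  obtain C where "C \<ge> 0" "\<And>k. \<bar>k \<bullet> v\<bar> ^ N * norm (fourier (\<lambda>x. frechet_derivative \<phi> (at x) v) k) \<le> C" by blast
  then show ?case
    by (intro exI[of _ C]) (auto simp: fourier_derivative[OF Suc.prems] norm_mult mult_ac)
qed

lemma norm_power_le_sum_Basis:
  fixes k :: "'a::euclidean_space"
  shows "norm k ^ N \<le> sqrt (DIM('a)) ^ N * (\<Sum>b\<in>Basis. \<bar>k \<bullet> b\<bar> ^ N)"
proof -
  have "infnorm k \<in> (\<lambda>i. \<bar>k \<bullet> i\<bar>) ` Basis"
    unfolding infnorm_Max by (intro Max_in) auto
  then obtain b where b: "b \<in> Basis" "infnorm k = \<bar>k \<bullet> b\<bar>" by auto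
  have "norm k ^ N \<le> (sqrt (DIM('a)) * infnorm k) ^ N"
    by (intro power_mono norm_le_infnorm) auto
  also have "\<dots> = sqrt (DIM('a)) ^ N * \<bar>k \<bullet> b\<bar> ^ N" unfolding b(2) by (rule power_mult_distrib)
  also have "\<dots> \<le> sqrt (DIM('a)) ^ N * (\<Sum>b\<in>Basis. \<bar>k \<bullet> b\<bar> ^ N)"
    using b(1) by (intro mult_left_mono member_le_sum) auto
  finally show ?thesis .
qed

lemma fourier_decay:
  fixes \<phi> :: "'a::euclidean_space \<Rightarrow> real"
  assumes "test_function \<phi>"
  shows "\<exists>C\<ge>0. \<forall>k. (1 + norm k) ^ N * norm (fourier \<phi> k) \<le> C"
proof -
  obtain C where C: "\<And>v. C v \<ge> 0" "\<And>v k. \<bar>k \<bullet> v\<bar> ^ N * norm (fourier \<phi> k) \<le> C v"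
    using fourier_decay_direction[OF assms, of _ N] by metis
  obtain C0 where C0: "C0 \<ge> 0" "\<And>k. norm (fourier \<phi> k) \<le> C0"
    using fourier_decay_direction[OF assms, of 0 0] by auto
  have "(1 + norm k) ^ N * norm (fourier \<phi> k) \<le> 2 ^ N * (C0 + sqrt (DIM('a)) ^ N * (\<Sum>b\<in>Basis. C b))" for k
  proof -
    have "(1 + norm k) ^ N \<le> (2 * max 1 (norm k)) ^ N" by (intro power_mono) auto
    also have "\<dots> = 2 ^ N * max 1 (norm k) ^ N" by (rule power_mult_distrib)
    also have "max 1 (norm k) ^ N \<le> 1 + norm k ^ N" by (auto simp: max_def)
    finally have "(1 + norm k) ^ N * norm (fourier \<phi> k) \<le> 2 ^ N * (1 + norm k ^ N) * norm (fourier \<phi> k)"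
      by (intro mult_right_mono) auto
    also have "\<dots> = 2 ^ N * (norm (fourier \<phi> k) + norm k ^ N * norm (fourier \<phi> k))" by (simp add: algebra_simps)
    also have "\<dots> \<le> 2 ^ N * (C0 + sqrt (DIM('a)) ^ N * (\<Sum>b\<in>Basis. C b))"
    proof (intro mult_left_mono add_mono C0)
      have "norm k ^ N * norm (fourier \<phi> k) \<le> (sqrt (DIM('a)) ^ N * (\<Sum>b\<in>Basis. \<bar>k \<bullet> b\<bar> ^ N)) * norm (fourier \<phi> k)"
        by (intro mult_right_mono norm_power_le_sum_Basis) auto
      also have "\<dots> = sqrt (DIM('a)) ^ N * (\<Sum>b\<in>Basis. \<bar>k \<bullet> b\<bar> ^ N * norm (fourier \<phi> k))"
        by (simp add: sum_distrib_right mult.assoc)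
      also have "\<dots> \<le> sqrt (DIM('a)) ^ N * (\<Sum>b\<in>Basis. C b)"
        by (intro mult_left_mono sum_mono C) auto
      finally show "norm k ^ N * norm (fourier \<phi> k) \<le> sqrt (DIM('a)) ^ N * (\<Sum>b\<in>Basis. C b)" .
    qed auto
    finally show ?thesis .
  qed
  moreover have "0 \<le> 2 ^ N * (C0 + sqrt (DIM('a)) ^ N * (\<Sum>b\<in>Basis. C b))"
    using C0 C by (intro mult_nonneg_nonneg add_nonneg_nonneg sum_nonneg) auto
  ultimately show ?thesis by blast
qed

text \<open>A weight in product form: its integrability reduces to the one-dimensional arctangent
  integral, and it dominates any rapidly decaying function.\<close>

lemma integrable_prod_inverse_square:
  "integrable lborel (\<lambda>k::'a::euclidean_space. \<Prod>b\<in>Basis. inverse (1 + (k \<bullet> b)\<^sup>2))"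
proof -
  interpret P: product_sigma_finite "\<lambda>_::'a. lborel::real measure" ..
  let ?T = "\<lambda>f. \<Sum>b\<in>(Basis::'a set). f b *\<^sub>R b"
  have T[measurable]: "?T \<in> (\<Pi>\<^sub>M b\<in>Basis. lborel) \<rightarrow>\<^sub>M borel" by measurable
  have i: "integrable lborel (\<lambda>x::real. inverse (1 + x\<^sup>2))"
    using integrable_inverse_1_plus_square by (simp add: set_integrable_def einterval_def)
  have int: "integrable (\<Pi>\<^sub>M b\<in>(Basis::'a set). lborel) (\<lambda>f. \<Prod>b\<in>Basis. inverse (1 + (f b :: real)\<^sup>2))"
    by (rule P.product_integrable_prod) (use i in auto)
  have eq: "(\<Prod>b\<in>Basis. inverse (1 + (?T f \<bullet> b)\<^sup>2)) = (\<Prod>b\<in>Basis. inverse (1 + (f b)\<^sup>2))" for f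
    by (intro prod.cong) auto
  have m: "(\<lambda>k::'a. \<Prod>b\<in>Basis. inverse (1 + (k \<bullet> b)\<^sup>2)) \<in> borel_measurable borel" by measurable
  show ?thesis
    by (subst lborel_eq, subst integrable_distr_eq[OF T m], unfold eq) (rule int)
qed

lemma fourier_measurable [measurable]:
  "integrable lborel \<phi> \<Longrightarrow> fourier \<phi> \<in> borel_measurable borel"
  unfolding fourier_eq_ft by (intro ft_measurable) auto

text \<open>Transforms of test functions absorb any factor of polynomial growth. This lets
  multipliers such as \<open>norm k powr (2 * s)\<close> be compared by testing before anything is
  known about their integrability.\<close>

lemma fourier_weighted:
  fixes \<phi> :: "'a::euclidean_space \<Rightarrow> real"
  assumes t: "test_function \<phi>" and p[measurable]: "p \<in> borel_measurable borel"
    and pb: "\<And>k. norm (p k) \<le> D * (1 + norm k) ^ j"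
  shows "integrable lborel (\<lambda>k. p k * fourier \<phi> k)" "l2 (\<lambda>k. p k * fourier \<phi> k)"
    "\<exists>B. \<forall>k. norm (p k * fourier \<phi> k) \<le> B"
proof -
  have [measurable]: "fourier \<phi> \<in> borel_measurable borel"
    using integrable_test_function[OF t] by measurable
  \<comment> \<open>Of the available decay, j powers compensate p and \<open>2 * DIM('a)\<close>
    powers compensate the product weight.\<close>
  obtain C where C: "C \<ge> 0" "\<And>k. (1 + norm k) ^ (j + 2 * DIM('a)) * norm (fourier \<phi> k) \<le> C"
    using fourier_decay[OF t] by blast
  have D: "D \<ge> 0" using pb[of 0] norm_ge_zero[of "p 0"] by (simp del: norm_ge_zero)
  let ?w = "\<lambda>k::'a. \<Prod>b\<in>Basis. inverse (1 + (k \<bullet> b)\<^sup>2)"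
  have le: "norm (p k * fourier \<phi> k) \<le> D * C * ?w k" for k
  proof -
    have "(\<Prod>b\<in>Basis. (1 + (k \<bullet> b)\<^sup>2)) \<le> (\<Prod>b\<in>(Basis::'a set). (1 + norm k)\<^sup>2)"
    proof (intro prod_mono conjI)
      fix b :: 'a assume b: "b \<in> Basis"
      have "(k \<bullet> b)\<^sup>2 \<le> (norm k)\<^sup>2"
        using Basis_le_norm[OF b, of k] by (simp add: abs_le_square_iff[symmetric])
      then show "1 + (k \<bullet> b)\<^sup>2 \<le> (1 + norm k)\<^sup>2" by (simp add: power2_sum add_increasing2)
    qed auto
    also have "\<dots> = (1 + norm k) ^ (2 * DIM('a))" by (simp add: power_mult)
    finally have w: "(\<Prod>b\<in>Basis. (1 + (k \<bullet> b)\<^sup>2)) \<le> (1 + norm k) ^ (2 * DIM('a))" .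
    have wpos: "(\<Prod>b\<in>Basis. (1 + (k \<bullet> b)\<^sup>2)) > 0" by (intro prod_pos) (auto simp: add_pos_nonneg)
    have "norm (p k * fourier \<phi> k) * (\<Prod>b\<in>Basis. (1 + (k \<bullet> b)\<^sup>2)) \<le> (D * (1 + norm k) ^ j) * norm (fourier \<phi> k) * (1 + norm k) ^ (2 * DIM('a))"
      unfolding norm_mult using wpos D by (intro mult_mono pb w) auto
    also have "\<dots> = D * ((1 + norm k) ^ (j + 2 * DIM('a)) * norm (fourier \<phi> k))"
      by (simp add: power_add)
    also have "\<dots> \<le> D * C" by (intro mult_left_mono C D)
    finally have "norm (p k * fourier \<phi> k) \<le> D * C * inverse (\<Prod>b\<in>Basis. (1 + (k \<bullet> b)\<^sup>2))"
      using wpos by (simp add: field_simps)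
    then show ?thesis using prod_inversef[of "\<lambda>b. 1 + (k \<bullet> b)\<^sup>2" Basis] by (simp add: comp_def)
  qed
  have w1: "?w k \<le> 1" for k
    by (intro prod_le_1) (auto simp: inverse_le_1_iff)
  show i: "integrable lborel (\<lambda>k. p k * fourier \<phi> k)"
  proof (rule Bochner_Integration.integrable_bound)
    show "integrable lborel (\<lambda>k. D * C * ?w k)" by (intro integrable_mult_right integrable_prod_inverse_square)
    show "AE k in lborel. norm (p k * fourier \<phi> k) \<le> norm (D * C * ?w k)"
      using le by (intro always_eventually allI) (auto intro: order_trans[OF _ abs_ge_self])
  qed measurable
  have b: "norm (p k * fourier \<phi> k) \<le> D * C" for k
    using le[of k] mult_left_mono[OF w1[of k], of "D * C"] C D by simp
  then show "\<exists>B. \<forall>k. norm (p k * fourier \<phi> k) \<le> B" by blast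
  show "l2 (\<lambda>k. p k * fourier \<phi> k)" by (rule bounded_integrable_l2[OF i b])
qed

lemma norm_powr_le:
  assumes "0 \<le> t" "t \<le> 2"
  shows "norm k powr t \<le> (1 + norm k) ^ 2"
proof -
  have "norm k powr t \<le> (1 + norm k) powr t" using assms by (intro powr_mono2) auto
  also have "\<dots> \<le> (1 + norm k) powr 2" using assms by (intro powr_mono) auto
  also have "\<dots> = (1 + norm k) ^ 2" by (simp add: powr_numeral add_pos_nonneg)
  finally show ?thesis .
qed

text \<open>Gauss summability gives the value; since the transform is integrable, dominated
  convergence removes the damping.\<close>

lemma fourier_inversion_at_0:
  fixes \<phi> :: "'a::euclidean_space \<Rightarrow> real"
  assumes t: "test_function \<phi>"
  shows "(LINT k|lborel. fourier \<phi> k) = (2 * pi) ^ DIM('a) * \<phi> 0"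
proof (rule LIMSEQ_unique)
  have i: "integrable lborel (fourier \<phi>)"
    using fourier_weighted(1)[OF t, of "\<lambda>_. 1" 1 0] by simp
  have [measurable]: "fourier \<phi> \<in> borel_measurable borel" using borel_measurable_integrable[OF i] by simp
  obtain B where B: "\<And>x. \<bar>\<phi> x\<bar> \<le> B" using test_function_bounded[OF t] by blast
  have "isCont \<phi> 0" using test_function_continuous[OF t] by (simp add: continuous_on_eq_continuous_at)
  then show "(\<lambda>m. LINT k|lborel. fourier \<phi> k * wide_gauss m k) \<longlonglongrightarrow> (2 * pi) ^ DIM('a) * \<phi> 0"
    unfolding fourier_eq_ft of_real_mult
    by (intro gauss_summability integrable_test_function_complex[OF t] isCont_of_real) (use B in auto)
  show "(\<lambda>m. LINT k|lborel. fourier \<phi> k * wide_gauss m k) \<longlonglongrightarrow> (LINT k|lborel. fourier \<phi> k)"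
  proof (rule integral_dominated_convergence[where w="\<lambda>k. norm (fourier \<phi> k)"])
    show "AE k in lborel. (\<lambda>m. fourier \<phi> k * complex_of_real (wide_gauss m k)) \<longlonglongrightarrow> fourier \<phi> k"
    proof (intro always_eventually allI)
      fix k show "(\<lambda>m. fourier \<phi> k * complex_of_real (wide_gauss m k)) \<longlonglongrightarrow> fourier \<phi> k"
        using tendsto_mult_left[OF tendsto_of_real[OF tendsto_wide_gauss[of k]], of "fourier \<phi> k"] by simp
    qed
    show "AE k in lborel. norm (fourier \<phi> k * complex_of_real (wide_gauss m k)) \<le> norm (fourier \<phi> k)" for m
      by (intro always_eventually allI)
        (simp add: norm_mult abs_of_pos[OF wide_gauss_bounds(1)] mult_left_le wide_gauss_bounds(2))
  qed (use i in auto)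
qed

lemma frac_laplacian_eq_ft:
  fixes \<phi> :: "'a::euclidean_space \<Rightarrow> real"
  shows "complex_of_real (frac_laplacian \<sigma> \<phi> x) =
    ft (\<lambda>k. of_real (norm k powr (2 * \<sigma>)) * fourier \<phi> k) (- x) / (2 * pi) ^ DIM('a)"
proof -
  define J where "J = (LINT k|lborel. (norm k powr (2 * \<sigma>)) *\<^sub>R (fourier \<phi> k * cis (k \<bullet> x)))"
  have J_ft: "ft (\<lambda>k. of_real (norm k powr (2 * \<sigma>)) * fourier \<phi> k) (- x) = J"
    unfolding ft_def J_def by (simp add: scaleR_conv_of_real mult.assoc inner_commute)
  have "cnj J = (LINT k|lborel. cnj ((norm k powr (2 * \<sigma>)) *\<^sub>R (fourier \<phi> k * cis (k \<bullet> x))))"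
    unfolding J_def by (rule Bochner_Integration.integral_cnj[symmetric])
  also have "\<dots> = (LINT k|lborel. (\<lambda>k. (norm k powr (2 * \<sigma>)) *\<^sub>R (fourier \<phi> k * cis (k \<bullet> x))) (- k))"
    by (simp add: fourier_eq_ft ft_uminus_real cis_cnj)
  also have "\<dots> = J" unfolding J_def by (rule integral_lborel_uminus)
  finally have "complex_of_real (Re J) = J" by (simp add: complex_eq_iff)
  then show ?thesis unfolding J_ft by (simp add: frac_laplacian_def J_def)
qed

lemma integral_times_inverse_ft:
  fixes u :: "'a::euclidean_space \<Rightarrow> real"
  assumes u: "integrable lborel u" and g: "integrable lborel g"
  shows "(LINT x|lborel. complex_of_real (u x) * ft g (- x)) = (LINT k|lborel. cnj (fourier u k) * g k)"
proof -
  have ui: "integrable lborel (\<lambda>x. complex_of_real (u (- x)))"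
    using u integrable_lborel_uminus_iff[of u] by auto
  have ftu: "ft (\<lambda>x. complex_of_real (u (- x))) k = cnj (fourier u k)" for k
    using ft_cnj_uminus[of "\<lambda>x. complex_of_real (u x)" k] by (simp add: fourier_eq_ft)
  have "(LINT x|lborel. complex_of_real (u x) * ft g (- x)) = (LINT x|lborel. complex_of_real (u (- x)) * ft g x)"
    using integral_lborel_uminus[of "\<lambda>x. complex_of_real (u x) * ft g (- x)"] by simp
  also have "\<dots> = (LINT k|lborel. cnj (fourier u k) * g k)"
    using ft_mult_formula[OF ui g] unfolding ftu by simp
  finally show ?thesis .
qed

text \<open>The point where the distributional definition becomes multiplication by the
  symbol.\<close>

lemma integral_frac_laplacian:
  fixes \<phi> u :: "'a::euclidean_space \<Rightarrow> real"
  assumes t: "test_function \<phi>" and u: "integrable lborel u" and \<sigma>: "0 \<le> \<sigma>" "\<sigma> \<le> 1"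
  shows "complex_of_real (LINT x|lborel. u x * frac_laplacian \<sigma> \<phi> x) =
    (LINT k|lborel. of_real (norm k powr (2 * \<sigma>)) * fourier u k * cnj (fourier \<phi> k)) / (2 * pi) ^ DIM('a)"
proof -
  let ?g = "\<lambda>k. of_real (norm k powr (2 * \<sigma>)) * fourier \<phi> k"
  have gi: "integrable lborel ?g"
    by (rule fourier_weighted(1)[OF t, where D=1 and j=2]) (use \<sigma> in \<open>auto intro!: norm_powr_le\<close>)
  have "complex_of_real (LINT x|lborel. u x * frac_laplacian \<sigma> \<phi> x) = (LINT x|lborel. complex_of_real (u x) * complex_of_real (frac_laplacian \<sigma> \<phi> x))"
    by (simp flip: of_real_mult)
  also have "\<dots> = (LINT x|lborel. complex_of_real (u x) * ft ?g (- x)) / (2 * pi) ^ DIM('a)"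
    unfolding frac_laplacian_eq_ft by simp
  also have "(LINT x|lborel. complex_of_real (u x) * ft ?g (- x)) = (LINT k|lborel. cnj (fourier u k) * ?g k)"
    by (rule integral_times_inverse_ft[OF u gi])
  finally have eq: "complex_of_real (LINT x|lborel. u x * frac_laplacian \<sigma> \<phi> x) = (LINT k|lborel. cnj (fourier u k) * ?g k) / (2 * pi) ^ DIM('a)" .
  \<comment> \<open>The left side is real, hence equal to its conjugate; conjugating moves the bar
    from the transform of u to that of the test function.\<close>
  have "complex_of_real (LINT x|lborel. u x * frac_laplacian \<sigma> \<phi> x) = cnj (complex_of_real (LINT x|lborel. u x * frac_laplacian \<sigma> \<phi> x))"
    by simp
  also have "\<dots> = (LINT k|lborel. cnj (cnj (fourier u k) * ?g k)) / (2 * pi) ^ DIM('a)"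
    unfolding eq Bochner_Integration.integral_cnj by simp
  finally show ?thesis by (simp add: mult_ac)
qed

lemma fourier_bump: "fourier (bump a r) k = cis (- (k \<bullet> a)) * fourier (bump 0 r) k"
  unfolding fourier_eq_ft bump_translate[of a] by (rule ft_translate)

text \<open>On the support of the bump the phase is at most 1 in modulus, so the real part of the
  character is at least cos 1 > 0.\<close>

lemma fourier_bump_nonzero:
  fixes k :: "'a::euclidean_space"
  assumes r: "r > 0" and k: "norm k * r \<le> 1"
  shows "fourier (bump 0 r) k \<noteq> 0"
proof -
  have t: "test_function (bump (0::'a) r)" by (rule test_function_bump[OF r])
  note i = integrable_test_function_complex[OF t] integrable_test_function[OF t]
  have "0 < (LINT x|lborel. bump (0::'a) r x)"
  proof (rule ccontr)
    assume "\<not> 0 < (LINT x|lborel. bump (0::'a) r x)"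
    moreover have "0 \<le> (LINT x|lborel. bump (0::'a) r x)" by (simp add: bump_nonneg)
    ultimately have "(LINT x|lborel. bump (0::'a) r x) = 0" by simp
    then have "AE x in lborel. bump (0::'a) r x = 0"
      using integral_nonneg_eq_0_iff_AE[OF i(3)] bump_nonneg by auto
    then have "AE x in lborel. x \<notin> ball (0::'a) r"
      by eventually_elim (use bump_pos_iff[OF r, of 0] in \<open>auto simp: less_le\<close>)
    then have "ball (0::'a) r \<in> null_sets lborel"
      by (subst AE_iff_null_sets) auto
    then have "emeasure lborel (ball (0::'a) r) = 0" by (rule null_setsD1)
    moreover have "measure lborel (ball (0::'a) r) > 0" using content_ball_pos[OF r] by auto
    ultimately show False by (simp add: measure_def)
  qed
  moreover have "cos 1 > (0::real)" by (intro cos_gt_zero_pi) (use pi_gt3 in auto)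
  ultimately have "0 < cos 1 * (LINT x|lborel. bump (0::'a) r x)" by simp
  also have "\<dots> = (LINT x|lborel. cos 1 * bump (0::'a) r x)" by simp
  also have "\<dots> \<le> (LINT x|lborel. Re (complex_of_real (bump 0 r x) * cis (- (k \<bullet> x))))"
  proof (rule integral_mono)
    show "integrable lborel (\<lambda>x::'a. cos 1 * bump 0 r x)" using i by auto
    show "integrable lborel (\<lambda>x. Re (complex_of_real (bump 0 r x) * cis (- (k \<bullet> x))))"
      by (intro integrable_Re integrable_ft i)
    fix x :: 'a
    show "cos 1 * bump 0 r x \<le> Re (complex_of_real (bump 0 r x) * cis (- (k \<bullet> x)))"
    proof (cases "norm x < r")
      case True
      have "\<bar>k \<bullet> x\<bar> \<le> norm k * norm x" by (rule Cauchy_Schwarz_ineq2)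
      also have "\<dots> \<le> norm k * r" using True by (intro mult_left_mono) auto
      finally have "\<bar>k \<bullet> x\<bar> \<le> 1" using k by simp
      then have "cos 1 \<le> cos \<bar>k \<bullet> x\<bar>" by (intro cos_monotone_0_pi_le) (use pi_gt3 in auto)
      then show ?thesis
        using mult_right_mono[of "cos 1" "cos (k \<bullet> x)" "bump 0 r x"] bump_nonneg[of 0 r x] by (simp add: mult.commute)
    next
      case False
      then show ?thesis using bump_eq_0[OF r, of x 0] by simp
    qed
  qed
  also have "\<dots> = Re (fourier (bump 0 r) k)"
    unfolding fourier_eq_ft ft_def by (intro integral_Re integrable_ft i)
  finally show ?thesis by auto
qed

text \<open>Translating a bump multiplies its transform by a character, so the hypothesis says that
  G times the transform of the centred bump has zero Fourier transform and thus vanishes almost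
  everywhere. For the countably many radii 1 / (m + 1) this holds simultaneously, and at each
  frequency a small enough bump has nonzero transform.\<close>

lemma fourier_test_uniqueness:
  fixes G :: "'a::euclidean_space \<Rightarrow> complex"
  assumes G: "\<And>r. r > 0 \<Longrightarrow> integrable lborel (\<lambda>k. G k * fourier (bump 0 r) k)"
      "\<And>r. r > 0 \<Longrightarrow> l2 (\<lambda>k. G k * fourier (bump 0 r) k)"
    and z: "\<And>a r. r > 0 \<Longrightarrow> (LINT k|lborel. G k * fourier (bump a r) k) = 0"
  shows "AE k in lborel. G k = 0"
proof -
  have "AE k in lborel. G k * fourier (bump 0 (1 / real (Suc m))) k = 0" for m
  proof (rule ft_eq_0_imp_AE)
    fix a :: 'a
    have "(LINT k|lborel. G k * fourier (bump a (1 / real (Suc m))) k) = 0"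
      by (intro z) auto
    then show "ft (\<lambda>k. G k * fourier (bump 0 (1 / real (Suc m))) k) a = 0"
      unfolding ft_def fourier_bump[of a] by (simp add: mult_ac inner_commute)
  qed (use G[of "1 / real (Suc m)"] in auto)
  then have "AE k in lborel. \<forall>m. G k * fourier (bump 0 (1 / real (Suc m))) k = 0"
    unfolding AE_all_countable by blast
  then show ?thesis
  proof eventually_elim
    case (elim k)
    obtain m where m: "norm k \<le> real m" using real_arch_simple by blast
    have "fourier (bump 0 (1 / real (Suc m))) k \<noteq> 0"
      by (rule fourier_bump_nonzero) (use m in \<open>auto simp: field_simps\<close>)
    then show ?case using elim by (metis mult_eq_0_iff)
  qed
qed

subsection \<open>The energy space on the Fourier side\<close>

definition L12 :: "('a::euclidean_space \<Rightarrow> real) \<Rightarrow> bool" where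
  "L12 u \<longleftrightarrow> integrable lborel u \<and> l2 u"

lemma L12D:
  assumes "L12 u"
  shows "integrable lborel u" "l2 u" "u \<in> borel_measurable borel"
    "integrable lborel (\<lambda>x. complex_of_real (u x))" "l2 (\<lambda>x. complex_of_real (u x))"
  using assms by (auto simp: L12_def l2_of_real_iff dest: l2D)

lemma L12_diff: "L12 u \<Longrightarrow> L12 v \<Longrightarrow> L12 (\<lambda>x. u x - v x)"
  unfolding L12_def using l2_diff by auto

lemma L12_cmult: "L12 u \<Longrightarrow> L12 (\<lambda>x. c * u x)"
  unfolding L12_def using l2_cmult by auto

lemma L12_bound:
  assumes "L12 u" "v \<in> borel_measurable borel" "AE x in lborel. \<bar>v x\<bar> \<le> \<bar>u x\<bar>"
  shows "L12 v"
  unfolding L12_def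
proof
  show "integrable lborel v"
    by (rule Bochner_Integration.integrable_bound[of _ u]) (use assms in \<open>auto simp: L12_def\<close>)
  show "l2 v"
    by (rule l2_bound[of u]) (use assms in \<open>auto simp: L12_def\<close>)
qed

lemma L12_translate: "L12 u \<Longrightarrow> L12 (\<lambda>x. u (x - a))"
  unfolding L12_def using l2_translate(2) by auto

lemma fourier_diff: "L12 u \<Longrightarrow> L12 v \<Longrightarrow> fourier (\<lambda>x. u x - v x) k = fourier u k - fourier v k"
  unfolding fourier_eq_ft of_real_diff by (intro ft_diff L12D)

lemma fourier_cmult: "fourier (\<lambda>x. c * u x) k = of_real c * fourier u k"
  unfolding fourier_eq_ft using ft_cmult[of "of_real c" "\<lambda>x. complex_of_real (u x)"] by simp

lemma fourier_translate: "fourier (\<lambda>x. u (x - a)) k = cis (- (k \<bullet> a)) * fourier u k"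
  unfolding fourier_eq_ft by (rule ft_translate)

lemma norm_fourier_le: "norm (fourier u k) \<le> (LINT x|lborel. \<bar>u x\<bar>)"
  unfolding fourier_eq_ft using norm_ft_le[of "\<lambda>x. complex_of_real (u x)" k] by simp

lemma l2_fourier: "L12 u \<Longrightarrow> l2 (fourier u)"
  unfolding fourier_eq_ft by (intro Plancherel L12D)

lemma Parseval_real:
  fixes u v :: "'a::euclidean_space \<Rightarrow> real"
  assumes u: "L12 u" and v: "L12 v"
  shows "(LINT k|lborel. fourier u k * cnj (fourier v k)) = of_real ((2 * pi) ^ DIM('a) * (LINT x|lborel. u x * v x))"
proof -
  have "(LINT k|lborel. fourier u k * cnj (fourier v k)) = (2 * pi) ^ DIM('a) * (LINT x|lborel. complex_of_real (u x) * cnj (complex_of_real (v x)))"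
    unfolding fourier_eq_ft by (intro Parseval_L1 L12D u v)
  also have "(LINT x|lborel. complex_of_real (u x) * cnj (complex_of_real (v x))) = of_real (LINT x|lborel. u x * v x)"
    by (simp flip: of_real_mult)
  finally show ?thesis by simp
qed

text \<open>Parseval expresses the pairing of g with a bump through G, and
  \<open>integral_frac_laplacian\<close> expresses the same number through the transform of u;
  uniqueness then identifies the two. Conjugates are compared, because
  \<open>fourier_test_uniqueness\<close> pairs without conjugation.\<close>

lemma weak_frac_laplacian_ft:
  fixes u g :: "'a::euclidean_space \<Rightarrow> real"
  assumes u: "L12 u" and g: "has_weak_frac_laplacian \<sigma> u g" and \<sigma>: "0 \<le> \<sigma>" "\<sigma> \<le> 1"
  shows "\<exists>G. is_ft (\<lambda>x. complex_of_real (g x)) G \<and> (AE k in lborel. G k = of_real (norm k powr (2 * \<sigma>)) * fourier u k)"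
proof -
  have gl2: "l2 (\<lambda>x. complex_of_real (g x))"
    using g unfolding has_weak_frac_laplacian_def square_integrable_iff_l2 l2_of_real_iff by blast
  then obtain G where G: "is_ft (\<lambda>x. complex_of_real (g x)) G" using is_ft_exists by blast
  have Gl2: "l2 G" using is_ftD(2)[OF G] .
  have [measurable]: "fourier u \<in> borel_measurable borel" using L12D(1)[OF u] by measurable
  have cfm[measurable]: "(\<lambda>k. cnj (fourier u k)) \<in> borel_measurable borel"
    using l2D(1)[of "\<lambda>k. cnj (fourier u k)"] l2_fourier[OF u] by simp
  have [measurable]: "(\<lambda>k. cnj (G k)) \<in> borel_measurable borel"
    using l2D(1)[of "\<lambda>k. cnj (G k)"] Gl2 by simp
  let ?p = "\<lambda>k. of_real (norm k powr (2 * \<sigma>)) * cnj (fourier u k)"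
  let ?D = "\<lambda>k. cnj (G k) - ?p k"
  have pm: "?p \<in> borel_measurable borel" by measurable
  have pb: "norm (?p k) \<le> (LINT x|lborel. \<bar>u x\<bar>) * (1 + norm k) ^ 2" for k
  proof -
    have "norm (?p k) = norm k powr (2 * \<sigma>) * norm (fourier u k)" by (simp add: norm_mult)
    also have "\<dots> \<le> (1 + norm k) ^ 2 * (LINT x|lborel. \<bar>u x\<bar>)"
      using \<sigma> by (intro mult_mono norm_powr_le norm_fourier_le) auto
    finally show ?thesis by (simp add: mult.commute)
  qed
  have f1: "integrable lborel (\<lambda>k. ?p k * fourier \<phi> k)" "l2 (\<lambda>k. ?p k * fourier \<phi> k)" if "test_function \<phi>" for \<phi>
    using fourier_weighted[OF that pm pb] by auto
  have f2: "integrable lborel (\<lambda>k. cnj (G k) * fourier \<phi> k)" "l2 (\<lambda>k. cnj (G k) * fourier \<phi> k)" if t: "test_function \<phi>" for \<phi>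
  proof -
    have pl: "l2 (fourier \<phi>)" using integrable_test_function[OF t] by (intro l2_fourier) (auto simp: L12_def)
    show "integrable lborel (\<lambda>k. cnj (G k) * fourier \<phi> k)"
      by (rule integrable_l2_mult) (use Gl2 pl in auto)
    have [measurable]: "fourier \<phi> \<in> borel_measurable borel" using l2D[OF pl] by simp
    let ?B = "LINT x|lborel. \<bar>\<phi> x\<bar>"
    show "l2 (\<lambda>k. cnj (G k) * fourier \<phi> k)"
    proof (rule l2_bound)
      show "l2 (\<lambda>k. complex_of_real ?B * cnj (G k))" using Gl2 by (intro l2_cmult) simp
      have "norm (cnj (G k) * fourier \<phi> k) \<le> norm (complex_of_real ?B * cnj (G k))" for k
        using mult_left_mono[OF norm_fourier_le[of \<phi> k], of "norm (G k)"]
        by (simp add: norm_mult mult.commute)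
      then show "AE k in lborel. norm (cnj (G k) * fourier \<phi> k) \<le> norm (complex_of_real ?B * cnj (G k))" by simp
    qed measurable
  qed
  have "AE k in lborel. ?D k = 0"
  proof (rule fourier_test_uniqueness)
    fix r :: real assume "r > 0"
    then have t: "test_function (bump (0::'a) r)" by (rule test_function_bump)
    show "integrable lborel (\<lambda>k. ?D k * fourier (bump 0 r) k)" "l2 (\<lambda>k. ?D k * fourier (bump 0 r) k)"
      unfolding left_diff_distrib using f1[OF t] f2[OF t] l2_diff by auto
  next
    fix a :: 'a and r :: real assume "r > 0"
    define \<phi> where "\<phi> = bump a r"
    have t: "test_function \<phi>" unfolding \<phi>_def by (rule test_function_bump) fact
    note i = integrable_test_function_complex[OF t]
    have "(LINT k|lborel. G k * cnj (fourier \<phi> k)) = (2 * pi) ^ DIM('a) * (LINT x|lborel. complex_of_real (g x) * cnj (complex_of_real (\<phi> x)))"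
      unfolding fourier_eq_ft by (rule Parseval[OF G is_ft_L1[OF i]])
    also have "(LINT x|lborel. complex_of_real (g x) * cnj (complex_of_real (\<phi> x))) = of_real (LINT x|lborel. g x * \<phi> x)"
      by (simp flip: of_real_mult)
    also have "(LINT x|lborel. g x * \<phi> x) = (LINT x|lborel. u x * frac_laplacian \<sigma> \<phi> x)"
      using g t unfolding has_weak_frac_laplacian_def by simp
    also have "complex_of_real \<dots> = (LINT k|lborel. of_real (norm k powr (2 * \<sigma>)) * fourier u k * cnj (fourier \<phi> k)) / (2 * pi) ^ DIM('a)"
      by (rule integral_frac_laplacian[OF t L12D(1)[OF u] \<sigma>])
    finally have eq: "(LINT k|lborel. G k * cnj (fourier \<phi> k)) = (LINT k|lborel. of_real (norm k powr (2 * \<sigma>)) * fourier u k * cnj (fourier \<phi> k))"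
      by simp
    have "(LINT k|lborel. cnj (G k) * fourier \<phi> k) = (LINT k|lborel. cnj (G k * cnj (fourier \<phi> k)))" by simp
    also have "\<dots> = cnj (LINT k|lborel. G k * cnj (fourier \<phi> k))" by (rule Bochner_Integration.integral_cnj)
    also have "\<dots> = (LINT k|lborel. cnj (of_real (norm k powr (2 * \<sigma>)) * fourier u k * cnj (fourier \<phi> k)))"
      unfolding eq by (rule Bochner_Integration.integral_cnj[symmetric])
    also have "\<dots> = (LINT k|lborel. ?p k * fourier \<phi> k)" by simp
    finally show "(LINT k|lborel. ?D k * fourier (bump a r) k) = 0"
      unfolding left_diff_distrib \<phi>_def[symmetric] using f1[OF t] f2[OF t] by simp
  qed
  then have "AE k in lborel. G k = of_real (norm k powr (2 * \<sigma>)) * fourier u k"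
  proof eventually_elim
    case (elim k)
    then have "cnj (cnj (G k)) = cnj (?p k)" by simp
    then show ?case by simp
  qed
  then show ?thesis using G by blast
qed

text \<open>The weight is the square root of the symbol of (-\<Delta>)^s + 1, so that the energy
  form becomes an L2 inner product.\<close>

definition hat :: "real \<Rightarrow> ('a::euclidean_space \<Rightarrow> real) \<Rightarrow> 'a \<Rightarrow> complex" where
  "hat s u k = of_real (sqrt (1 + norm k powr (2 * s))) * fourier u k"

text \<open>The integrable elements of \<open>sobolev s\<close>, by
  \<open>sobolev_iff_Hs\<close>.\<close>

definition Hs :: "real \<Rightarrow> ('a::euclidean_space \<Rightarrow> real) \<Rightarrow> bool" where
  "Hs s u \<longleftrightarrow> L12 u \<and> l2 (hat s u)"

text \<open>The pairing of (-\<Delta>)^s u + u with v, lower order term included; see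
  \<open>frac_form_eq\<close>.\<close>

definition eform :: "real \<Rightarrow> ('a::euclidean_space \<Rightarrow> real) \<Rightarrow> ('a \<Rightarrow> real) \<Rightarrow> real" where
  "eform s u v = Re (LINT k|lborel. hat s u k * cnj (hat s v k)) / (2 * pi) ^ DIM('a)"

lemma hat_measurable: "L12 u \<Longrightarrow> hat s u \<in> borel_measurable borel"
proof -
  assume "L12 u"
  then have [measurable]: "fourier u \<in> borel_measurable borel" by (intro fourier_measurable L12D)
  show ?thesis unfolding hat_def[abs_def] by measurable
qed

lemma sqrt_weight [simp]: "(sqrt (1 + norm k powr t))\<^sup>2 = 1 + norm k powr t"
  by (simp add: add_nonneg_nonneg)

lemma norm_hat_sq: "(norm (hat s u k))\<^sup>2 = (1 + norm k powr (2 * s)) * (norm (fourier u k))\<^sup>2"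
  by (simp add: hat_def norm_mult power_mult_distrib add_nonneg_nonneg)

lemma Hs_iff:
  assumes "L12 u"
  shows "Hs s u \<longleftrightarrow> integrable lborel (\<lambda>k. norm k powr (2 * s) * (norm (fourier u k))\<^sup>2)"
proof -
  have 1: "integrable lborel (\<lambda>k. (norm (fourier u k))\<^sup>2)" using l2D(3)[OF l2_fourier[OF assms]] .
  have eq: "(\<lambda>k. (norm (hat s u k))\<^sup>2) = (\<lambda>k. (norm (fourier u k))\<^sup>2 + norm k powr (2 * s) * (norm (fourier u k))\<^sup>2)"
    by (simp add: norm_hat_sq algebra_simps)
  have "integrable lborel (\<lambda>k. (norm (hat s u k))\<^sup>2) \<longleftrightarrow> integrable lborel (\<lambda>k. norm k powr (2 * s) * (norm (fourier u k))\<^sup>2)"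
  proof
    assume "integrable lborel (\<lambda>k. (norm (hat s u k))\<^sup>2)"
    from Bochner_Integration.integrable_diff[OF this 1]
    show "integrable lborel (\<lambda>k. norm k powr (2 * s) * (norm (fourier u k))\<^sup>2)"
      by (simp add: norm_hat_sq algebra_simps)
  qed (use 1 in \<open>simp add: eq\<close>)
  then show ?thesis using assms hat_measurable[OF assms] by (auto simp: Hs_def l2_def)
qed

lemma powr_half_sq: "norm k powr (2 * (s / 2)) * norm k powr (2 * (s / 2)) = norm k powr (2 * s)"
  by (simp flip: powr_add)

text \<open>In one direction the transform of a half Laplacian is known; in the other, the inverse
  transform of the weighted transform of u is a half Laplacian.\<close>

lemma sobolev_iff_Hs:
  fixes u :: "'a::euclidean_space \<Rightarrow> real"
  assumes u: "L12 u" and s: "0 \<le> s" "s \<le> 2"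
  shows "u \<in> sobolev s \<longleftrightarrow> Hs s u"
proof
  have [measurable]: "fourier u \<in> borel_measurable borel" using L12D(1)[OF u] by measurable
  have ns: "(norm (complex_of_real (norm k powr (2 * (s/2))) * fourier u k))\<^sup>2 = norm k powr (2 * s) * (norm (fourier u k))\<^sup>2" for k
    unfolding norm_mult power_mult_distrib by (simp add: power2_eq_square flip: powr_add)
  {
    assume "u \<in> sobolev s"
    then obtain g where g: "has_weak_frac_laplacian (s / 2) u g" by (auto simp: sobolev_def)
    obtain G where G: "is_ft (\<lambda>x. complex_of_real (g x)) G" "AE k in lborel. G k = of_real (norm k powr (2 * (s / 2))) * fourier u k"
      using weak_frac_laplacian_ft[OF u g] s by auto
    have [measurable]: "G \<in> borel_measurable borel" using is_ftD[OF G(1)] l2D by blast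
    have "integrable lborel (\<lambda>k. (norm (G k))\<^sup>2)" using l2D(3)[OF is_ftD(2)[OF G(1)]] .
    moreover have "AE k in lborel. (norm (G k))\<^sup>2 = norm k powr (2 * s) * (norm (fourier u k))\<^sup>2"
      using G(2) by eventually_elim (use ns in simp)
    ultimately have "integrable lborel (\<lambda>k. norm k powr (2 * s) * (norm (fourier u k))\<^sup>2)"
      by (subst integrable_cong_AE[symmetric, of "\<lambda>k. (norm (G k))\<^sup>2"]) auto
    then show "Hs s u" using Hs_iff[OF u] by simp
  next
    assume "Hs s u"
    then have i: "integrable lborel (\<lambda>k. norm k powr (2 * s) * (norm (fourier u k))\<^sup>2)" using Hs_iff[OF u] by simp
    let ?F = "\<lambda>k. of_real (norm k powr (2 * (s / 2))) * fourier u k"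
    have "l2 ?F" unfolding l2_def ns using i by auto
    then obtain g where g: "l2 g" "\<And>\<phi>. integrable lborel \<phi> \<and> l2 \<phi> \<Longrightarrow> 
       (2 * pi) ^ DIM('a) * (LINT x|lborel. g x * cnj (\<phi> x)) = (LINT k|lborel. ?F k * cnj (ft \<phi> k))"
      using inverse_ft_exists by blast
    \<comment> \<open>Whether g is real valued need not be decided: its pairings with real test
      functions are real, so \<open>Re\<close> preserves them.\<close>
    have "has_weak_frac_laplacian (s / 2) u (\<lambda>x. Re (g x))"
      unfolding has_weak_frac_laplacian_def square_integrable_iff_l2
    proof (intro conjI allI impI L12D(2)[OF u] l2_Re_Im g)
      fix \<phi> :: "'a \<Rightarrow> real" assume t: "test_function \<phi>"
      note i = integrable_test_function_complex[OF t]
      have "complex_of_real (LINT x|lborel. u x * frac_laplacian (s/2) \<phi> x) = (LINT k|lborel. ?F k * cnj (fourier \<phi> k)) / (2 * pi) ^ DIM('a)"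
        by (rule integral_frac_laplacian[OF t L12D(1)[OF u]]) (use s in auto)
      also have "\<dots> = (LINT x|lborel. g x * cnj (complex_of_real (\<phi> x)))"
        unfolding fourier_eq_ft[of \<phi>] using g(2)[of "\<lambda>x. complex_of_real (\<phi> x)"] i by (simp add: field_simps)
      finally have "complex_of_real (LINT x|lborel. u x * frac_laplacian (s/2) \<phi> x) = (LINT x|lborel. g x * cnj (complex_of_real (\<phi> x)))" .
      from arg_cong[OF this, of Re]
      have "(LINT x|lborel. u x * frac_laplacian (s/2) \<phi> x) = Re (LINT x|lborel. g x * complex_of_real (\<phi> x))"
        unfolding Re_complex_of_real complex_cnj_complex_of_real .
      also have "\<dots> = (LINT x|lborel. Re (g x * complex_of_real (\<phi> x)))"
        by (rule integral_Re[symmetric]) (intro integrable_l2_mult g i)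
      finally show "(LINT x|lborel. u x * frac_laplacian (s/2) \<phi> x) = (LINT x|lborel. Re (g x) * \<phi> x)" by simp
    qed
    then show "u \<in> sobolev s" by (auto simp: sobolev_def)
  }
qed

text \<open>The chosen half Laplacians are arbitrary representatives, but their transforms are
  determined almost everywhere, and Parseval makes the choice invisible.\<close>

lemma frac_form_eq:
  fixes u v :: "'a::euclidean_space \<Rightarrow> real"
  assumes u: "Hs s u" and v: "Hs s v" and s: "0 \<le> s" "s \<le> 2"
  shows "frac_form s u v + (LINT x|lborel. u x * v x) = eform s u v"
proof -
  have L: "L12 u" "L12 v" using u v by (auto simp: Hs_def)
  have hu: "has_weak_frac_laplacian (s / 2) u (half_frac_laplacian s u)"
    and hv: "has_weak_frac_laplacian (s / 2) v (half_frac_laplacian s v)"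
    unfolding half_frac_laplacian_def using sobolev_iff_Hs[OF L(1) s] sobolev_iff_Hs[OF L(2) s] u v
    by (simp_all add: sobolev_def some_eq_ex[of "has_weak_frac_laplacian (s / 2) u"] some_eq_ex[of "has_weak_frac_laplacian (s / 2) v"])
  let ?g = "half_frac_laplacian s u" and ?h = "half_frac_laplacian s v"
  obtain G where G: "is_ft (\<lambda>x. complex_of_real (?g x)) G" "AE k in lborel. G k = of_real (norm k powr (2 * (s / 2))) * fourier u k"
    using weak_frac_laplacian_ft[OF L(1) hu] s by auto
  obtain K where K: "is_ft (\<lambda>x. complex_of_real (?h x)) K" "AE k in lborel. K k = of_real (norm k powr (2 * (s / 2))) * fourier v k"
    using weak_frac_laplacian_ft[OF L(2) hv] s by auto
  have fm[measurable]: "fourier u \<in> borel_measurable borel" "(\<lambda>k. cnj (fourier v k)) \<in> borel_measurable borel"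
    using l2D(1)[OF l2_fourier[OF L(1)]] l2D(1)[of "\<lambda>k. cnj (fourier v k)"] l2_fourier[OF L(2)] by auto
  have [measurable]: "G \<in> borel_measurable borel" "(\<lambda>k. cnj (K k)) \<in> borel_measurable borel"
    using l2D(1)[OF is_ftD(2)[OF G(1)]] l2D(1)[of "\<lambda>k. cnj (K k)"] is_ftD(2)[OF K(1)] by auto
  have GK: "AE k in lborel. G k * cnj (K k) = of_real (norm k powr (2 * s)) * (fourier u k * cnj (fourier v k))"
    using G(2) K(2)
  proof eventually_elim
    case (elim k)
    have "G k * cnj (K k) = of_real (norm k powr (2 * (s/2)) * norm k powr (2 * (s/2))) * (fourier u k * cnj (fourier v k))"
      unfolding elim by (simp add: mult_ac)
    then show ?case by (simp only: powr_half_sq)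
  qed
  have iGK: "integrable lborel (\<lambda>k. G k * cnj (K k))"
    by (rule integrable_l2_mult) (use is_ftD(2)[OF G(1)] is_ftD(2)[OF K(1)] in auto)
  have i1: "integrable lborel (\<lambda>k. of_real (norm k powr (2 * s)) * (fourier u k * cnj (fourier v k)))"
    using iGK by (subst integrable_cong_AE[symmetric, OF _ _ GK]) auto
  have i2: "integrable lborel (\<lambda>k. fourier u k * cnj (fourier v k))"
    by (rule integrable_l2_mult) (use l2_fourier L in auto)
  have "(2 * pi) ^ DIM('a) * complex_of_real (frac_form s u v) = (2 * pi) ^ DIM('a) * (LINT x|lborel. complex_of_real (?g x) * cnj (complex_of_real (?h x)))"
    unfolding frac_form_def by (simp flip: of_real_mult)
  also have "\<dots> = (LINT k|lborel. G k * cnj (K k))" by (rule Parseval[OF G(1) K(1), symmetric])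
  also have "\<dots> = (LINT k|lborel. of_real (norm k powr (2 * s)) * (fourier u k * cnj (fourier v k)))"
    by (rule integral_cong_AE[OF _ _ GK]) auto
  finally have 1: "(2 * pi) ^ DIM('a) * complex_of_real (frac_form s u v) = (LINT k|lborel. of_real (norm k powr (2 * s)) * (fourier u k * cnj (fourier v k)))" .
  have "hat s u k * cnj (hat s v k) = fourier u k * cnj (fourier v k) + of_real (norm k powr (2 * s)) * (fourier u k * cnj (fourier v k))" for k
  proof -
    have "hat s u k * cnj (hat s v k) = of_real ((sqrt (1 + norm k powr (2 * s)))\<^sup>2) * (fourier u k * cnj (fourier v k))"
      unfolding hat_def power2_eq_square of_real_mult complex_cnj_mult complex_cnj_complex_of_real
      by (simp only: mult_ac)
    then show ?thesis unfolding sqrt_weight by (simp add: algebra_simps)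
  qed
  then have "(LINT k|lborel. hat s u k * cnj (hat s v k)) = (LINT k|lborel. fourier u k * cnj (fourier v k)) + (LINT k|lborel. of_real (norm k powr (2 * s)) * (fourier u k * cnj (fourier v k)))"
    using i1 i2 by simp
  also have "\<dots> = of_real ((2 * pi) ^ DIM('a) * ((LINT x|lborel. u x * v x) + frac_form s u v))"
    unfolding 1[symmetric] Parseval_real[OF L] by (simp add: algebra_simps)
  finally show ?thesis unfolding eform_def by (simp add: add.commute)
qed

text \<open>Only integrable variations are retained; positive parts and differences of
  \<open>L12\<close> functions, the variations used later, are of this kind.\<close>

lemma weak_solution_eform:
  assumes sol: "weak_solution s U u f" and u: "L12 u" and s: "0 \<le> s" "s \<le> 2"
  shows "Hs s u"
    "\<And>v. Hs s v \<Longrightarrow> (AE x in lborel. x \<notin> U \<longrightarrow> v x = 0) \<Longrightarrow> eform s u v = (LINT x|lborel. f x * v x)"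
proof -
  show h: "Hs s u" using sol sobolev_iff_Hs[OF u s] unfolding weak_solution_def by simp
  fix v assume v: "Hs s v" "AE x in lborel. x \<notin> U \<longrightarrow> v x = 0"
  then have "v \<in> sobolev s" using sobolev_iff_Hs[OF _ s, of v] by (simp add: Hs_def)
  then have "frac_form s u v + (LINT x|lborel. u x * v x) = (LINT x|lborel. f x * v x)"
    using sol v(2) unfolding weak_solution_def by blast
  then show "eform s u v = (LINT x|lborel. f x * v x)"
    using frac_form_eq[OF h v(1) s] by simp
qed

text \<open>With this normalization the energy norm dominates \<open>l2norm\<close> with constant
  1.\<close>

definition enorm :: "real \<Rightarrow> ('a::euclidean_space \<Rightarrow> real) \<Rightarrow> real" where
  "enorm s u = l2norm (hat s u) / sqrt ((2 * pi) ^ DIM('a))"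

lemma enorm_nonneg [simp]: "0 \<le> enorm s u"
  by (simp add: enorm_def)

lemma eform_self: "eform s u u = (enorm s u)\<^sup>2" if "Hs s u"
proof -
  have "(LINT k|lborel. hat s u k * cnj (hat s u k)) = of_real ((l2norm (hat s u))\<^sup>2)"
    unfolding l2norm_power2 complex_norm_square[symmetric] by (simp del: of_real_power)
  then show ?thesis by (simp add: eform_def enorm_def power_divide)
qed

lemma eform_Cauchy_Schwarz:
  assumes "Hs s u" "Hs s v"
  shows "\<bar>eform s u v\<bar> \<le> enorm s u * enorm s v"
proof -
  have "\<bar>Re (LINT k|lborel. hat s u k * cnj (hat s v k))\<bar> \<le> norm (LINT k|lborel. hat s u k * cnj (hat s v k))"
    by (rule abs_Re_le_cmod)
  also have "\<dots> \<le> l2norm (hat s u) * l2norm (\<lambda>k. cnj (hat s v k))"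
    by (rule l2_Cauchy_Schwarz) (use assms in \<open>auto simp: Hs_def\<close>)
  finally show ?thesis
    unfolding eform_def enorm_def abs_divide by (simp add: divide_right_mono)
qed

lemma hat_linear:
  "L12 u \<Longrightarrow> L12 v \<Longrightarrow> hat s (\<lambda>x. u x - v x) = (\<lambda>k. hat s u k - hat s v k)"
  "hat s (\<lambda>x. c * u x) = (\<lambda>k. of_real c * hat s u k)"
  by (simp_all add: fun_eq_iff hat_def fourier_diff fourier_cmult algebra_simps)

lemma Hs_L12: "Hs s u \<Longrightarrow> L12 u" by (simp add: Hs_def)

lemma Hs_diff: "Hs s u \<Longrightarrow> Hs s v \<Longrightarrow> Hs s (\<lambda>x. u x - v x)"
  by (auto simp: Hs_def L12_diff hat_linear intro: l2_diff)

lemma Hs_cmult: "Hs s u \<Longrightarrow> Hs s (\<lambda>x. c * u x)"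
  by (auto simp: Hs_def L12_cmult hat_linear intro: l2_cmult)

lemma integrable_hat: "Hs s u \<Longrightarrow> Hs s v \<Longrightarrow> integrable lborel (\<lambda>k. hat s u k * cnj (hat s v k))"
  by (intro integrable_l2_mult) (auto simp: Hs_def)

lemma eform_diff_left:
  assumes "Hs s u" "Hs s v" "Hs s w"
  shows "eform s (\<lambda>x. u x - v x) w = eform s u w - eform s v w"
  using integrable_hat[OF assms(1,3)] integrable_hat[OF assms(2,3)] assms
  by (simp add: eform_def hat_linear Hs_L12 left_diff_distrib diff_divide_distrib)

lemma eform_diff_right:
  assumes "Hs s u" "Hs s v" "Hs s w"
  shows "eform s w (\<lambda>x. u x - v x) = eform s w u - eform s w v"
  using integrable_hat[OF assms(3,1)] integrable_hat[OF assms(3,2)] assms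
  by (simp add: eform_def hat_linear Hs_L12 right_diff_distrib diff_divide_distrib)

lemma eform_cmult_left: "eform s (\<lambda>x. c * u x) w = c * eform s u w"
  by (simp add: eform_def hat_linear mult.assoc)

lemma l2norm_le_enorm:
  fixes u :: "'a::euclidean_space \<Rightarrow> real"
  assumes "Hs s u"
  shows "l2norm u \<le> enorm s u"
proof -
  have L: "L12 u" using assms by (rule Hs_L12)
  have "sqrt ((2 * pi) ^ DIM('a)) * l2norm (\<lambda>x. complex_of_real (u x)) = l2norm (fourier u)"
    unfolding fourier_eq_ft by (rule Plancherel_norm[OF L12D(4,5)[OF L], symmetric])
  also have "\<dots> \<le> l2norm (hat s u)"
    unfolding l2norm_def
  proof (intro real_sqrt_le_mono integral_mono)
    show "integrable lborel (\<lambda>k. (norm (fourier u k))\<^sup>2)" "integrable lborel (\<lambda>k. (norm (hat s u k))\<^sup>2)"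
      using l2D(3)[OF l2_fourier[OF L]] assms l2D(3) by (auto simp: Hs_def)
    show "(norm (fourier u k))\<^sup>2 \<le> (norm (hat s u k))\<^sup>2" for k
      unfolding norm_hat_sq by (simp add: algebra_simps)
  qed
  finally have "l2norm (\<lambda>x. complex_of_real (u x)) \<le> enorm s u"
    by (simp add: enorm_def field_simps)
  then show ?thesis by (simp add: l2norm_def)
qed

subsection \<open>Translations and mollifications\<close>

lemma tendsto_cis:
  assumes "(f \<longlongrightarrow> a) F"
  shows "((\<lambda>x. cis (f x)) \<longlongrightarrow> cis a) F"
proof (rule isCont_tendsto_compose[OF _ assms])
  have "continuous_on UNIV cis" by (intro continuous_intros)
  then show "isCont cis a" by (simp add: continuous_on_eq_continuous_at)
qed

lemma continuous_fourier:
  fixes u :: "'a::euclidean_space \<Rightarrow> real"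
  assumes u: "integrable lborel u"
  shows "continuous_on UNIV (fourier u)"
  unfolding continuous_on_sequentially comp_def
proof (intro allI ballI impI)
  have [measurable]: "u \<in> borel_measurable borel" using borel_measurable_integrable[OF u] by simp
  fix x :: "nat \<Rightarrow> 'a" and a assume x: "(\<forall>n. x n \<in> UNIV) \<and> x \<longlonglongrightarrow> a"
  show "(\<lambda>n. fourier u (x n)) \<longlonglongrightarrow> fourier u a"
    unfolding fourier_def
  proof (rule integral_dominated_convergence[where w="\<lambda>x. \<bar>u x\<bar>"])
    show "AE y in lborel. (\<lambda>n. u y *\<^sub>R cis (- (x n \<bullet> y))) \<longlonglongrightarrow> u y *\<^sub>R cis (- (a \<bullet> y))"
    proof (intro always_eventually allI tendsto_scaleR tendsto_const)
      fix y :: 'a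
      show "(\<lambda>n. cis (- (x n \<bullet> y))) \<longlonglongrightarrow> cis (- (a \<bullet> y))"
        using x by (intro tendsto_cis tendsto_minus tendsto_inner tendsto_const) auto
    qed
  qed (use u in auto)
qed

lemma continuous_AE_eq:
  fixes f g :: "'a::euclidean_space \<Rightarrow> 'b::real_normed_vector"
  assumes f: "continuous_on UNIV f" and g: "continuous_on UNIV g" and ae: "AE x in lborel. f x = g x"
  shows "f x = g x"
proof (rule ccontr)
  let ?S = "{x. f x \<noteq> g x}"
  assume "f x \<noteq> g x"
  moreover have "open ?S"
    using open_Collect_neq[OF f g] by simp
  ultimately obtain r where r: "r > 0" "ball x r \<subseteq> ?S" unfolding open_contains_ball by blast
  have "AE y in lborel. y \<notin> ball x r" using ae by eventually_elim (use r in auto)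
  then have "ball x r \<in> null_sets lborel" by (subst AE_iff_null_sets) auto
  then have "emeasure lborel (ball x r) = 0" by (rule null_setsD1)
  moreover have "measure lborel (ball x r) > 0" using content_ball_pos[OF r(1)] by auto
  ultimately show False by (simp add: measure_def)
qed

text \<open>The value of a bump at x is the value of a translated bump at 0, so inversion at 0 is
  enough.\<close>

lemma fourier_inversion_bump:
  fixes x :: "'a::euclidean_space"
  assumes r: "r > 0"
  shows "complex_of_real (bump a r x) = ft (fourier (bump a r)) (- x) / (2 * pi) ^ DIM('a)"
proof -
  have eq: "bump a r y = bump (a - x) r (y - x)" for y unfolding bump_def by simp
  have "ft (fourier (bump a r)) (- x) = (LINT k|lborel. fourier (bump (a - x) r) k)"
    unfolding ft_def fourier_bump[of a] fourier_bump[of "a - x"]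
    by (intro Bochner_Integration.integral_cong refl) (simp add: mult_ac cis_mult inner_diff_right inner_commute flip: mult.assoc)
  also have "\<dots> = (2 * pi) ^ DIM('a) * bump (a - x) r 0"
    by (rule fourier_inversion_at_0[OF test_function_bump[OF r]])
  finally show ?thesis by (simp add: eq[of x])
qed

text \<open>Young's inequality for L1 and L2. Splitting |f| |h| into sqrt |f| and sqrt |f| |h|,
  Cauchy-Schwarz bounds the square of the convolution by the L1 norm of f times the convolution of
  |f| with h^2, which is integrable.\<close>

lemma L12_conv:
  fixes f h :: "'a::euclidean_space \<Rightarrow> real"
  assumes f: "integrable lborel f" and h: "L12 h"
  shows "L12 (conv f h)"
  unfolding L12_def
proof
  show "integrable lborel (conv f h)" by (rule integrable_conv[OF f L12D(1)[OF h]])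
  have [measurable]: "f \<in> borel_measurable borel" "h \<in> borel_measurable borel"
    using borel_measurable_integrable[OF f] L12D(3)[OF h] by auto
  define I where "I = (LINT y|lborel. \<bar>f y\<bar>)"
  have h2: "integrable lborel (\<lambda>y. (h y)\<^sup>2)" using l2D(3)[OF L12D(2)[OF h]] by simp
  have fa: "integrable lborel (\<lambda>y. \<bar>f y\<bar>)" using f by auto
  have ip: "integrable (lborel \<Otimes>\<^sub>M lborel) (\<lambda>(y, x). \<bar>f (x - y)\<bar> * (h y)\<^sup>2)"
    using integrable_conv_pair[OF fa h2] .
  have "AE x in lborel. integrable lborel (\<lambda>y. \<bar>f (x - y)\<bar> * (h y)\<^sup>2)"
    using lborel_pair.AE_integrable_snd[of "\<lambda>y x. \<bar>f (x - y)\<bar> * (h y)\<^sup>2"] ip by simp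
  then have le: "AE x in lborel. (norm (conv f h x))\<^sup>2 \<le> I * conv (\<lambda>x. \<bar>f x\<bar>) (\<lambda>y. (h y)\<^sup>2) x"
  proof eventually_elim
    case (elim x)
    let ?a = "\<lambda>y. sqrt \<bar>f (x - y)\<bar>" and ?b = "\<lambda>y. sqrt \<bar>f (x - y)\<bar> * \<bar>h y\<bar>"
    have a2: "(norm (?a y))\<^sup>2 = \<bar>f (x - y)\<bar>" for y by simp
    have b2: "(norm (?b y))\<^sup>2 = \<bar>f (x - y)\<bar> * (h y)\<^sup>2" for y by (simp add: power_mult_distrib)
    have ai: "integrable lborel (\<lambda>y. \<bar>f (x - y)\<bar>)" using fa integrable_lborel_translate_iff(3)[of "\<lambda>y. \<bar>f y\<bar>" x] by blast
    have l2a: "l2 ?a" and l2b: "l2 ?b" unfolding l2_def a2 b2 using ai elim by auto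
    have na: "(l2norm ?a)\<^sup>2 = I" unfolding l2norm_power2 a2 I_def
      using integral_lborel_translate(3)[of "\<lambda>y. \<bar>f y\<bar>" x] .
    have nb: "(l2norm ?b)\<^sup>2 = conv (\<lambda>x. \<bar>f x\<bar>) (\<lambda>y. (h y)\<^sup>2) x" unfolding l2norm_power2 b2 conv_def ..
    have "norm (conv f h x) \<le> (LINT y|lborel. norm (f (x - y) * h y))"
      unfolding conv_def by (rule integral_norm_bound)
    also have "\<dots> = (LINT y|lborel. norm (?a y) * norm (?b y))"
      by (intro Bochner_Integration.integral_cong refl) (simp add: abs_mult flip: mult.assoc)
    also have "\<dots> \<le> l2norm ?a * l2norm ?b" by (rule l2_Cauchy_Schwarz_norm[OF l2a l2b])
    finally have "(norm (conv f h x))\<^sup>2 \<le> (l2norm ?a * l2norm ?b)\<^sup>2" by (intro power_mono) auto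
    then show ?case by (simp add: power_mult_distrib na nb)
  qed
  have "integrable lborel (\<lambda>x. (norm (conv f h x))\<^sup>2)"
  proof (rule Bochner_Integration.integrable_bound)
    show "integrable lborel (\<lambda>x. I * conv (\<lambda>x. \<bar>f x\<bar>) (\<lambda>y. (h y)\<^sup>2) x)"
      by (intro integrable_mult_right integrable_conv fa h2)
    show "AE x in lborel. norm ((norm (conv f h x))\<^sup>2) \<le> norm (I * conv (\<lambda>x. \<bar>f x\<bar>) (\<lambda>y. (h y)\<^sup>2) x)"
      using le by eventually_elim (auto intro: order_trans[OF _ abs_ge_self])
  qed measurable
  then show "l2 (conv f h)" unfolding l2_def by simp
qed

lemma fourier_conv:
  fixes f h :: "'a::euclidean_space \<Rightarrow> real"
  assumes f: "integrable lborel f" and h: "integrable lborel h"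
  shows "fourier (conv f h) k = fourier f k * fourier h k"
proof -
  have "(\<lambda>x. complex_of_real (conv f h x)) = conv (\<lambda>x. complex_of_real (f x)) (\<lambda>x. complex_of_real (h x))"
    unfolding conv_def by (simp flip: of_real_mult)
  then show ?thesis unfolding fourier_eq_ft using ft_conv[OF integrable_of_real[OF f] integrable_of_real[OF h], of k] by simp
qed

text \<open>The bound 2 fits differences of two multipliers of modulus at most 1, which occur for
  translations and for mollifications.\<close>

lemma l2norm_multiplier_tendsto_0:
  fixes F :: "'a::euclidean_space \<Rightarrow> complex"
  assumes F: "l2 F" and [measurable]: "\<And>m. M m \<in> borel_measurable borel"
    and b: "\<And>m k. norm (M m k) \<le> 2" and lim: "\<And>k. (\<lambda>m. M m k) \<longlonglongrightarrow> 0"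
  shows "(\<lambda>m. l2norm (\<lambda>k. M m k * F k)) \<longlonglongrightarrow> 0"
proof -
  have [measurable]: "F \<in> borel_measurable borel" using l2D[OF F] by simp
  have "(\<lambda>m. LINT k|lborel. (norm (M m k * F k))\<^sup>2) \<longlonglongrightarrow> (LINT k|(lborel :: 'a measure). 0)"
  proof (rule integral_dominated_convergence[where w="\<lambda>k. 4 * (norm (F k))\<^sup>2"])
    show "AE k in lborel. (\<lambda>m. (norm (M m k * F k))\<^sup>2) \<longlonglongrightarrow> 0"
    proof (intro always_eventually allI)
      fix k
      have "(\<lambda>m. (norm (M m k * F k))\<^sup>2) \<longlonglongrightarrow> (norm (0 * F k))\<^sup>2"
        by (intro tendsto_intros lim)
      then show "(\<lambda>m. (norm (M m k * F k))\<^sup>2) \<longlonglongrightarrow> 0" by simp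
    qed
    show "AE k in lborel. norm ((norm (M m k * F k))\<^sup>2) \<le> 4 * (norm (F k))\<^sup>2" for m
    proof (intro always_eventually allI)
      fix k
      have "(norm (M m k))\<^sup>2 \<le> 2\<^sup>2" by (intro power_mono b) auto
      then have "(norm (M m k))\<^sup>2 * (norm (F k))\<^sup>2 \<le> 4 * (norm (F k))\<^sup>2" by (intro mult_right_mono) auto
      then show "norm ((norm (M m k * F k))\<^sup>2) \<le> 4 * (norm (F k))\<^sup>2" by (simp add: norm_mult power_mult_distrib)
    qed
  qed (use l2D(3)[OF F] in auto)
  then show ?thesis unfolding l2norm_def using tendsto_real_sqrt by fastforce
qed

lemma Hs_multiplier:
  assumes u: "Hs s u" and v: "L12 v" and eq: "\<And>k. fourier v k = M k * fourier u k" and b: "\<And>k. norm (M k) \<le> B"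
  shows "Hs s v"
  unfolding Hs_def
proof
  show "l2 (hat s v)"
  proof (rule l2_bound)
    show "l2 (\<lambda>k. complex_of_real B * hat s u k)" using u by (intro l2_cmult) (simp add: Hs_def)
    show "hat s v \<in> borel_measurable borel" by (rule hat_measurable[OF v])
    have "norm (hat s v k) \<le> norm (complex_of_real B * hat s u k)" for k
    proof -
      have "hat s v k = M k * hat s u k" by (simp add: hat_def eq)
      then have "norm (hat s v k) = norm (M k) * norm (hat s u k)" by (simp add: norm_mult)
      also have "\<dots> \<le> \<bar>B\<bar> * norm (hat s u k)" using b[of k] by (intro mult_right_mono) auto
      finally show ?thesis by (simp add: norm_mult)
    qed
    then show "AE k in lborel. norm (hat s v k) \<le> norm (complex_of_real B * hat s u k)" by simp
  qed
qed fact

lemma Hs_translate: "Hs s u \<Longrightarrow> Hs s (\<lambda>x. u (x - a))"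
  by (rule Hs_multiplier[where M="\<lambda>k. cis (- (k \<bullet> a))" and B=1]) 
     (auto simp: fourier_translate Hs_L12 L12_translate)

lemma enorm_translate_tendsto_0:
  fixes u :: "'a::euclidean_space \<Rightarrow> real"
  assumes u: "Hs s u" and a: "a \<longlonglongrightarrow> b"
  shows "(\<lambda>m. enorm s (\<lambda>x. u (x - a m) - u (x - b))) \<longlonglongrightarrow> 0"
proof -
  have L: "L12 u" using Hs_L12[OF u] .
  have eq: "hat s (\<lambda>x. u (x - a m) - u (x - b)) = (\<lambda>k. (cis (- (k \<bullet> a m)) - cis (- (k \<bullet> b))) * hat s u k)" for m
    by (simp add: hat_linear L12_translate L) (simp add: hat_def fun_eq_iff fourier_translate algebra_simps)
  have "(\<lambda>m. l2norm (\<lambda>k. (cis (- (k \<bullet> a m)) - cis (- (k \<bullet> b))) * hat s u k)) \<longlonglongrightarrow> 0"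
  proof (rule l2norm_multiplier_tendsto_0)
    show "l2 (hat s u)" using u by (simp add: Hs_def)
    show "norm (cis (- (k \<bullet> a m)) - cis (- (k \<bullet> b))) \<le> 2" for m k
      using norm_triangle_ineq4[of "cis (- (k \<bullet> a m))" "cis (- (k \<bullet> b))"] by simp
    fix k :: 'a
    have "(\<lambda>m. cis (- (k \<bullet> a m))) \<longlonglongrightarrow> cis (- (k \<bullet> b))"
      by (intro tendsto_cis tendsto_minus tendsto_inner tendsto_const a)
    then show "(\<lambda>m. cis (- (k \<bullet> a m)) - cis (- (k \<bullet> b))) \<longlonglongrightarrow> 0" by (rule LIM_zero)
  qed measurable
  then show ?thesis unfolding enorm_def eq by (rule tendsto_divide_zero)
qed

text \<open>Normalized indicators suffice: what matters is the shrinking support, the total mass 1,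
  and membership in L1 and L2.\<close>

definition mollifier :: "nat \<Rightarrow> 'a::euclidean_space \<Rightarrow> real" where
  "mollifier m x = indicator (ball 0 (1 / real (Suc m))) x / measure lborel (ball (0::'a) (1 / real (Suc m)))"

lemma mollifier:
  shows mollifier_nonneg: "0 \<le> mollifier m x"
    and mollifier_eq_0: "1 / real (Suc m) \<le> norm x \<Longrightarrow> mollifier m x = 0"
    and L12_mollifier: "L12 (mollifier m :: 'a::euclidean_space \<Rightarrow> real)"
    and integral_mollifier: "(LINT x|lborel. mollifier m (x::'a)) = 1"
proof -
  show "0 \<le> mollifier m x" by (simp add: mollifier_def)
  show "1 / real (Suc m) \<le> norm x \<Longrightarrow> mollifier m x = 0" by (simp add: mollifier_def)
  have p: "measure lborel (ball (0::'a) (1 / real (Suc m))) > 0"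
    using content_ball_pos[of "1 / real (Suc m)" "0::'a"] by simp
  have fin: "emeasure lborel (ball (0::'a) (1 / real (Suc m))) < \<infinity>"
    by (intro emeasure_bounded_finite) auto
  then have i: "integrable lborel (\<lambda>x::'a. mollifier m x)"
    unfolding mollifier_def by (intro integrable_divide integrable_real_indicator) auto
  have "\<bar>mollifier m x\<bar> \<le> 1 / measure lborel (ball (0::'a) (1 / real (Suc m)))" for x :: 'a
    unfolding mollifier_def by (auto simp: indicator_def)
  then show "L12 (mollifier m :: 'a \<Rightarrow> real)"
    unfolding L12_def using i by (auto intro!: bounded_integrable_l2)
  show "(LINT x|lborel. mollifier m (x::'a)) = 1"
    unfolding mollifier_def[abs_def] using p by simp
qed

lemma cis_minus_1_le: "norm (cis t - 1) \<le> \<bar>t\<bar>"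
proof -
  have "norm (cis t - 1)^2 = (2 * sin (t/2))^2"
  proof -
    have "norm (cis t - 1)^2 = (cos t - 1)^2 + (sin t)^2" by (simp add: cmod_power2)
    also have "\<dots> = 2 - 2 * cos t" using sin_cos_squared_add[of t] by (simp add: power2_diff)
    also have "cos t = 1 - 2 * (sin (t/2))^2" using cos_double_sin[of "t/2"] by simp
    finally show ?thesis by (simp add: power_mult_distrib)
  qed
  then have "norm (cis t - 1) = \<bar>2 * sin (t/2)\<bar>" by (metis abs_norm_cancel power2_eq_iff_nonneg abs_ge_zero power2_abs norm_ge_zero)
  also have "\<dots> \<le> \<bar>t\<bar>" using abs_sin_x_le_abs_x[of "t/2"] by simp
  finally show ?thesis .
qed

lemma tendsto_fourier_mollifier: "(\<lambda>m. fourier (mollifier m) k) \<longlonglongrightarrow> 1"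
proof (rule LIM_zero_cancel, rule Lim_null_comparison)
  show "(\<lambda>m. norm k * inverse (real (Suc m))) \<longlonglongrightarrow> 0"
    using tendsto_mult_left[OF LIMSEQ_inverse_real_of_nat, of "norm k"] by simp
  have "norm (fourier (mollifier m) k - 1) \<le> norm k * inverse (real (Suc m))" for m
  proof -
    note L = L12_mollifier[of m, where 'a='a]
    have i: "integrable lborel (\<lambda>x::'a. complex_of_real (mollifier m x))" using L12D[OF L] by simp
    have m[measurable]: "(mollifier m :: 'a \<Rightarrow> real) \<in> borel_measurable borel" using L12D[OF L] by simp
    have "fourier (mollifier m) k - 1 = (LINT x|lborel. complex_of_real (mollifier m x) * cis (- (k \<bullet> x))) - (LINT x|lborel. complex_of_real (mollifier m (x::'a)))"
      unfolding fourier_eq_ft ft_def using integral_mollifier[of m, where 'a='a] by simp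
    also have "\<dots> = (LINT x|lborel. complex_of_real (mollifier m x) * (cis (- (k \<bullet> x)) - 1))"
      using i integrable_ft(1)[OF i] by (simp add: right_diff_distrib)
    also have "norm \<dots> \<le> (LINT x|lborel. norm (complex_of_real (mollifier m x) * (cis (- (k \<bullet> x)) - 1)))"
      by (rule integral_norm_bound)
    also have "\<dots> \<le> (LINT x|lborel. norm k * inverse (real (Suc m)) * mollifier m (x::'a))"
    proof (rule integral_mono')
      show "integrable lborel (\<lambda>x::'a. norm k * inverse (real (Suc m)) * mollifier m x)" using L12D[OF L] by simp
      fix x :: 'a
      show "norm (complex_of_real (mollifier m x) * (cis (- (k \<bullet> x)) - 1)) \<le> norm k * inverse (real (Suc m)) * mollifier m x"
      proof (cases "1 / real (Suc m) \<le> norm x")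
        case True
        then show ?thesis by (simp add: mollifier_eq_0 del: of_nat_Suc)
      next
        case False
        have "norm (cis (- (k \<bullet> x)) - 1) \<le> \<bar>k \<bullet> x\<bar>" using cis_minus_1_le[of "- (k \<bullet> x)"] by simp
        also have "\<dots> \<le> norm k * norm x" by (rule Cauchy_Schwarz_ineq2)
        also have "\<dots> \<le> norm k * inverse (real (Suc m))" using False by (intro mult_left_mono) (auto simp: divide_inverse)
        finally have "norm (cis (- (k \<bullet> x)) - 1) \<le> norm k * inverse (real (Suc m))" .
        from mult_left_mono[OF this mollifier_nonneg[of m x]] show ?thesis
          by (simp add: norm_mult abs_of_nonneg[OF mollifier_nonneg] mult.commute)
      qed
    qed (auto simp: mollifier_nonneg)
    also have "\<dots> = norm k * inverse (real (Suc m))" using integral_mollifier[of m, where 'a='a] by simp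
    finally show ?thesis .
  qed
  then show "\<forall>\<^sub>F m in sequentially. norm (fourier (mollifier m) k - 1) \<le> norm k * inverse (real (Suc m))" by simp
qed

lemma norm_fourier_mollifier_le: "norm (fourier (mollifier m) (k :: 'a::euclidean_space)) \<le> 1"
proof -
  have "norm (fourier (mollifier m) k) \<le> (LINT x|lborel. \<bar>mollifier m (x::'a)\<bar>)" by (rule norm_fourier_le)
  then show ?thesis using integral_mollifier[of m, where 'a='a] by (simp add: abs_of_nonneg[OF mollifier_nonneg])
qed

lemma Hs_conv_mollifier:
  assumes "Hs s u"
  shows "Hs s (conv (mollifier m) u)"
  using Hs_L12[OF assms]
  by (intro Hs_multiplier[OF assms, where M="fourier (mollifier m)" and B=1])
     (auto intro!: L12_conv L12D L12_mollifier fourier_conv norm_fourier_mollifier_le)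

lemma enorm_mollify_tendsto_0:
  fixes u :: "'a::euclidean_space \<Rightarrow> real"
  assumes u: "Hs s u"
  shows "(\<lambda>m. enorm s (\<lambda>x. u x - conv (mollifier m) u x)) \<longlonglongrightarrow> 0"
proof -
  have L: "L12 u" using Hs_L12[OF u] .
  have Lm: "L12 (mollifier m :: 'a \<Rightarrow> real)" for m by (rule L12_mollifier)
  have eq: "hat s (\<lambda>x. u x - conv (mollifier m) u x) = (\<lambda>k. (1 - fourier (mollifier m) k) * hat s u k)" for m
    by (subst hat_linear(1)) (auto simp: hat_def fun_eq_iff fourier_conv[OF L12D(1)[OF Lm] L12D(1)[OF L]] L L12_conv[OF L12D(1)[OF Lm] L] algebra_simps)
  have [measurable]: "fourier (mollifier m :: 'a \<Rightarrow> real) \<in> borel_measurable borel" for m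
    using L12D(1)[OF Lm] by measurable
  have "(\<lambda>m. l2norm (\<lambda>k. (1 - fourier (mollifier m) k) * hat s u k)) \<longlonglongrightarrow> 0"
  proof (rule l2norm_multiplier_tendsto_0)
    show "l2 (hat s u)" using u by (simp add: Hs_def)
    show "norm (1 - fourier (mollifier m) k) \<le> 2" for m and k :: 'a
      using norm_triangle_ineq4[of 1 "fourier (mollifier m) k"] norm_fourier_mollifier_le[of m k] by simp
    show "(\<lambda>m. 1 - fourier (mollifier m) k) \<longlonglongrightarrow> 0" for k :: 'a
      using tendsto_diff[OF tendsto_const[of 1] tendsto_fourier_mollifier[of k]] by simp
  qed measurable
  then show ?thesis unfolding enorm_def eq by (rule tendsto_divide_zero)
qed

subsection \<open>The fundamental solution and the Markov property\<close>

locale fundamental_solution =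
  fixes s :: real and \<Gamma> :: "'a::euclidean_space \<Rightarrow> real"
  assumes s: "0 < s" "s < 1"
    and fundamental: "decaying_fundamental_solution s \<Gamma>"
    and radial: "radial \<Gamma>"
    and pos: "\<And>x. x \<noteq> 0 \<Longrightarrow> 0 < \<Gamma> x"
    and has_integral: "has_bochner_integral lborel \<Gamma> 1"
    and decay: "two_sided_decay s \<Gamma>"
begin

lemma integrable: "integrable lborel \<Gamma>"
  and integral: "(LINT x|lborel. \<Gamma> x) = 1"
  using has_integral by (auto simp: has_bochner_integral_iff)

lemma measurable [measurable]: "\<Gamma> \<in> borel_measurable borel"
  using borel_measurable_integrable[OF integrable] by simp

lemma even: "\<Gamma> (- x) = \<Gamma> x"
  using radial[unfolded radial_def, rule_format, of "- x" x] by simp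

lemma commute: "\<Gamma> (x - y) = \<Gamma> (y - x)"
  using even[of "x - y"] by simp

lemma nonneg_AE: "AE y in lborel. 0 \<le> \<Gamma> (x - y)"
proof -
  have "AE y in lborel. y \<noteq> x" by (rule AE_lborel_singleton)
  then show ?thesis by eventually_elim (use pos in \<open>auto intro: less_imp_le\<close>)
qed

lemma nonneg_AE': "AE y in lborel. 0 \<le> \<Gamma> (y - x)"
  using nonneg_AE[of x] by (simp add: commute[of x])

lemma conv_nonneg: "(\<And>y. 0 \<le> h y) \<Longrightarrow> 0 \<le> conv \<Gamma> h x"
  unfolding conv_def by (intro integral_nonneg_AE) (use nonneg_AE[of x] in \<open>auto elim: eventually_mono\<close>)

text \<open>Tested against translated bumps, the equation says that (1 + |k|^2s) times the conjugate
  transform of \<Gamma> has the same pairings as the constant 1. Uniqueness gives equality almost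
  everywhere, and continuity of both sides gives it at every point, which the rescaling in
  \<open>fourier_resolvent\<close> relies on.\<close>

lemma fourier_fundamental: "fourier \<Gamma> k = of_real (1 / (1 + norm k powr (2 * s)))"
proof (rule continuous_AE_eq[where f="fourier \<Gamma>" and g="\<lambda>k. of_real (1 / (1 + norm k powr (2 * s)))"])
  have tpos: "1 + norm k powr (2 * s) > 0" for k :: 'a by (rule add_pos_nonneg) auto
  show "continuous_on UNIV (fourier \<Gamma>)" by (rule continuous_fourier[OF integrable])
  show "continuous_on UNIV (\<lambda>k::'a. complex_of_real (1 / (1 + norm k powr (2 * s))))"
    using s tpos by (intro continuous_intros continuous_on_powr') (auto simp: less_imp_neq[symmetric] intro: less_imp_neq[symmetric])
  have fm[measurable]: "fourier \<Gamma> \<in> borel_measurable borel" using integrable by measurable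
  have cm: "continuous_on UNIV (\<lambda>k. cnj (fourier \<Gamma> k))"
    by (intro continuous_intros continuous_fourier integrable)
  have [measurable]: "(\<lambda>k. cnj (fourier \<Gamma> k)) \<in> borel_measurable borel"
    by (rule borel_measurable_continuous_onI[OF cm])
  let ?t = "\<lambda>k::'a. complex_of_real (1 + norm k powr (2 * s))"
  let ?p = "\<lambda>k. ?t k * cnj (fourier \<Gamma> k)"
  let ?G = "\<lambda>k. ?p k - 1"
  have tb: "norm (?t k) \<le> 2 * (1 + norm k) ^ 2" for k
  proof -
    have "norm (?t k) = 1 + norm k powr (2 * s)" using tpos[of k] by (simp del: of_real_add)
    also have "\<dots> \<le> (1 + norm k)^2 + (1 + norm k)^2"
      using s by (intro add_mono norm_powr_le) (auto simp: power2_eq_square algebra_simps)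
    finally show ?thesis by simp
  qed
  have pb: "norm (?p k) \<le> (2 * (LINT x|lborel. \<bar>\<Gamma> x\<bar>)) * (1 + norm k) ^ 2" for k
  proof -
    have "norm (?p k) = norm (?t k) * norm (fourier \<Gamma> k)" by (simp add: norm_mult)
    also have "\<dots> \<le> 2 * (1 + norm k) ^ 2 * (LINT x|lborel. \<bar>\<Gamma> x\<bar>)"
      by (intro mult_mono tb norm_fourier_le) auto
    finally show ?thesis by (simp add: mult_ac)
  qed
  have pm: "?p \<in> borel_measurable borel" by measurable
  have f1: "integrable lborel (\<lambda>k. ?p k * fourier \<phi> k)" "l2 (\<lambda>k. ?p k * fourier \<phi> k)"
    "integrable lborel (\<lambda>k. 1 * fourier \<phi> k)" "l2 (\<lambda>k. 1 * fourier \<phi> k)"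
    if "test_function \<phi>" for \<phi>
    using fourier_weighted[OF that pm pb] fourier_weighted[OF that, of "\<lambda>_. 1" 1 0] by auto
  have "AE k in lborel. ?G k = 0"
  proof (rule fourier_test_uniqueness)
    fix r :: real assume "r > 0"
    then have t: "test_function (bump (0::'a) r)" by (rule test_function_bump)
    show "integrable lborel (\<lambda>k. ?G k * fourier (bump 0 r) k)" "l2 (\<lambda>k. ?G k * fourier (bump 0 r) k)"
      unfolding left_diff_distrib using f1[OF t] l2_diff by auto
  next
    fix a :: 'a and r :: real assume r: "r > 0"
    have t: "test_function (bump a r)" by (rule test_function_bump[OF r])
    let ?g = "\<lambda>k. of_real (norm k powr (2 * s)) * fourier (bump a r) k"
    have gi: "integrable lborel ?g"
      by (rule fourier_weighted(1)[OF t, where D=1 and j=2]) (use s in \<open>auto intro!: norm_powr_le\<close>)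
    have fi: "integrable lborel (fourier (bump a r))" using f1(3)[OF t] by simp
    have cx: "complex_of_real (frac_laplacian s (bump a r) x + bump a r x) = ft (\<lambda>k. ?g k + fourier (bump a r) k) (- x) / (2 * pi) ^ DIM('a)" for x
      unfolding of_real_add frac_laplacian_eq_ft fourier_inversion_bump[OF r] ft_add[OF gi fi]
      by (simp add: add_divide_distrib)
    have "complex_of_real (LINT x|lborel. \<Gamma> x * (frac_laplacian s (bump a r) x + bump a r x)) = (LINT x|lborel. complex_of_real (\<Gamma> x) * complex_of_real (frac_laplacian s (bump a r) x + bump a r x))"
      by (simp only: integral_complex_of_real[symmetric] of_real_mult)
    also have "\<dots> = (LINT x|lborel. complex_of_real (\<Gamma> x) * ft (\<lambda>k. ?g k + fourier (bump a r) k) (- x)) / (2 * pi) ^ DIM('a)"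
      unfolding cx by simp
    also have "(LINT x|lborel. complex_of_real (\<Gamma> x) * ft (\<lambda>k. ?g k + fourier (bump a r) k) (- x)) = (LINT k|lborel. cnj (fourier \<Gamma> k) * (?g k + fourier (bump a r) k))"
      by (rule integral_times_inverse_ft[OF integrable]) (use gi fi in auto)
    also have "\<dots> = (LINT k|lborel. ?p k * fourier (bump a r) k)"
      by (simp add: algebra_simps)
    also have "(LINT x|lborel. \<Gamma> x * (frac_laplacian s (bump a r) x + bump a r x)) = bump a r 0"
      using fundamental t unfolding decaying_fundamental_solution_def by blast
    finally have "(LINT k|lborel. ?p k * fourier (bump a r) k) = (2 * pi) ^ DIM('a) * bump a r 0" by simp
    also have "\<dots> = (LINT k|lborel. 1 * fourier (bump a r) k)" using fourier_inversion_at_0[OF t] by simp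
    finally show "(LINT k|lborel. ?G k * fourier (bump a r) k) = 0"
      unfolding left_diff_distrib using f1[OF t] by simp
  qed
  then show "AE k in lborel. fourier \<Gamma> k = complex_of_real (1 / (1 + norm k powr (2 * s)))"
  proof eventually_elim
    case (elim k)
    then have "cnj (?p k) = 1" by simp
    then have "complex_of_real (1 + norm k powr (2 * s)) * fourier \<Gamma> k = 1" by simp
    moreover have "complex_of_real (1 + norm k powr (2 * s)) \<noteq> 0" using tpos[of k] by (simp only: of_real_eq_0_iff)
    ultimately show ?case by (simp add: field_simps del: of_real_add)
  qed
qed

section \<open>Convolution with the fundamental solution and the Yosida regularization\<close>

lemma hat_conv:
  assumes h: "L12 h"
  shows "hat s (conv \<Gamma> h) k = fourier h k / of_real (sqrt (1 + norm k powr (2 * s)))"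
proof -
  have "1 + norm k powr (2 * s) > 0" by (rule add_pos_nonneg) auto
  then have "sqrt (1 + norm k powr (2 * s)) / (1 + norm k powr (2 * s)) = 1 / sqrt (1 + norm k powr (2 * s))"
    by (simp add: field_simps)
  then have eq: "complex_of_real (sqrt (1 + norm k powr (2 * s))) * complex_of_real (1 / (1 + norm k powr (2 * s))) = complex_of_real (1 / sqrt (1 + norm k powr (2 * s)))"
    unfolding of_real_mult[symmetric] by simp
  have "hat s (conv \<Gamma> h) k = complex_of_real (sqrt (1 + norm k powr (2 * s))) * complex_of_real (1 / (1 + norm k powr (2 * s))) * fourier h k"
    unfolding hat_def fourier_conv[OF integrable L12D(1)[OF h]] fourier_fundamental by (simp only: mult.assoc)
  then show ?thesis unfolding eq by simp
qed

lemma Hs_conv: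
  assumes h: "L12 h"
  shows "Hs s (conv \<Gamma> h)"
proof -
  have L: "L12 (conv \<Gamma> h)" by (rule L12_conv[OF integrable h])
  have "l2 (hat s (conv \<Gamma> h))"
  proof (rule l2_bound[OF l2_fourier[OF h] hat_measurable[OF L]])
    have "norm (hat s (conv \<Gamma> h) k) \<le> norm (fourier h k)" for k
    proof -
      have "1 \<le> sqrt (1 + norm k powr (2 * s))" by simp
      then have "norm (fourier h k) / sqrt (1 + norm k powr (2 * s)) \<le> norm (fourier h k) / 1"
        by (intro divide_left_mono) (auto intro!: add_pos_nonneg)
      moreover have "norm (hat s (conv \<Gamma> h) k) = norm (fourier h k) / sqrt (1 + norm k powr (2 * s))"
        unfolding hat_conv[OF h] norm_divide norm_of_real by (simp add: add_nonneg_nonneg)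
      ultimately show ?thesis by simp
    qed
    then show "AE k in lborel. norm (hat s (conv \<Gamma> h) k) \<le> norm (fourier h k)" by simp
  qed
  then show ?thesis using L by (simp add: Hs_def)
qed

text \<open>\<open>conv \<Gamma> h\<close> is the finite energy solution with right side h: the
  weight of the form cancels the transform of \<Gamma>. A nonnegative h makes it a supersolution,
  and an h vanishing on U makes it a solution in U.\<close>

lemma eform_conv:
  assumes h: "L12 h" and v: "Hs s v"
  shows "eform s (conv \<Gamma> h) v = (LINT x|lborel. h x * v x)"
proof -
  have "hat s (conv \<Gamma> h) k * cnj (hat s v k) = fourier h k * cnj (fourier v k)" for k
  proof -
    have "1 + norm k powr (2 * s) > 0" by (rule add_pos_nonneg) auto
    then have "sqrt (1 + norm k powr (2 * s)) > 0" by (rule real_sqrt_gt_zero)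
    then have "complex_of_real (sqrt (1 + norm k powr (2 * s))) \<noteq> 0" by (simp only: of_real_eq_0_iff)
    then show ?thesis unfolding hat_conv[OF h] unfolding hat_def by simp
  qed
  then show ?thesis
    unfolding eform_def using Parseval_real[OF h Hs_L12[OF v]] by simp
qed

text \<open>The kernel of the Yosida regularization \<open>\<lambda> (\<lambda> + (-\<Delta>)\<^sup>s)\<^sup>-\<^sup>1\<close>, \<open>\<lambda> = m + 1\<close>, is a rescaling
  of \<open>\<Gamma>\<close>, hence positive. The forms \<open>\<lambda> \<langle>u - kernel * u, u\<rangle>\<close> increase to the form of \<open>(-\<Delta>)\<^sup>s\<close>,
  which therefore inherits the Markov property.\<close>

definition resolvent :: "nat \<Rightarrow> 'a \<Rightarrow> real" where
  "resolvent m x = (real (Suc m) powr (1 / (2 * s))) ^ DIM('a) * \<Gamma> ((real (Suc m) powr (1 / (2 * s))) *\<^sub>R x)"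

lemma integrable_resolvent: "integrable lborel (resolvent m)"
proof -
  have "integrable lborel (\<lambda>x. \<Gamma> (0 + (real (Suc m) powr (1 / (2 * s))) *\<^sub>R x))"
    by (rule integrable_lborel_affine[OF integrable]) simp
  then show ?thesis unfolding resolvent_def[abs_def] by simp
qed

lemma resolvent_nonneg: "x \<noteq> 0 \<Longrightarrow> 0 \<le> resolvent m x"
  unfolding resolvent_def using pos[of "(real (Suc m) powr (1 / (2 * s))) *\<^sub>R x"] by simp

text \<open>The symbol of \<lambda> (1 - R) with R convolution by the kernel and \<lambda> = m + 1.
  It is bounded by \<lambda>, so the regularized form is finite on all of L2.\<close>

definition yosida :: "nat \<Rightarrow> 'a \<Rightarrow> real" where
  "yosida m k = real (Suc m) * norm k powr (2 * s) / (real (Suc m) + norm k powr (2 * s))"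

text \<open>The dilation factor \<lambda>^(1 / (2s)), \<lambda> = m + 1, divides |k|^2s by
  \<lambda>, so the kernel has transform \<lambda> / (\<lambda> + |k|^2s).\<close>

lemma fourier_resolvent: "of_real (real (Suc m)) * (1 - fourier (resolvent m) k) = complex_of_real (yosida m k)"
proof -
  let ?c = "real (Suc m) powr (1 / (2 * s))" and ?t = "norm k powr (2 * s)"
  have c: "?c > 0" by simp
  have "fourier (resolvent m) k = of_real (?c ^ DIM('a)) * ft (\<lambda>x. complex_of_real (\<Gamma> (?c *\<^sub>R x))) k"
    unfolding resolvent_def fourier_cmult by (simp add: fourier_eq_ft)
  also have "ft (\<lambda>x. complex_of_real (\<Gamma> (?c *\<^sub>R x))) k = fourier \<Gamma> (k /\<^sub>R ?c) /\<^sub>R \<bar>?c\<bar> ^ DIM('a)"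
    unfolding fourier_eq_ft using ft_scale[of ?c "\<lambda>x. complex_of_real (\<Gamma> x)" k] c by simp
  also have "complex_of_real (?c ^ DIM('a)) * (fourier \<Gamma> (k /\<^sub>R ?c) /\<^sub>R \<bar>?c\<bar> ^ DIM('a)) = fourier \<Gamma> (k /\<^sub>R ?c)"
  proof -
    have "complex_of_real (?c ^ DIM('a)) \<noteq> 0" using c by simp
    then show ?thesis using c by (simp add: scaleR_conv_of_real of_real_inverse del: of_real_power powr_eq_0_iff)
  qed
  also have "norm (k /\<^sub>R ?c) powr (2 * s) = ?t / real (Suc m)"
  proof -
    have "norm (k /\<^sub>R ?c) powr (2 * s) = (norm k / ?c) powr (2 * s)" 
    proof -
      have "norm (k /\<^sub>R d) = norm k / d" if "d > 0" for d :: real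
        using that by (simp add: field_simps)
      from this[OF c] show ?thesis by simp
    qed
    also have "\<dots> = ?t / ?c powr (2 * s)" by (rule powr_divide)
    also have "?c powr (2 * s) = real (Suc m)" unfolding powr_powr using s by simp
    finally show ?thesis .
  qed
  then have "fourier \<Gamma> (k /\<^sub>R ?c) = complex_of_real (1 / (1 + ?t / real (Suc m)))"
    unfolding fourier_fundamental by simp
  finally have f: "fourier (resolvent m) k = complex_of_real (1 / (1 + ?t / real (Suc m)))" .
  have t: "?t \<ge> 0" by simp
  have "real (Suc m) * (1 - 1 / (1 + ?t / real (Suc m))) = yosida m k"
  proof -
    have "1 / (1 + ?t / real (Suc m)) = real (Suc m) / (real (Suc m) + ?t)"
      by (simp add: field_simps del: of_nat_Suc)
    moreover have "real (Suc m) + ?t > 0" by (rule add_pos_nonneg) auto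
    ultimately show ?thesis unfolding yosida_def by (simp add: diff_divide_eq_iff field_simps del: of_nat_Suc)
  qed
  then show ?thesis unfolding f by (metis of_real_1 of_real_diff of_real_mult)
qed

lemma yosida_bounds: "0 \<le> yosida m k" "yosida m k \<le> norm k powr (2 * s)" "yosida m k \<le> real (Suc m)"
proof -
  have t: "norm k powr (2 * s) \<ge> 0" by simp
  have p: "real (Suc m) + norm k powr (2 * s) > 0" by (rule add_pos_nonneg) auto
  show "0 \<le> yosida m k" unfolding yosida_def using p by (intro divide_nonneg_pos mult_nonneg_nonneg) auto
  show "yosida m k \<le> norm k powr (2 * s)" "yosida m k \<le> real (Suc m)"
    unfolding yosida_def using p t by (auto simp: pos_divide_le_eq algebra_simps simp del: of_nat_Suc)
qed

lemma yosida_mono: "mono (\<lambda>m. yosida m k)"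
proof (intro monoI)
  fix m n :: nat assume "m \<le> n"
  then have l: "real (Suc m) \<le> real (Suc n)" by simp
  define t where "t = norm k powr (2 * s)"
  have t: "t \<ge> 0" by (simp add: t_def)
  have "real (Suc m) + t > 0" "real (Suc n) + t > 0" using t by simp_all
  moreover have "t * t * real (Suc m) \<le> t * t * real (Suc n)" using l by (intro mult_left_mono) auto
  ultimately show "yosida m k \<le> yosida n k"
    unfolding yosida_def t_def[symmetric] by (simp add: divide_le_eq le_divide_eq frac_le_eq divide_simps del: of_nat_Suc) (simp add: algebra_simps del: of_nat_Suc)
qed

lemma yosida_tendsto: "(\<lambda>m. yosida m k) \<longlonglongrightarrow> norm k powr (2 * s)"
proof -
  define t where "t = norm k powr (2 * s)"
  have t: "t \<ge> 0" by (simp add: t_def)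
  have "yosida m k = t / (1 + t * inverse (real (Suc m)))" for m
    unfolding yosida_def t_def[symmetric] using t by (simp add: field_simps del: of_nat_Suc)
  moreover have "(\<lambda>m. t / (1 + t * inverse (real (Suc m)))) \<longlonglongrightarrow> t / (1 + t * 0)"
    by (intro tendsto_intros LIMSEQ_inverse_real_of_nat) auto
  ultimately show ?thesis by (simp add: t_def)
qed

lemma yosida_measurable [measurable]: "yosida m \<in> borel_measurable borel"
  unfolding yosida_def[abs_def] by measurable

lemma yosida_form:
  assumes u: "L12 u" and v: "L12 v"
  shows "integrable lborel (\<lambda>k. of_real (yosida m k) * (fourier u k * cnj (fourier v k)))"
    "(LINT k|lborel. of_real (yosida m k) * (fourier u k * cnj (fourier v k))) =
      of_real ((2 * pi) ^ DIM('a) * (real (Suc m) * ((LINT x|lborel. u x * v x) - (LINT x|lborel. conv (resolvent m) u x * v x))))"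
proof -
  have Lc: "L12 (conv (resolvent m) u)" by (rule L12_conv[OF integrable_resolvent u])
  have eq: "of_real (yosida m k) * (fourier u k * cnj (fourier v k)) = of_real (real (Suc m)) * (fourier u k * cnj (fourier v k) - fourier (conv (resolvent m) u) k * cnj (fourier v k))" for k
    unfolding fourier_resolvent[symmetric] fourier_conv[OF integrable_resolvent L12D(1)[OF u]] by (simp add: algebra_simps)
  have i: "integrable lborel (\<lambda>k. fourier u k * cnj (fourier v k))" "integrable lborel (\<lambda>k. fourier (conv (resolvent m) u) k * cnj (fourier v k))"
    by (rule integrable_l2_mult; use l2_fourier[OF u] l2_fourier[OF v] l2_fourier[OF Lc] in simp)+
  show "integrable lborel (\<lambda>k. of_real (yosida m k) * (fourier u k * cnj (fourier v k)))"
    unfolding eq using i by (intro integrable_mult_right Bochner_Integration.integrable_diff)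
  show "(LINT k|lborel. of_real (yosida m k) * (fourier u k * cnj (fourier v k))) =
      of_real ((2 * pi) ^ DIM('a) * (real (Suc m) * ((LINT x|lborel. u x * v x) - (LINT x|lborel. conv (resolvent m) u x * v x))))"
    unfolding eq integral_mult_right_zero Bochner_Integration.integral_diff[OF i] Parseval_real[OF u v] Parseval_real[OF Lc v]
    by (simp add: algebra_simps)
qed

text \<open>The diagonal part vanishes by disjointness, and the remaining term is minus a pairing of
  nonnegative functions because the kernel is nonnegative.\<close>

lemma yosida_form_disjoint:
  assumes u: "L12 u" and v: "L12 v" and nn: "\<And>x. 0 \<le> u x" "\<And>x. 0 \<le> v x" and disj: "\<And>x. u x * v x = 0"
  shows "Re (LINT k|lborel. of_real (yosida m k) * (fourier u k * cnj (fourier v k))) \<le> 0"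
proof -
  have "0 \<le> conv (resolvent m) u x" for x
    unfolding conv_def
  proof (rule integral_nonneg_AE)
    have "AE y in lborel. y \<noteq> x" by (rule AE_lborel_singleton)
    then show "AE y in lborel. 0 \<le> resolvent m (x - y) * u y"
      by eventually_elim (use resolvent_nonneg nn in auto)
  qed
  then have "0 \<le> (LINT x|lborel. conv (resolvent m) u x * v x)" using nn by (intro Bochner_Integration.integral_nonneg) auto
  then have "(2 * pi) ^ DIM('a) * (real (Suc m) * ((LINT x|lborel. u x * v x) - (LINT x|lborel. conv (resolvent m) u x * v x))) \<le> 0"
    unfolding disj by (intro mult_nonneg_nonpos) auto
  then show ?thesis unfolding yosida_form(2)[OF u v] Re_complex_of_real .
qed

text \<open>For the regularized forms the cross term of the positive and the negative part is
  nonpositive. Hence the regularized energy of each part is at most that of u, and monotone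
  convergence shows that each part has finite energy. The cross term then keeps its sign in the
  limit.\<close>

lemma Markov:
  fixes u :: "'a \<Rightarrow> real"
  assumes u: "Hs s u"
  shows "Hs s (\<lambda>x. max (u x) 0)" "(enorm s (\<lambda>x. max (u x) 0))\<^sup>2 \<le> eform s u (\<lambda>x. max (u x) 0)"
proof -
  have L: "L12 u" by (rule Hs_L12[OF u])
  have [measurable]: "u \<in> borel_measurable borel" using L12D[OF L] by simp
  let ?p = "\<lambda>x. max (u x) 0" and ?n = "\<lambda>x. max (- u x) 0"
  have Lp: "L12 ?p" and Ln: "L12 ?n" by (rule L12_bound[OF L]; auto)+
  have dec: "u = (\<lambda>x. ?p x - ?n x)" by (auto simp: fun_eq_iff max_def)
  have fdec: "fourier u k = fourier ?p k - fourier ?n k" for k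
    by (subst dec) (rule fourier_diff[OF Lp Ln])
  have [measurable]: "fourier ?p \<in> borel_measurable borel" "fourier ?n \<in> borel_measurable borel"
    using l2D(1)[OF l2_fourier[OF Lp]] l2D(1)[OF l2_fourier[OF Ln]] .
  have it: "integrable lborel (\<lambda>k. norm k powr (2 * s) * (norm (fourier u k))\<^sup>2)" using u Hs_iff[OF L] by simp
  have cross: "Re (LINT k|lborel. of_real (yosida m k) * (fourier ?p k * cnj (fourier ?n k))) \<le> 0" for m
    by (rule yosida_form_disjoint[OF Lp Ln]) (auto simp: max_def)
  have iq: "integrable lborel (\<lambda>k. yosida m k * (norm (fourier v k))\<^sup>2)" if v: "L12 v" for m and v :: "'a \<Rightarrow> real"
  proof (rule Bochner_Integration.integrable_bound)
    have [measurable]: "fourier v \<in> borel_measurable borel" using l2D(1)[OF l2_fourier[OF v]] .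
    show "integrable lborel (\<lambda>k. real (Suc m) * (norm (fourier v k))\<^sup>2)" using l2D(3)[OF l2_fourier[OF v]] by simp
    show "AE k in lborel. norm (yosida m k * (norm (fourier v k))\<^sup>2) \<le> norm (real (Suc m) * (norm (fourier v k))\<^sup>2)"
      using yosida_bounds[of m] by (intro always_eventually allI) (auto simp: abs_mult intro!: mult_right_mono simp del: of_nat_Suc)
    show "(\<lambda>k. yosida m k * (norm (fourier v k))\<^sup>2) \<in> borel_measurable lborel" by measurable
  qed
  let ?C = "LINT k|lborel. norm k powr (2 * s) * (norm (fourier u k))\<^sup>2"
  have sq: "(norm (a - b))\<^sup>2 = (norm a)\<^sup>2 + (norm b)\<^sup>2 - 2 * Re (a * cnj b)" for a b :: complex
    by (simp add: cmod_power2 power2_diff algebra_simps)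
  have bound: "(LINT k|lborel. yosida m k * (norm (fourier ?p k))\<^sup>2) \<le> ?C"
    "(LINT k|lborel. yosida m k * (norm (fourier ?n k))\<^sup>2) \<le> ?C" for m
  proof -
    have ic: "integrable lborel (\<lambda>k. Re (of_real (yosida m k) * (fourier ?p k * cnj (fourier ?n k))))"
      by (intro integrable_Re yosida_form Lp Ln)
    have "(LINT k|lborel. yosida m k * (norm (fourier u k))\<^sup>2) = (LINT k|lborel. yosida m k * (norm (fourier ?p k))\<^sup>2 + yosida m k * (norm (fourier ?n k))\<^sup>2 - 2 * Re (of_real (yosida m k) * (fourier ?p k * cnj (fourier ?n k))))"
      unfolding fdec sq by (intro Bochner_Integration.integral_cong refl) (simp add: algebra_simps)
    also have "\<dots> = (LINT k|lborel. yosida m k * (norm (fourier ?p k))\<^sup>2) + (LINT k|lborel. yosida m k * (norm (fourier ?n k))\<^sup>2) - 2 * (LINT k|lborel. Re (of_real (yosida m k) * (fourier ?p k * cnj (fourier ?n k))))"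
      using iq[OF Lp] iq[OF Ln] ic by (simp only: Bochner_Integration.integral_diff Bochner_Integration.integral_add Bochner_Integration.integrable_add integrable_mult_right integral_mult_right_zero)
    also have "(LINT k|lborel. Re (of_real (yosida m k) * (fourier ?p k * cnj (fourier ?n k)))) = Re (LINT k|lborel. of_real (yosida m k) * (fourier ?p k * cnj (fourier ?n k)))"
      by (rule integral_Re[OF yosida_form(1)[OF Lp Ln]])
    finally have eq: "(LINT k|lborel. yosida m k * (norm (fourier u k))\<^sup>2) = (LINT k|lborel. yosida m k * (norm (fourier ?p k))\<^sup>2) + (LINT k|lborel. yosida m k * (norm (fourier ?n k))\<^sup>2) - 2 * Re (LINT k|lborel. of_real (yosida m k) * (fourier ?p k * cnj (fourier ?n k)))" .
    have "(LINT k|lborel. yosida m k * (norm (fourier u k))\<^sup>2) \<le> ?C"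
      using yosida_bounds(2)[of m] by (intro integral_mono iq L it mult_right_mono) auto
    moreover have "0 \<le> (LINT k|lborel. yosida m k * (norm (fourier ?p k))\<^sup>2)" "0 \<le> (LINT k|lborel. yosida m k * (norm (fourier ?n k))\<^sup>2)"
      using yosida_bounds(1)[of m] by (auto intro!: Bochner_Integration.integral_nonneg mult_nonneg_nonneg)
    ultimately show "(LINT k|lborel. yosida m k * (norm (fourier ?p k))\<^sup>2) \<le> ?C"
      "(LINT k|lborel. yosida m k * (norm (fourier ?n k))\<^sup>2) \<le> ?C"
      using eq cross[of m] by linarith+
  qed
  \<comment> \<open>Uniformly bounded, increasing regularized energies force the limiting symbol to
    be integrable against the squared transform.\<close>
  have lift: "Hs s v" if v: "L12 v" and b: "\<And>m. (LINT k|lborel. yosida m k * (norm (fourier v k))\<^sup>2) \<le> ?C" for v :: "'a \<Rightarrow> real"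
  proof -
    have [measurable]: "fourier v \<in> borel_measurable borel" using l2D(1)[OF l2_fourier[OF v]] .
    have m1: "mono (\<lambda>m. yosida m k * (norm (fourier v k))\<^sup>2)" for k
      using yosida_mono[of k] by (auto simp: mono_def intro!: mult_right_mono)
    have "incseq (\<lambda>m. LINT k|lborel. yosida m k * (norm (fourier v k))\<^sup>2)"
      using m1 by (intro monoI integral_mono iq v) (auto simp: mono_def)
    then obtain l where l: "(\<lambda>m. LINT k|lborel. yosida m k * (norm (fourier v k))\<^sup>2) \<longlonglongrightarrow> l"
      using incseq_convergent[of _ ?C] b by blast
    have "integrable lborel (\<lambda>k. norm k powr (2 * s) * (norm (fourier v k))\<^sup>2)"
    proof (rule integrable_monotone_convergence[OF iq[OF v] _ _ l])
      show "AE k in lborel. mono (\<lambda>m. yosida m k * (norm (fourier v k))\<^sup>2)" using m1 by simp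
      show "AE k in lborel. (\<lambda>m. yosida m k * (norm (fourier v k))\<^sup>2) \<longlonglongrightarrow> norm k powr (2 * s) * (norm (fourier v k))\<^sup>2"
        by (intro always_eventually allI tendsto_mult_right yosida_tendsto)
    qed measurable
    then show ?thesis using Hs_iff[OF v] by simp
  qed
  show Hp: "Hs s ?p" by (rule lift[OF Lp bound(1)])
  have Hn: "Hs s ?n" by (rule lift[OF Ln bound(2)])
  have [measurable]: "(\<lambda>k. cnj (fourier ?n k)) \<in> borel_measurable borel"
    using l2D(1)[of "\<lambda>k. cnj (fourier ?n k)"] l2_fourier[OF Ln] by simp
  \<comment> \<open>The cross term has no sign pointwise, so its limit is taken by dominated
    convergence; the majorant is integrable only because both parts are already known to lie in
    \<open>Hs\<close>.\<close>
  have lim: "(\<lambda>m. LINT k|lborel. of_real (yosida m k) * (fourier ?p k * cnj (fourier ?n k))) \<longlonglongrightarrow> (LINT k|lborel. of_real (norm k powr (2 * s)) * (fourier ?p k * cnj (fourier ?n k)))"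
  proof (rule integral_dominated_convergence[where w="\<lambda>k. norm k powr (2 * s) * (norm (fourier ?p k))\<^sup>2 + norm k powr (2 * s) * (norm (fourier ?n k))\<^sup>2"])
    show "integrable lborel (\<lambda>k. norm k powr (2 * s) * (norm (fourier ?p k))\<^sup>2 + norm k powr (2 * s) * (norm (fourier ?n k))\<^sup>2)"
      using Hp Hn Hs_iff[OF Lp] Hs_iff[OF Ln] by simp
    show "AE k in lborel. (\<lambda>m. complex_of_real (yosida m k) * (fourier ?p k * cnj (fourier ?n k))) \<longlonglongrightarrow> complex_of_real (norm k powr (2 * s)) * (fourier ?p k * cnj (fourier ?n k))"
      by (intro always_eventually allI tendsto_mult_right tendsto_of_real yosida_tendsto)
    show "AE k in lborel. norm (complex_of_real (yosida m k) * (fourier ?p k * cnj (fourier ?n k))) \<le> norm k powr (2 * s) * (norm (fourier ?p k))\<^sup>2 + norm k powr (2 * s) * (norm (fourier ?n k))\<^sup>2" for m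
    proof (intro always_eventually allI)
      fix k
      have "norm (fourier ?p k) * norm (fourier ?n k) \<le> (norm (fourier ?p k))\<^sup>2 + (norm (fourier ?n k))\<^sup>2"
        using sum_squares_bound[of "norm (fourier ?p k)" "norm (fourier ?n k)"] mult_nonneg_nonneg[OF norm_ge_zero[of "fourier ?p k"] norm_ge_zero[of "fourier ?n k"]]
        by linarith
      then have "yosida m k * (norm (fourier ?p k) * norm (fourier ?n k)) \<le> norm k powr (2 * s) * ((norm (fourier ?p k))\<^sup>2 + (norm (fourier ?n k))\<^sup>2)"
        using yosida_bounds[of m k] by (intro mult_mono) auto
      then show "norm (complex_of_real (yosida m k) * (fourier ?p k * cnj (fourier ?n k))) \<le> norm k powr (2 * s) * (norm (fourier ?p k))\<^sup>2 + norm k powr (2 * s) * (norm (fourier ?n k))\<^sup>2"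
        using yosida_bounds(1)[of m k] by (simp add: norm_mult distrib_left)
    qed
  qed measurable
  have c: "Re (LINT k|lborel. of_real (norm k powr (2 * s)) * (fourier ?p k * cnj (fourier ?n k))) \<le> 0"
    by (rule LIMSEQ_le_const2[OF tendsto_Re[OF lim]]) (use cross in auto)
  have i1: "integrable lborel (\<lambda>k. fourier ?p k * cnj (fourier ?n k))"
    by (rule integrable_l2_mult) (use l2_fourier[OF Lp] l2_fourier[OF Ln] in simp_all)
  have i0: "integrable lborel (\<lambda>k. hat s ?p k * cnj (hat s ?n k))" by (rule integrable_hat[OF Hp Hn])
  have heq: "hat s ?p k * cnj (hat s ?n k) = fourier ?p k * cnj (fourier ?n k) + of_real (norm k powr (2 * s)) * (fourier ?p k * cnj (fourier ?n k))" for k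
  proof -
    have "hat s ?p k * cnj (hat s ?n k) = of_real ((sqrt (1 + norm k powr (2 * s)))\<^sup>2) * (fourier ?p k * cnj (fourier ?n k))"
      unfolding hat_def power2_eq_square of_real_mult complex_cnj_mult complex_cnj_complex_of_real
      by (simp only: mult_ac)
    then show ?thesis unfolding sqrt_weight by (simp add: algebra_simps)
  qed
  have i2: "integrable lborel (\<lambda>k. of_real (norm k powr (2 * s)) * (fourier ?p k * cnj (fourier ?n k)))"
    using Bochner_Integration.integrable_diff[OF i0 i1] unfolding heq by simp
  have "(LINT k|lborel. hat s ?p k * cnj (hat s ?n k)) = of_real ((2 * pi) ^ DIM('a) * (LINT x|lborel. ?p x * ?n x)) + (LINT k|lborel. of_real (norm k powr (2 * s)) * (fourier ?p k * cnj (fourier ?n k)))"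
    unfolding heq using i1 i2 Parseval_real[OF Lp Ln] by simp
  moreover have "(\<lambda>x. ?p x * ?n x) = (\<lambda>x. 0)" by (auto simp: fun_eq_iff max_def)
  ultimately have "Re (LINT k|lborel. hat s ?p k * cnj (hat s ?n k)) \<le> 0" using c by simp
  then have pn: "eform s ?p ?n \<le> 0" unfolding eform_def by (simp add: divide_le_0_iff)
  have sym: "eform s ?n ?p = eform s ?p ?n"
  proof -
    have "(LINT k|lborel. hat s ?n k * cnj (hat s ?p k)) = (LINT k|lborel. cnj (hat s ?p k * cnj (hat s ?n k)))" by (simp add: mult.commute)
    also have "\<dots> = cnj (LINT k|lborel. hat s ?p k * cnj (hat s ?n k))" by (rule Bochner_Integration.integral_cnj)
    finally show ?thesis unfolding eform_def by simp
  qed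
  have "eform s u ?p = eform s (\<lambda>x. ?p x - ?n x) ?p" using dec by simp
  also have "\<dots> = eform s ?p ?p - eform s ?n ?p" by (rule eform_diff_left[OF Hp Hn Hp])
  also have "eform s ?p ?p = (enorm s ?p)\<^sup>2" by (rule eform_self[OF Hp])
  finally show "(enorm s ?p)\<^sup>2 \<le> eform s u ?p" using pn sym by simp
qed

end

subsection \<open>Exterior balls\<close>

lemma smooth_on_has_derivative:
  assumes "smooth_on U \<rho>" "x \<in> U"
  shows "(\<rho> has_derivative frechet_derivative \<rho> (at x)) (at x)"
  using assms times_differentiable_on.simps(2)[of 0 U \<rho>] frechet_derivative_works
  unfolding smooth_on_def by blast

lemma smooth_on_continuous_derivative:
  assumes "smooth_on U \<rho>"
  shows "continuous_on U (\<lambda>x. frechet_derivative \<rho> (at x) v)"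
proof -
  have "times_differentiable_on (Suc 0) U \<rho>" using assms unfolding smooth_on_def by blast
  then show ?thesis by simp
qed

text \<open>Near z0 the derivative of \<rho> along v exceeds 1/2, and a deviation e shorter than
  \<kappa> t changes it by at most t / 2. So \<rho> increases from z, where it is nonnegative, to
  every point of the ball, which therefore misses \<Omega>. As t varies these balls sweep out a cone
  with vertex z.\<close>

lemma exterior_cone_local:
  fixes \<Omega> U :: "'a::euclidean_space set"
  assumes U: "open U" "z0 \<in> U" and smooth: "smooth_on U \<rho>" and v0: "frechet_derivative \<rho> (at z0) v0 \<noteq> 0"
    and \<Omega>: "\<Omega> \<inter> U = {x\<in>U. \<rho> x < 0}"
  shows "\<exists>\<eta>>0. \<exists>\<kappa>>0. \<exists>t0>0. \<exists>v. \<forall>z\<in>ball z0 \<eta>. z \<notin> \<Omega> \<longrightarrow> (\<forall>t. 0 < t \<and> t \<le> t0 \<longrightarrow> ball (z + t *\<^sub>R v) (\<kappa> * t) \<inter> \<Omega> = {})"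
proof -
  let ?D = "\<lambda>x. frechet_derivative \<rho> (at x)"
  have lin: "linear (?D x)" if "x \<in> U" for x
    using smooth_on_has_derivative[OF smooth that] by (rule has_derivative_linear)
  have cont: "isCont (\<lambda>x. ?D x w) z0" for w
    using smooth_on_continuous_derivative[OF smooth, of w] U by (simp add: continuous_on_eq_continuous_at)
  define v where "v = v0 /\<^sub>R ?D z0 v0"
  have v: "?D z0 v = 1" using lin[OF U(2)] v0 by (simp add: v_def linear_cmul)
  have "\<forall>\<^sub>F x in nhds z0. x \<in> U" using U by (rule eventually_nhds_in_open)
  moreover have "\<forall>\<^sub>F x in nhds z0. ?D x v > 1/2"
  proof -
    have "((\<lambda>x. ?D x v) \<longlongrightarrow> ?D z0 v) (nhds z0)"
      using cont[of v] unfolding isCont_def by (intro tendsto_at_iff_tendsto_nhds[THEN iffD1])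
    then show ?thesis using v by (intro order_tendstoD(1)) auto
  qed
  moreover have "\<forall>\<^sub>F x in nhds z0. \<forall>b\<in>Basis. \<bar>?D x b\<bar> < \<bar>?D z0 b\<bar> + 1"
  proof (intro eventually_ball_finite ballI finite_Basis)
    fix b :: 'a
    have "((\<lambda>x. \<bar>?D x b\<bar>) \<longlongrightarrow> \<bar>?D z0 b\<bar>) (nhds z0)"
      using cont[of b] unfolding isCont_def by (intro tendsto_rabs tendsto_at_iff_tendsto_nhds[THEN iffD1])
    then show "\<forall>\<^sub>F x in nhds z0. \<bar>?D x b\<bar> < \<bar>?D z0 b\<bar> + 1" by (intro order_tendstoD(2)) auto
  qed
  ultimately have "\<forall>\<^sub>F x in nhds z0. x \<in> U \<and> ?D x v > 1/2 \<and> (\<forall>b\<in>Basis. \<bar>?D x b\<bar> < \<bar>?D z0 b\<bar> + 1)"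
    by eventually_elim blast
  then obtain R where R: "R > 0" "\<And>x. x \<in> ball z0 R \<Longrightarrow> x \<in> U \<and> ?D x v > 1/2 \<and> (\<forall>b\<in>Basis. \<bar>?D x b\<bar> < \<bar>?D z0 b\<bar> + 1)"
    unfolding eventually_nhds_metric by (metis dist_commute mem_ball)
  define L where "L = (\<Sum>b\<in>(Basis::'a set). \<bar>?D z0 b\<bar> + 1)"
  have L: "L > 0" unfolding L_def by (intro sum_pos) auto
  have DL: "\<bar>?D x e\<bar> \<le> L * norm e" if x: "x \<in> ball z0 R" for x e
  proof -
    have "?D x e = ?D x (\<Sum>b\<in>Basis. (e \<bullet> b) *\<^sub>R b)" by (simp add: euclidean_representation)
    also have "\<dots> = (\<Sum>b\<in>Basis. (e \<bullet> b) * ?D x b)"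
      using lin R(2)[OF x] by (simp add: linear_sum linear_cmul)
    finally have "\<bar>?D x e\<bar> \<le> (\<Sum>b\<in>Basis. \<bar>(e \<bullet> b) * ?D x b\<bar>)" by simp
    also have "\<dots> \<le> (\<Sum>b\<in>Basis. norm e * (\<bar>?D z0 b\<bar> + 1))"
      unfolding abs_mult using R(2)[OF x] by (intro sum_mono mult_mono) (auto simp: Basis_le_norm less_imp_le)
    also have "\<dots> = L * norm e" unfolding L_def by (simp add: sum_distrib_left mult.commute)
    finally show ?thesis .
  qed
  \<comment> \<open>L bounds the derivative of \<rho> near z0, so L \<kappa> \<le> 1/2 keeps the
    deviation below the gain along v.\<close>
  define \<kappa> where "\<kappa> = min 1 (1 / (2 * L))"
  have \<kappa>: "\<kappa> > 0" "\<kappa> \<le> 1" "L * \<kappa> \<le> 1/2"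
  proof -
    show "\<kappa> > 0" "\<kappa> \<le> 1" using L by (auto simp: \<kappa>_def)
    have "L * \<kappa> \<le> L * (1 / (2 * L))" using L by (intro mult_left_mono) (auto simp: \<kappa>_def)
    then show "L * \<kappa> \<le> 1/2" using L by simp
  qed
  \<comment> \<open>With this bound a segment of the cone has length at most R / 4, so from a vertex
    in the ball of radius R / 2 it stays where the derivative is controlled.\<close>
  define t0 where "t0 = (R / 4) / (norm v + 1)"
  have nv: "norm v + 1 > 0" by (simp add: add_nonneg_pos)
  have t0: "t0 > 0" using R(1) nv by (simp add: t0_def)
  have "ball (z + t *\<^sub>R v) (\<kappa> * t) \<inter> \<Omega> = {}" if z: "z \<in> ball z0 (R/2)" "z \<notin> \<Omega>" and t: "0 < t" "t \<le> t0" for z t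
  proof (rule ccontr)
    assume "ball (z + t *\<^sub>R v) (\<kappa> * t) \<inter> \<Omega> \<noteq> {}"
    then obtain q where q: "q \<in> ball (z + t *\<^sub>R v) (\<kappa> * t)" "q \<in> \<Omega>" by blast
    define e where "e = q - (z + t *\<^sub>R v)"
    define w where "w = t *\<^sub>R v + e"
    have e: "norm e < \<kappa> * t" using q(1) by (simp add: e_def dist_norm norm_minus_commute)
    have qz: "q = z + 1 *\<^sub>R w" by (simp add: w_def e_def)
    have "norm w \<le> t * norm v + norm e" unfolding w_def using norm_triangle_ineq[of "t *\<^sub>R v" e] t by simp
    also have "\<dots> \<le> t * norm v + t" 
    proof -
      have "\<kappa> * t \<le> 1 * t" using \<kappa>(2) t by (intro mult_right_mono) auto
      then show ?thesis using e by simp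
    qed
    also have "\<dots> = t * (norm v + 1)" by (simp add: algebra_simps)
    also have "\<dots> \<le> t0 * (norm v + 1)" using t nv by (intro mult_right_mono) auto
    also have "\<dots> = R / 4"
    proof -
      have "(R / 4) / N * N = R / 4" if "N > 0" for N :: real using that by simp
      from this[OF nv] show ?thesis unfolding t0_def .
    qed
    finally have w: "norm w \<le> R / 4" .
    have inb: "z + \<tau> *\<^sub>R w \<in> ball z0 R" if "0 \<le> \<tau>" "\<tau> \<le> 1" for \<tau>
    proof -
      have "dist z0 (z + \<tau> *\<^sub>R w) \<le> dist z0 z + dist z (z + \<tau> *\<^sub>R w)" by (rule dist_triangle)
      also have "dist z (z + \<tau> *\<^sub>R w) = \<tau> * norm w" using that by (simp add: dist_norm)
      also have "\<tau> * norm w \<le> 1 * (R/4)" using that w by (intro mult_mono) auto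
      finally show ?thesis using z(1) R(1) by (simp add: dist_commute)
    qed
    have deriv: "((\<lambda>\<tau>. \<rho> (z + \<tau> *\<^sub>R w)) has_real_derivative ?D (z + \<tau> *\<^sub>R w) w) (at \<tau>)" if "0 \<le> \<tau>" "\<tau> \<le> 1" for \<tau>
    proof -
      have xU: "z + \<tau> *\<^sub>R w \<in> U" using R(2)[OF inb[OF that]] by blast
      have "((\<lambda>\<tau>. z + \<tau> *\<^sub>R w) has_derivative (\<lambda>u. u *\<^sub>R w)) (at \<tau>)" by (auto intro!: derivative_eq_intros)
      from has_derivative_compose[OF this smooth_on_has_derivative[OF smooth xU]]
      have "((\<lambda>\<tau>. \<rho> (z + \<tau> *\<^sub>R w)) has_derivative (\<lambda>u. ?D (z + \<tau> *\<^sub>R w) (u *\<^sub>R w))) (at \<tau>)" .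
      moreover have "?D (z + \<tau> *\<^sub>R w) (u *\<^sub>R w) = ?D (z + \<tau> *\<^sub>R w) w * u" for u
        using linear_cmul[OF lin[OF xU], of u w] by (simp add: mult.commute)
      ultimately show ?thesis by (simp add: has_field_derivative_def)
    qed
    obtain \<tau> where \<tau>: "0 < \<tau>" "\<tau> < 1" "\<rho> (z + 1 *\<^sub>R w) - \<rho> (z + 0 *\<^sub>R w) = (1 - 0) * ?D (z + \<tau> *\<^sub>R w) w"
      using MVT2[of 0 1 "\<lambda>\<tau>. \<rho> (z + \<tau> *\<^sub>R w)" "\<lambda>\<tau>. ?D (z + \<tau> *\<^sub>R w) w"] deriv by auto
    let ?x = "z + \<tau> *\<^sub>R w"
    have x: "?x \<in> ball z0 R" using inb \<tau> by auto
    have "?D ?x w = t * ?D ?x v + ?D ?x e"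
    proof -
      have "linear (?D ?x)" using lin R(2)[OF x] by blast
      then have "?D ?x (t *\<^sub>R v + e) = t * ?D ?x v + ?D ?x e" by (simp only: linear_add linear_cmul real_scaleR_def)
      then show ?thesis by (simp only: w_def)
    qed
    moreover have "t * ?D ?x v > t * (1/2)" using R(2)[OF x] t by (intro mult_strict_left_mono) auto
    moreover have "\<bar>?D ?x e\<bar> \<le> t * (1/2)"
    proof -
      have "\<bar>?D ?x e\<bar> \<le> L * norm e" by (rule DL[OF x])
      also have "\<dots> \<le> L * (\<kappa> * t)" using e L by (intro mult_left_mono) auto
      also have "\<dots> = (L * \<kappa>) * t" by simp
      also have "\<dots> \<le> (1/2) * t" using \<kappa>(3) t by (intro mult_right_mono) auto
      finally show ?thesis by simp
    qed
    ultimately have "\<rho> q > \<rho> z" using \<tau>(3) unfolding qz by (simp add: abs_le_iff)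
    moreover have "\<rho> z \<ge> 0"
    proof -
      have "z \<in> U" using R(2)[OF inb[of 0]] by simp
      then have "\<not> \<rho> z < 0" using \<Omega> z(2) by blast
      then show ?thesis by simp
    qed
    moreover have "\<rho> q < 0"
    proof -
      have "q \<in> U" using R(2)[OF inb[of 1]] qz by simp
      then show ?thesis using \<Omega> q(2) by blast
    qed
    ultimately show False by simp
  qed
  then show ?thesis using R(1) \<kappa>(1) t0 by (intro exI[of _ "R/2"] conjI exI[of _ \<kappa>] exI[of _ t0] exI[of _ v]) auto
qed

text \<open>Compactness of the boundary leaves finitely many local cones. The direction v still
  depends on the point, so only its length is controlled.\<close>

lemma exterior_cone_uniform:
  fixes \<Omega> :: "'a::euclidean_space set"
  assumes "smooth_bounded_domain \<Omega>"
  shows "\<exists>\<kappa>>0. \<exists>t0>0. \<exists>V\<ge>0. \<forall>z\<in>frontier \<Omega>. \<exists>v. norm v \<le> V \<and> (\<forall>t. 0 < t \<and> t \<le> t0 \<longrightarrow> ball (z + t *\<^sub>R v) (\<kappa> * t) \<inter> \<Omega> = {})"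
proof -
  have \<Omega>: "open \<Omega>" "bounded \<Omega>" using assms by (auto simp: smooth_bounded_domain_def)
  have "\<exists>\<eta>>0. \<exists>\<kappa>>0. \<exists>t0>0. \<exists>v. \<forall>z\<in>ball z0 \<eta>. z \<notin> \<Omega> \<longrightarrow> (\<forall>t. 0 < t \<and> t \<le> t0 \<longrightarrow> ball (z + t *\<^sub>R v) (\<kappa> * t) \<inter> \<Omega> = {})"
    if z0: "z0 \<in> frontier \<Omega>" for z0
  proof -
    obtain U \<rho> where U: "open U" "z0 \<in> U" "smooth_on U \<rho>" "\<forall>x\<in>U. \<exists>v. frechet_derivative \<rho> (at x) v \<noteq> 0" "\<Omega> \<inter> U = {x\<in>U. \<rho> x < 0}"
      using assms z0 unfolding smooth_bounded_domain_def by blast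
    then obtain v0 where "frechet_derivative \<rho> (at z0) v0 \<noteq> 0" by blast
    from exterior_cone_local[OF U(1-3) this U(5)] show ?thesis .
  qed
  then obtain \<eta> \<kappa> t0 v where loc: "\<And>z0. z0 \<in> frontier \<Omega> \<Longrightarrow> \<eta> z0 > 0 \<and> \<kappa> z0 > 0 \<and> t0 z0 > 0 \<and>
      (\<forall>z\<in>ball z0 (\<eta> z0). z \<notin> \<Omega> \<longrightarrow> (\<forall>t. 0 < t \<and> t \<le> t0 z0 \<longrightarrow> ball (z + t *\<^sub>R v z0) (\<kappa> z0 * t) \<inter> \<Omega> = {}))"
    by metis
  have comp: "compact (frontier \<Omega>)" using \<Omega> by (simp add: compact_frontier_bounded)
  have cover: "frontier \<Omega> \<subseteq> (\<Union>z0\<in>frontier \<Omega>. ball z0 (\<eta> z0))" using loc by auto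
  obtain C where C: "C \<subseteq> frontier \<Omega>" "finite C" "frontier \<Omega> \<subseteq> (\<Union>z0\<in>C. ball z0 (\<eta> z0))"
    by (rule compactE_image[OF comp _ cover]) auto
  \<comment> \<open>The inserted 1 and 0 keep the extrema defined when C is empty.\<close>
  define K where "K = Min (insert 1 (\<kappa> ` C))"
  define T where "T = Min (insert 1 (t0 ` C))"
  define V where "V = Max (insert 0 ((\<lambda>z. norm (v z)) ` C))"
  have K: "K > 0" "\<And>z. z \<in> C \<Longrightarrow> K \<le> \<kappa> z" unfolding K_def using C loc by (auto simp: Min_gr_iff)
  have T: "T > 0" "\<And>z. z \<in> C \<Longrightarrow> T \<le> t0 z" unfolding T_def using C loc by (auto simp: Min_gr_iff)
  have V: "V \<ge> 0" "\<And>z. z \<in> C \<Longrightarrow> norm (v z) \<le> V" unfolding V_def using C by (auto intro: Max_ge)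
  have "\<exists>v. norm v \<le> V \<and> (\<forall>t. 0 < t \<and> t \<le> T \<longrightarrow> ball (z + t *\<^sub>R v) (K * t) \<inter> \<Omega> = {})" if z: "z \<in> frontier \<Omega>" for z
  proof -
    obtain z0 where z0: "z0 \<in> C" "z \<in> ball z0 (\<eta> z0)" using C z by blast
    have "z \<notin> \<Omega>" using z \<Omega>(1) by (auto simp: frontier_def interior_open)
    then have *: "ball (z + t *\<^sub>R v z0) (\<kappa> z0 * t) \<inter> \<Omega> = {}" if "0 < t" "t \<le> t0 z0" for t
      using loc[of z0] z0 C that by blast
    have "ball (z + t *\<^sub>R v z0) (K * t) \<inter> \<Omega> = {}" if t: "0 < t" "t \<le> T" for t
    proof -
      have "ball (z + t *\<^sub>R v z0) (K * t) \<subseteq> ball (z + t *\<^sub>R v z0) (\<kappa> z0 * t)"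
        using K(2)[OF z0(1)] t by (intro subset_ball mult_right_mono) auto
      then show ?thesis using *[of t] T(2)[OF z0(1)] t by fastforce
    qed
    then show ?thesis using V(2)[OF z0(1)] by blast
  qed
  then show ?thesis using K(1) T(1) V(1) by blast
qed

lemma frontier_rescaled:
  fixes \<Omega> :: "'a::euclidean_space set"
  assumes "\<epsilon> > 0"
  shows "frontier (rescaled \<epsilon> \<Omega>) = rescaled \<epsilon> (frontier \<Omega>)"
proof -
  have "(\<lambda>x. x /\<^sub>R \<epsilon>) ` interior \<Omega> = interior ((\<lambda>x. x /\<^sub>R \<epsilon>) ` \<Omega>)"
    by (rule interior_injective_linear_image[symmetric]) (use assms in \<open>auto intro!: linearI simp: algebra_simps inj_on_def\<close>)
  moreover have "(\<lambda>x. x /\<^sub>R \<epsilon>) ` closure \<Omega> = closure ((\<lambda>x. x /\<^sub>R \<epsilon>) ` \<Omega>)"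
    by (rule closure_injective_linear_image) (use assms in \<open>auto intro!: linearI simp: algebra_simps inj_on_def\<close>)
  moreover have "inj (\<lambda>x::'a. x /\<^sub>R \<epsilon>)" using assms by (auto simp: inj_on_def)
  ultimately show ?thesis unfolding frontier_def rescaled_def by (simp add: image_set_diff)
qed

text \<open>The cone is taken at the boundary point nearest to \<xi>, with t = d \<epsilon>: after
  division by \<epsilon> the ball has radius \<kappa> d and centre within (1 + V) d of \<xi>. The
  bound d \<le> t0 / \<epsilon> is exactly the admissibility of t, and the origin of the threshold
  on \<delta>.\<close>

lemma exterior_ball_rescaled:
  fixes \<Omega> :: "'a::euclidean_space set"
  assumes "smooth_bounded_domain \<Omega>"
  shows "\<exists>\<kappa>>0. \<exists>t0>0. \<exists>K\<ge>0. \<forall>\<epsilon> \<xi>. 0 < \<epsilon> \<longrightarrow> 0 < infdist \<xi> (frontier (rescaled \<epsilon> \<Omega>)) \<longrightarrow>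
    infdist \<xi> (frontier (rescaled \<epsilon> \<Omega>)) \<le> t0 / \<epsilon> \<longrightarrow>
    (\<exists>p. norm (p - \<xi>) \<le> K * infdist \<xi> (frontier (rescaled \<epsilon> \<Omega>)) \<and>
      ball p (\<kappa> * infdist \<xi> (frontier (rescaled \<epsilon> \<Omega>))) \<inter> rescaled \<epsilon> \<Omega> = {})"
proof -
  obtain \<kappa> t0 V where k: "\<kappa> > 0" "t0 > 0" "V \<ge> 0" "\<And>z. z \<in> frontier \<Omega> \<Longrightarrow> \<exists>v. norm v \<le> V \<and> (\<forall>t. 0 < t \<and> t \<le> t0 \<longrightarrow> ball (z + t *\<^sub>R v) (\<kappa> * t) \<inter> \<Omega> = {})"
    using exterior_cone_uniform[OF assms] by blast
  have "\<exists>p. norm (p - \<xi>) \<le> (1 + V) * infdist \<xi> (frontier (rescaled \<epsilon> \<Omega>)) \<and>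
      ball p (\<kappa> * infdist \<xi> (frontier (rescaled \<epsilon> \<Omega>))) \<inter> rescaled \<epsilon> \<Omega> = {}"
    if e: "0 < \<epsilon>" and d: "0 < infdist \<xi> (frontier (rescaled \<epsilon> \<Omega>))" "infdist \<xi> (frontier (rescaled \<epsilon> \<Omega>)) \<le> t0 / \<epsilon>" for \<epsilon> \<xi>
  proof -
    define d where "d = infdist \<xi> (frontier (rescaled \<epsilon> \<Omega>))"
    have d0: "0 < d" "d * \<epsilon> \<le> t0" using d e by (auto simp: d_def pos_le_divide_eq)
    \<comment> \<open>\<open>infdist\<close> to the empty set is 0, so a positive distance means
      that the boundary is nonempty.\<close>
    have "frontier (rescaled \<epsilon> \<Omega>) \<noteq> {}" using d(1) by (auto simp: infdist_def)
    then obtain z' where z': "z' \<in> frontier (rescaled \<epsilon> \<Omega>)" "d = dist \<xi> z'"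
      using infdist_attains_inf[of "frontier (rescaled \<epsilon> \<Omega>)" \<xi>] by (auto simp: d_def)
    then obtain z where z: "z \<in> frontier \<Omega>" "z' = z /\<^sub>R \<epsilon>" unfolding frontier_rescaled[OF e] by (auto simp: rescaled_def)
    obtain v where v: "norm v \<le> V" "\<And>t. 0 < t \<Longrightarrow> t \<le> t0 \<Longrightarrow> ball (z + t *\<^sub>R v) (\<kappa> * t) \<inter> \<Omega> = {}"
      using k(4)[OF z(1)] by blast
    have emp: "ball (z + (d * \<epsilon>) *\<^sub>R v) (\<kappa> * (d * \<epsilon>)) \<inter> \<Omega> = {}" using v(2)[of "d * \<epsilon>"] d0 e by simp
    define p where "p = z' + d *\<^sub>R v"
    have "norm (p - \<xi>) \<le> norm (z' - \<xi>) + norm (d *\<^sub>R v)"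
      unfolding p_def using norm_triangle_ineq[of "z' - \<xi>" "d *\<^sub>R v"] by (simp add: algebra_simps)
    also have "\<dots> \<le> d + d * V" using z'(2) d0 v(1) by (auto simp: dist_norm norm_minus_commute intro!: mult_left_mono)
    finally have "norm (p - \<xi>) \<le> (1 + V) * d" by (simp add: algebra_simps)
    moreover have "ball p (\<kappa> * d) \<inter> rescaled \<epsilon> \<Omega> = {}"
    proof (rule ccontr)
      assume "ball p (\<kappa> * d) \<inter> rescaled \<epsilon> \<Omega> \<noteq> {}"
      then obtain y where y: "y \<in> \<Omega>" "norm (p - y /\<^sub>R \<epsilon>) < \<kappa> * d" by (auto simp: rescaled_def dist_norm)
      have "z + (d * \<epsilon>) *\<^sub>R v - y = \<epsilon> *\<^sub>R (p - y /\<^sub>R \<epsilon>)"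
        using e by (simp add: p_def z(2) algebra_simps)
      then have "norm (z + (d * \<epsilon>) *\<^sub>R v - y) = \<epsilon> * norm (p - y /\<^sub>R \<epsilon>)" using e by simp
      also have "\<dots> < \<epsilon> * (\<kappa> * d)" using y(2) e by (intro mult_strict_left_mono) auto
      finally have "y \<in> ball (z + (d * \<epsilon>) *\<^sub>R v) (\<kappa> * (d * \<epsilon>))" by (simp add: dist_norm mult_ac)
      then show False using emp y(1) by blast
    qed
    ultimately show ?thesis unfolding d_def by blast
  qed
  then show ?thesis using k(1-3) by (intro exI[of _ \<kappa>] exI[of _ t0] exI[of _ "1 + V"] conjI) auto
qed

lemma ball_infdist_frontier_subset:
  fixes U :: "'a::euclidean_space set"
  assumes "\<xi> \<in> U"
  shows "ball \<xi> (infdist \<xi> (frontier U)) \<subseteq> U"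
proof (rule ccontr)
  let ?B = "ball \<xi> (infdist \<xi> (frontier U))"
  assume n: "\<not> ?B \<subseteq> U"
  then have "?B \<noteq> {}" by blast
  then have "\<xi> \<in> ?B" by (simp add: ball_eq_empty not_le)
  then have ne: "?B \<inter> U \<noteq> {}" using assms by blast
  have "?B - U \<noteq> {}" using n by blast
  with ne have "?B \<inter> frontier U \<noteq> {}"
    by (rule connected_Int_frontier[OF connected_ball])
  then obtain x where x: "x \<in> frontier U" "dist \<xi> x < infdist \<xi> (frontier U)" by auto
  then show False using infdist_le[OF x(1), of \<xi>] by simp
qed

subsection \<open>Bounds for the regular part from below\<close>

lemma rescaled_eq_vimage:
  fixes \<Omega> :: "'a::euclidean_space set"
  shows "\<epsilon> > 0 \<Longrightarrow> rescaled \<epsilon> \<Omega> = (\<lambda>x. \<epsilon> *\<^sub>R x) -` \<Omega>"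
  unfolding rescaled_def by (auto simp: image_iff intro!: bexI[of _ "\<epsilon> *\<^sub>R x" for x])

lemma open_rescaled:
  fixes \<Omega> :: "'a::euclidean_space set"
  shows "\<epsilon> > 0 \<Longrightarrow> open \<Omega> \<Longrightarrow> open (rescaled \<epsilon> \<Omega>)"
  unfolding rescaled_eq_vimage by (intro open_vimage continuous_intros)

lemma bounded_rescaled:
  fixes \<Omega> :: "'a::euclidean_space set"
  shows "bounded \<Omega> \<Longrightarrow> bounded (rescaled \<epsilon> \<Omega>)"
  unfolding rescaled_def by (rule bounded_scaling)

lemma l2_indicator:
  fixes U :: "'a::euclidean_space set"
  assumes "bounded U" "U \<in> sets borel"
  shows "l2 (indicator U :: 'a \<Rightarrow> real)"
proof -
  have "integrable lborel (indicator U :: 'a \<Rightarrow> real)"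
    by (intro integrable_real_indicator) (use assms emeasure_bounded_finite[OF assms(1)] in auto)
  then show ?thesis by (rule bounded_integrable_l2[where B=1]) (auto simp: indicator_def)
qed

lemma measure_unit_ball_pos: "measure lborel (ball (c::'a::euclidean_space) 1) > 0"
  using content_ball_pos[of 1 c] by simp

text \<open>Dirichlet's principle: u is orthogonal to u - t. It lets any \<open>Hs\<close> extension
  t of the exterior values control the solution.\<close>

lemma enorm_minimal:
  assumes u: "Hs s u" and t: "Hs s t" and eq: "\<And>x. x \<notin> U \<Longrightarrow> u x = t x"
    and sol: "\<And>v. Hs s v \<Longrightarrow> (\<And>x. x \<notin> U \<Longrightarrow> v x = 0) \<Longrightarrow> eform s u v = 0"
  shows "enorm s u \<le> enorm s t"
proof -
  have "eform s u (\<lambda>x. u x - t x) = 0" by (rule sol) (use eq Hs_diff[OF u t] in auto)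
  then have "(enorm s u)\<^sup>2 = eform s u t" using eform_diff_right[OF u t u] eform_self[OF u] by simp
  also have "\<dots> \<le> enorm s u * enorm s t" using eform_Cauchy_Schwarz[OF u t] by simp
  finally have "enorm s u * enorm s u \<le> enorm s u * enorm s t" by (simp add: power2_eq_square)
  then show ?thesis by (cases "enorm s u = 0") (auto simp: mult_le_cancel_left less_le)
qed

context fundamental_solution
begin

text \<open>The positive part is itself an admissible variation, and the Markov property bounds its
  energy by its pairing with z. The constant C admits functions that are subsolutions only up to a
  functional of energy norm C.\<close>

lemma max_principle:
  fixes z :: "'a \<Rightarrow> real"
  assumes z: "Hs s z" and ext: "\<And>x. x \<notin> U \<Longrightarrow> z x \<le> 0" and C: "0 \<le> C"
    and sub: "\<And>v. Hs s v \<Longrightarrow> (\<And>x. 0 \<le> v x) \<Longrightarrow> (\<And>x. x \<notin> U \<Longrightarrow> v x = 0) \<Longrightarrow> eform s z v \<le> C * enorm s v"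
  shows "Hs s (\<lambda>x. max (z x) 0)" "enorm s (\<lambda>x. max (z x) 0) \<le> C"
proof -
  let ?p = "\<lambda>x. max (z x) 0"
  show p: "Hs s ?p" by (rule Markov[OF z])
  have "(enorm s ?p)\<^sup>2 \<le> eform s z ?p" by (rule Markov[OF z])
  also have "\<dots> \<le> C * enorm s ?p" by (rule sub[OF p]) (use ext in auto)
  finally have "enorm s ?p * enorm s ?p \<le> C * enorm s ?p" by (simp add: power2_eq_square)
  then show "enorm s ?p \<le> C" using C by (cases "enorm s ?p = 0") (auto simp: mult_le_cancel_right less_le)
qed

lemma max_principle_0:
  fixes z :: "'a \<Rightarrow> real"
  assumes z: "Hs s z" and ext: "\<And>x. x \<notin> U \<Longrightarrow> z x \<le> 0"
    and sub: "\<And>v. Hs s v \<Longrightarrow> (\<And>x. 0 \<le> v x) \<Longrightarrow> (\<And>x. x \<notin> U \<Longrightarrow> v x = 0) \<Longrightarrow> eform s z v \<le> 0"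
  shows "AE x in lborel. z x \<le> 0"
proof -
  have m: "Hs s (\<lambda>x. max (z x) 0)" "enorm s (\<lambda>x. max (z x) 0) \<le> 0"
    using max_principle[OF z ext, where C=0] sub by auto
  then have "l2norm (\<lambda>x. max (z x) 0) = 0"
    using l2norm_le_enorm[OF m(1)] l2norm_nonneg[of "\<lambda>x. max (z x) 0"] by linarith
  then have "AE x in lborel. max (z x) 0 = 0"
    by (intro l2_eq_0_AE L12D Hs_L12[OF m(1)])
  then show ?thesis by eventually_elim (auto simp: max_def split: if_splits)
qed

text \<open>A weak solution is only known to be L2. On the bounded set U this implies integrability,
  and outside U the values are those of the integrable \<Gamma>(x - y).\<close>

lemma regular_part_L12:
  assumes U: "open U" "bounded U" and H: "regular_part s U \<Gamma> H" and y: "y \<in> U"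
  shows "L12 (\<lambda>x. H x y)"
proof -
  have sol: "weak_solution s U (\<lambda>x. H x y) (\<lambda>x. 0)" and ext: "\<And>x. x \<notin> U \<Longrightarrow> H x y = \<Gamma> (x - y)"
    using H y unfolding regular_part_def by auto
  have l2: "l2 (\<lambda>x. H x y)"
    using sol unfolding weak_solution_def sobolev_def has_weak_frac_laplacian_def square_integrable_iff_l2 by blast
  have [measurable]: "U \<in> sets borel" using U by auto
  have "integrable lborel (\<lambda>x. indicator U x * H x y)"
    by (intro integrable_l2_mult l2_indicator U l2) auto
  moreover have "integrable lborel (\<lambda>x. indicator (- U) x * \<Gamma> (x - y))"
    by (rule Bochner_Integration.integrable_bound[of _ "\<lambda>x. \<Gamma> (x - y)"]) (use integrable in \<open>auto simp: indicator_def\<close>)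
  ultimately have "integrable lborel (\<lambda>x. indicator U x * H x y + indicator (- U) x * \<Gamma> (x - y))" by simp
  moreover have "indicator U x * H x y + indicator (- U) x * \<Gamma> (x - y) = H x y" for x
    using ext[of x] by (auto simp: indicator_def)
  ultimately show ?thesis using l2 by (simp add: L12_def)
qed

lemma regular_part_Hs:
  assumes U: "open U" "bounded U" and H: "regular_part s U \<Gamma> H" and y: "y \<in> U"
  shows "Hs s (\<lambda>x. H x y)"
    "\<And>v. Hs s v \<Longrightarrow> (\<And>x. x \<notin> U \<Longrightarrow> v x = 0) \<Longrightarrow> eform s (\<lambda>x. H x y) v = 0"
proof -
  have sol: "weak_solution s U (\<lambda>x. H x y) (\<lambda>x. 0)" using H y unfolding regular_part_def by auto
  note * = weak_solution_eform[OF sol regular_part_L12[OF assms]]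
  show "Hs s (\<lambda>x. H x y)" by (rule *) (use s in auto)
  fix v :: "'a \<Rightarrow> real" assume "Hs s v" "\<And>x. x \<notin> U \<Longrightarrow> v x = 0"
  then show "eform s (\<lambda>x. H x y) v = 0" using *(2)[of v] s by simp
qed

lemma regular_part_exterior:
  "regular_part s U \<Gamma> H \<Longrightarrow> y \<in> U \<Longrightarrow> x \<notin> U \<Longrightarrow> H x y = \<Gamma> (x - y)"
  unfolding regular_part_def by auto

lemma regular_part_nonneg:
  assumes U: "open U" "bounded U" and H: "regular_part s U \<Gamma> H" and y: "y \<in> U"
  shows "AE x in lborel. 0 \<le> H x y"
proof -
  note u = regular_part_Hs[OF U H y]
  have "AE x in lborel. (-1) * H x y \<le> 0"
  proof (rule max_principle_0[where U=U])
    show "Hs s (\<lambda>x. (-1) * H x y)" by (rule Hs_cmult[OF u(1)])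
    show "(-1) * H x y \<le> 0" if "x \<notin> U" for x
      using regular_part_exterior[OF H y that] pos[of "x - y"] that y by (cases "x = y") auto
    show "eform s (\<lambda>x. (-1) * H x y) v \<le> 0" if "Hs s v" "\<And>x. x \<notin> U \<Longrightarrow> v x = 0" for v :: "'a \<Rightarrow> real"
      using u(2)[OF that] eform_cmult_left[of s "-1" "\<lambda>x. H x y" v] by simp
  qed
  then show ?thesis by eventually_elim simp
qed

lemma decay_bounds:
  obtains a b where "a > 0" "b > 0"
    "\<And>x. 1 \<le> norm x \<Longrightarrow> a * norm x powr (- (real DIM('a) + 2 * s)) \<le> \<Gamma> x"
    "\<And>x. 1 \<le> norm x \<Longrightarrow> \<Gamma> x \<le> b * norm x powr (- (real DIM('a) + 2 * s))"
  using decay unfolding two_sided_decay_def by auto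

text \<open>\<open>\<beta> = \<Gamma> * (\<Gamma>(\<cdot> - y) 1\<^bsub>-U\<^esub>)\<close> solves the homogeneous equation in \<open>U\<close>, and outside of \<open>U\<close> it is at
  most a multiple of \<open>\<Gamma>(\<cdot> - y)\<close>, because \<open>\<Gamma> * \<Gamma>\<close> decays like \<open>\<Gamma>\<close>.\<close>

lemma regular_part_lower_bound:
  "\<exists>c>0. \<forall>U H y. open U \<longrightarrow> bounded U \<longrightarrow> regular_part s U \<Gamma> H \<longrightarrow> ball y 1 \<subseteq> U \<longrightarrow>
     (AE x in lborel. c * conv \<Gamma> (\<lambda>z. indicator (- U) z * \<Gamma> (z - y)) x \<le> H x y)"
proof -
  define N where "N = real DIM('a) + 2 * s"
  obtain a b where ab: "a > 0" "b > 0" "\<And>x. 1 \<le> norm x \<Longrightarrow> a * norm x powr (- N) \<le> \<Gamma> x"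
    "\<And>x. 1 \<le> norm x \<Longrightarrow> \<Gamma> x \<le> b * norm x powr (- N)"
    using decay_bounds unfolding N_def by blast
  have N: "N \<ge> 0" using s by (simp add: N_def)
  \<comment> \<open>Outside U the convolution is at most 2 b (D / 2)^-N with D the distance from x
    to y, while \<Gamma>(x - y) is at least a D^-N; c is the ratio of these bounds.\<close>
  define c where "c = a / (2 * b * 2 powr N)"
  have c: "c > 0" using ab by (simp add: c_def)
  have "AE x in lborel. c * conv \<Gamma> (\<lambda>z. indicator (- U) z * \<Gamma> (z - y)) x \<le> H x y"
    if U: "open U" "bounded U" and H: "regular_part s U \<Gamma> H" and y: "ball y 1 \<subseteq> U" for U H y
  proof -
    have yU: "y \<in> U" using y by auto
    \<comment> \<open>The unit ball around y inside U keeps the exterior in the range of the decay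
      estimate, which makes h bounded and hence \<open>L12\<close> despite the singularity of
      \<Gamma>.\<close>
    have out: "1 \<le> norm (z - y)" if "z \<notin> U" for z
    proof (rule ccontr)
      assume "\<not> 1 \<le> norm (z - y)"
      then have "z \<in> ball y 1" by (simp add: dist_norm norm_minus_commute)
      then show False using y that by blast
    qed
    define h where "h z = indicator (- U) z * \<Gamma> (z - y)" for z
    have [measurable]: "U \<in> sets borel" using U by auto
    have h0: "0 \<le> h z" for z
    proof (cases "z \<in> U")
      case False
      then have "z - y \<noteq> 0" using out[OF False] by auto
      then show ?thesis using pos[of "z - y"] by (simp add: h_def less_imp_le)
    qed (simp add: h_def)
    have hb: "h z \<le> b * r powr (- N)" if "0 < r" "r \<le> norm (z - y)" for z r
    proof (cases "z \<in> U")
      case True then show ?thesis using ab by (simp add: h_def)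
    next
      case False
      have "h z \<le> b * norm (z - y) powr (- N)" using ab(4)[OF out[OF False]] False by (simp add: h_def)
      also have "\<dots> \<le> b * r powr (- N)" using ab that N by (intro mult_left_mono powr_mono2') auto
      finally show ?thesis .
    qed
    have hi: "integrable lborel h"
      unfolding h_def by (rule Bochner_Integration.integrable_bound[of _ "\<lambda>x. \<Gamma> (x - y)"]) (use integrable in \<open>auto simp: indicator_def\<close>)
    have "\<bar>h z\<bar> \<le> b" for z
    proof (cases "z \<in> U")
      case True then show ?thesis using ab by (simp add: h_def)
    next
      case False then show ?thesis using hb[of 1 z] out[OF False] h0[of z] by simp
    qed
    then have hL: "L12 h" unfolding L12_def using hi by (auto intro!: bounded_integrable_l2)
    have hm[measurable]: "h \<in> borel_measurable borel" using L12D[OF hL] by simp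
    note u = regular_part_Hs[OF U H yU]
    have "AE x in lborel. c * conv \<Gamma> h x - H x y \<le> 0"
    proof (rule max_principle_0[where U=U])
      show "Hs s (\<lambda>x. c * conv \<Gamma> h x - H x y)" by (intro Hs_diff Hs_cmult Hs_conv hL u)
      fix v :: "'a \<Rightarrow> real" assume v: "Hs s v" "\<And>x. x \<notin> U \<Longrightarrow> v x = 0"
      have "(\<lambda>x. h x * v x) = (\<lambda>x. 0)" using v(2) by (auto simp: h_def fun_eq_iff indicator_def)
      then have "eform s (conv \<Gamma> h) v = 0" using eform_conv[OF hL v(1)] by simp
      then show "eform s (\<lambda>x. c * conv \<Gamma> h x - H x y) v \<le> 0"
        using eform_diff_left[OF Hs_cmult[OF Hs_conv[OF hL], of c] u(1) v(1)] eform_cmult_left[of s c "conv \<Gamma> h" v] u(2)[OF v]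
        by simp
    next
      fix x assume x: "x \<notin> U"
      define D where "D = norm (x - y)"
      have D: "D \<ge> 1" using out[OF x] by (simp add: D_def)
      define M where "M = b * (D / 2) powr (- N)"
      have M: "M \<ge> 0" using ab by (simp add: M_def)
      \<comment> \<open>One of the distances from z to x and to y is at least D / 2. The
        corresponding factor is at most M, and the other is integrated, with total mass 1.\<close>
      have pt: "AE z in lborel. \<Gamma> (x - z) * h z \<le> M * \<Gamma> (x - z) + M * \<Gamma> (z - y)"
        using nonneg_AE[of x] nonneg_AE'[of y]
      proof eventually_elim
        case (elim z)
        show ?case
        proof (cases "h z = 0")
          case True then show ?thesis using elim M by simp
        next
          case hz: False
          then have zU: "z \<notin> U" by (auto simp: h_def)
          show ?thesis
          proof (cases "D / 2 \<le> norm (z - y)")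
            case True
            have "\<Gamma> (x - z) * h z \<le> \<Gamma> (x - z) * M" unfolding M_def using elim hb[of "D/2" z] True D by (intro mult_left_mono) auto
            then show ?thesis using elim M by (simp add: mult.commute add_increasing2)
          next
            case False
            have "D \<le> norm (x - z) + norm (z - y)" unfolding D_def using norm_triangle_ineq[of "x - z" "z - y"] by simp
            then have xz: "D / 2 \<le> norm (x - z)" using False by simp
            have "1 \<le> norm (x - z)" using out[OF zU] False xz by linarith
            then have "\<Gamma> (x - z) \<le> b * norm (x - z) powr (- N)" by (rule ab)
            also have "\<dots> \<le> M" unfolding M_def using ab xz D N by (intro mult_left_mono powr_mono2') auto
            finally have le: "\<Gamma> (x - z) * h z \<le> M * h z" using h0 by (intro mult_right_mono)
            have "h z = \<Gamma> (z - y)" using zU by (simp add: h_def)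
            then show ?thesis using le elim M by (simp add: add_increasing)
          qed
        qed
      qed
      have i1: "integrable lborel (\<lambda>z. \<Gamma> (x - z))" "integrable lborel (\<lambda>z. \<Gamma> (z - y))" using integrable by simp_all
      \<comment> \<open>A nonintegrable integrand has integral 0 by convention, which is compatible
        with an upper bound that is nonnegative.\<close>
      have "conv \<Gamma> h x \<le> (LINT z|lborel. M * \<Gamma> (x - z) + M * \<Gamma> (z - y))"
      proof (cases "integrable lborel (\<lambda>z. \<Gamma> (x - z) * h z)")
        case True
        then show ?thesis unfolding conv_def using i1 pt by (intro integral_mono_AE) auto
      next
        case False
        then have "conv \<Gamma> h x = 0" by (simp add: conv_def not_integrable_integral_eq)
        also have "0 \<le> (LINT z|lborel. M * \<Gamma> (x - z) + M * \<Gamma> (z - y))"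
        proof (rule integral_nonneg_AE)
          show "AE z in lborel. 0 \<le> M * \<Gamma> (x - z) + M * \<Gamma> (z - y)"
            using nonneg_AE[of x] nonneg_AE'[of y] by eventually_elim (use M in auto)
        qed
        finally show ?thesis .
      qed
      also have "\<dots> = 2 * M" using i1 integral by simp
      finally have "c * conv \<Gamma> h x \<le> c * (2 * M)" using c by (intro mult_left_mono) auto
      also have "\<dots> = a * D powr (- N)"
      proof -
        have "(D / 2) powr (- N) = D powr (- N) * 2 powr N"
          unfolding powr_divide powr_minus[of 2] by (simp only: divide_inverse inverse_inverse_eq)
        then show ?thesis using ab by (simp add: M_def c_def)
      qed
      also have "\<dots> \<le> \<Gamma> (x - y)" unfolding D_def by (rule ab(3)[OF out[OF x]])
      also have "\<dots> = H x y" using regular_part_exterior[OF H yU x] by simp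
      finally show "c * conv \<Gamma> h x - H x y \<le> 0" by simp
    qed
    then show ?thesis unfolding h_def by eventually_elim simp
  qed
  then show ?thesis using c by blast
qed

text \<open>Only the exterior ball is kept in the integral. Its points lie within M d of the unit
  ball around \<xi>, with M = 1 + K + \<kappa>, so both factors are at least a (M d)^-N, and the
  volume is \<omega> (\<kappa> d)^n. Since N = n + 2s, the powers of d add up to n - 2N = -(n +
  4s).\<close>

lemma conv_exterior_lower_bound:
  assumes \<kappa>: "\<kappa> > 0" and K: "K \<ge> 0"
  shows "\<exists>c>0. \<forall>U \<xi> d p x y. open U \<longrightarrow> 2 \<le> d \<longrightarrow> ball \<xi> d \<subseteq> U \<longrightarrow> norm (p - \<xi>) \<le> K * d \<longrightarrow>
     ball p (\<kappa> * d) \<inter> U = {} \<longrightarrow> x \<in> ball \<xi> 1 \<longrightarrow> y \<in> ball \<xi> 1 \<longrightarrow>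
     c * d powr (- (real DIM('a) + 4 * s)) \<le> conv \<Gamma> (\<lambda>z. indicator (- U) z * \<Gamma> (z - y)) x"
proof -
  define N where "N = real DIM('a) + 2 * s"
  obtain a b where ab: "a > 0" "b > 0" "\<And>x. 1 \<le> norm x \<Longrightarrow> a * norm x powr (- N) \<le> \<Gamma> x"
    "\<And>x. 1 \<le> norm x \<Longrightarrow> \<Gamma> x \<le> b * norm x powr (- N)"
    using decay_bounds unfolding N_def by blast
  have N: "N \<ge> 0" using s by (simp add: N_def)
  define M where "M = 1 + K + \<kappa>"
  have M: "M > 0" using K \<kappa> by (simp add: M_def)
  define \<omega> where "\<omega> = unit_ball_vol (real DIM('a))"
  have \<omega>: "\<omega> > 0" by (simp add: \<omega>_def)
  define c where "c = (a * M powr (- N)) * (a * M powr (- N)) * (\<omega> * \<kappa> ^ DIM('a))"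
  have c: "c > 0" using ab M \<omega> \<kappa> by (simp add: c_def)
  have "c * d powr (- (real DIM('a) + 4 * s)) \<le> conv \<Gamma> (\<lambda>z. indicator (- U) z * \<Gamma> (z - y)) x"
    if U: "open U" and d: "2 \<le> d" and bU: "ball \<xi> d \<subseteq> U" and p: "norm (p - \<xi>) \<le> K * d"
      and ext: "ball p (\<kappa> * d) \<inter> U = {}" and x: "x \<in> ball \<xi> 1" and y: "y \<in> ball \<xi> 1" for U \<xi> d p x y
  proof -
    define h where "h z = indicator (- U) z * \<Gamma> (z - y)" for z
    have [measurable]: "U \<in> sets borel" using U by auto
    \<comment> \<open>From d \<ge> 2 a distance of at least 1 remains between the unit ball and the
      complement of U, so the decay bounds apply.\<close>
    have far: "1 \<le> norm (q - z)" if q: "q \<in> ball \<xi> 1" and z: "z \<notin> U" for q z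
    proof -
      have "\<not> dist \<xi> z < d" using bU z by auto
      moreover have "dist \<xi> z \<le> dist \<xi> q + dist q z" by (rule dist_triangle)
      moreover have "dist \<xi> q < 1" using q by simp
      ultimately have "1 \<le> dist q z" using d by linarith
      then show ?thesis by (simp add: dist_norm)
    qed
    have h0: "0 \<le> h z" for z
    proof (cases "z \<in> U")
      case False
      then have "z - y \<noteq> 0" using far[OF y False] by auto
      then show ?thesis using pos[of "z - y"] by (simp add: h_def less_imp_le)
    qed (simp add: h_def)
    have near: "norm (q - z) \<le> M * d" if q: "q \<in> ball \<xi> 1" and z: "z \<in> ball p (\<kappa> * d)" for q z
    proof -
      have "dist q z \<le> dist q \<xi> + dist \<xi> z" by (rule dist_triangle)
      also have "dist \<xi> z \<le> dist \<xi> p + dist p z" by (rule dist_triangle)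
      finally have "dist q z \<le> dist \<xi> q + (dist p \<xi> + dist p z)" by (simp add: dist_commute)
      also have "\<dots> \<le> 1 + (K * d + \<kappa> * d)" using q z p by (intro add_mono) (auto simp: dist_norm)
      also have "\<dots> \<le> M * d" using d by (simp add: M_def algebra_simps)
      finally show ?thesis by (simp add: dist_norm)
    qed
    define L where "L = a * (M * d) powr (- N)"
    have L0: "L \<ge> 0" using ab by (simp add: L_def)
    have low: "L \<le> \<Gamma> (q - z)" if q: "q \<in> ball \<xi> 1" and z: "z \<in> ball p (\<kappa> * d)" for q z
    proof -
      have zU: "z \<notin> U" using ext z by blast
      have "L \<le> a * norm (q - z) powr (- N)"
        unfolding L_def using far[OF q zU] near[OF q z] ab N by (intro mult_left_mono powr_mono2') auto
      also have "\<dots> \<le> \<Gamma> (q - z)" by (rule ab(3)[OF far[OF q zU]])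
      finally show ?thesis .
    qed
    have hi: "integrable lborel h"
      unfolding h_def by (rule Bochner_Integration.integrable_bound[of _ "\<lambda>x. \<Gamma> (x - y)"]) (use integrable in \<open>auto simp: indicator_def\<close>)
    have [measurable]: "h \<in> borel_measurable borel" using borel_measurable_integrable[OF hi] by simp
    \<comment> \<open>For a bound from below integrability is essential: otherwise the convolution
      would take the default value 0.\<close>
    have intg: "integrable lborel (\<lambda>z. \<Gamma> (x - z) * h z)"
    proof (rule Bochner_Integration.integrable_bound)
      show "integrable lborel (\<lambda>z. b * h z)" using hi by simp
      show "AE z in lborel. norm (\<Gamma> (x - z) * h z) \<le> norm (b * h z)"
      proof (intro always_eventually allI)
        fix z
        show "norm (\<Gamma> (x - z) * h z) \<le> norm (b * h z)"
        proof (cases "z \<in> U")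
          case False
          have f: "1 \<le> norm (x - z)" by (rule far[OF x False])
          have "\<Gamma> (x - z) \<le> b * norm (x - z) powr (- N)" by (rule ab(4)[OF f])
          also have "\<dots> \<le> b * 1 powr (- N)" using ab N f by (intro mult_left_mono powr_mono2') auto
          finally have "\<Gamma> (x - z) \<le> b" by simp
          moreover have "0 < \<Gamma> (x - z)" using pos[of "x - z"] f by fastforce
          ultimately show ?thesis using ab h0[of z] by (simp add: abs_mult mult_right_mono)
        qed (simp add: h_def)
      qed
    qed measurable
    have "L * L * measure lborel (ball p (\<kappa> * d)) = (LINT z|lborel. indicator (ball p (\<kappa> * d)) z * (L * L))" by simp
    also have "\<dots> \<le> (LINT z|lborel. \<Gamma> (x - z) * h z)"
    proof (rule integral_mono_AE)
      have "emeasure lborel (ball p (\<kappa> * d)) < \<infinity>" by (intro emeasure_bounded_finite) auto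
      then show "Bochner_Integration.integrable lborel (\<lambda>z. indicator (ball p (\<kappa> * d)) z * (L * L))"
        by (intro integrable_mult_left integrable_real_indicator) auto
      show "AE z in lborel. indicator (ball p (\<kappa> * d)) z * (L * L) \<le> \<Gamma> (x - z) * h z"
        using nonneg_AE[of x]
      proof eventually_elim
        case (elim z)
        show ?case
        proof (cases "z \<in> ball p (\<kappa> * d)")
          case True
          then have "z \<notin> U" using ext by blast
          then have "h z = \<Gamma> (y - z)" by (simp add: h_def commute[of z])
          then show ?thesis using low[OF x True] low[OF y True] L0 True by (auto intro!: mult_mono)
        next
          case False then show ?thesis using elim h0[of z] by simp
        qed
      qed
    qed (rule intg)
    also have "\<dots> = conv \<Gamma> h x" by (simp add: conv_def)
    finally have "L * L * measure lborel (ball p (\<kappa> * d)) \<le> conv \<Gamma> h x" .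
    moreover have "L * L * measure lborel (ball p (\<kappa> * d)) = c * d powr (- (real DIM('a) + 4 * s))"
    proof -
      have "measure lborel (ball p (\<kappa> * d)) = \<omega> * (\<kappa> * d) ^ DIM('a)"
        using content_ball[of "\<kappa> * d" p] \<kappa> d by (simp add: \<omega>_def)
      also have "\<dots> = \<omega> * \<kappa> ^ DIM('a) * d powr real DIM('a)"
        using d by (simp add: power_mult_distrib powr_realpow)
      finally have m: "measure lborel (ball p (\<kappa> * d)) = \<omega> * \<kappa> ^ DIM('a) * d powr real DIM('a)" .
      have L: "L = a * M powr (- N) * d powr (- N)" unfolding L_def using M d by (simp add: powr_mult)
      have "d powr (- N) * d powr (- N) * d powr real DIM('a) = d powr (- (real DIM('a) + 4 * s))"
        by (simp add: N_def flip: powr_add)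
      then show ?thesis unfolding m L c_def by (simp add: mult_ac)
    qed
    ultimately show ?thesis unfolding h_def by simp
  qed
  then show ?thesis using c by blast
qed

end

subsection \<open>The reduced functional\<close>

context fundamental_solution
begin

text \<open>\<open>\<Gamma>\<close> itself need not lie in \<open>H\<^sup>s\<close>, but the regular part of a small rescaled copy of the
  domain, centred at its pole, is an element of \<open>H\<^sup>s\<close> that agrees with \<open>\<Gamma>\<close> away from the origin.\<close>

lemma truncated_fundamental_solution:
  assumes \<Omega>: "open \<Omega>" "bounded \<Omega>" "\<Omega> \<noteq> {}" and H: "\<And>\<epsilon>. \<epsilon> > 0 \<Longrightarrow> regular_part s (rescaled \<epsilon> \<Omega>) \<Gamma> (H \<epsilon>)"
    and r: "r > 0"
  shows "\<exists>T. Hs s T \<and> (\<forall>x. r \<le> norm x \<longrightarrow> T x = \<Gamma> x)"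
proof -
  obtain z where z: "z \<in> \<Omega>" using \<Omega>(3) by blast
  obtain B where B: "B > 0" "\<And>x. x \<in> \<Omega> \<Longrightarrow> norm x \<le> B" using \<Omega>(2) bounded_pos by metis
  \<comment> \<open>The rescaled domain has diameter at most 2B / \<epsilon> = 2r / 3, so translated
    with its pole at the origin it lies within the ball of radius r.\<close>
  define \<epsilon> where "\<epsilon> = 3 * B / r"
  have e: "\<epsilon> > 0" using B r by (simp add: \<epsilon>_def)
  define y0 where "y0 = z /\<^sub>R \<epsilon>"
  let ?U = "rescaled \<epsilon> \<Omega>"
  have y0: "y0 \<in> ?U" unfolding y0_def rescaled_def using z by (rule imageI)
  have U: "open ?U" "bounded ?U" using open_rescaled[OF e \<Omega>(1)] bounded_rescaled[OF \<Omega>(2)] .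
  have "Hs s (\<lambda>x. H \<epsilon> (x - (- y0)) y0)"
    by (rule Hs_translate[OF regular_part_Hs(1)[OF U H[OF e] y0]])
  moreover have "H \<epsilon> (x - (- y0)) y0 = \<Gamma> x" if x: "r \<le> norm x" for x
  proof -
    have "x - (- y0) \<notin> ?U"
    proof
      assume "x - (- y0) \<in> ?U"
      then obtain x' where x': "x' \<in> \<Omega>" "x + y0 = x' /\<^sub>R \<epsilon>" by (auto simp: rescaled_def)
      then have "x = (x' - z) /\<^sub>R \<epsilon>" by (simp add: y0_def algebra_simps)
      then have "norm x = norm (x' - z) / \<epsilon>" using e by (simp add: divide_inverse mult.commute)
      also have "\<dots> \<le> 2 * B / \<epsilon>"
        using B(2)[OF x'(1)] B(2)[OF z] norm_triangle_ineq4[of x' z] e by (intro divide_right_mono) auto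
      also have "\<dots> = (2/3) * r" using B r by (simp add: \<epsilon>_def)
      also have "\<dots> < r" using r by simp
      finally show False using x by simp
    qed
    from regular_part_exterior[OF H[OF e] y0 this] show ?thesis by simp
  qed
  ultimately show ?thesis by blast
qed

text \<open>The exterior values of the difference of two regular parts extend to a difference of
  translates of T, since both poles stay at distance r = R / 2 from the complement of U. By
  \<open>enorm_minimal\<close> the energy of that extension bounds the energy of the difference, and
  translations are continuous in the energy norm.\<close>

lemma integral_H_continuous:
  assumes trunc: "\<And>r. r > 0 \<Longrightarrow> \<exists>T. Hs s T \<and> (\<forall>x. r \<le> norm x \<longrightarrow> T x = \<Gamma> x)"
    and U: "open U" "bounded U" and H: "regular_part s U \<Gamma> H" and g: "l2 g"
  shows "continuous_on U (\<lambda>y. LINT x|lborel. H x y * g x)"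
  unfolding continuous_on_sequentially comp_def
proof (intro allI ballI impI)
  fix ys y assume y: "y \<in> U" and ys: "(\<forall>n. ys n \<in> U) \<and> ys \<longlonglongrightarrow> y"
  obtain R where R: "R > 0" "ball y R \<subseteq> U" using U(1) y unfolding open_contains_ball by blast
  define r where "r = R / 2"
  have r: "r > 0" using R by (simp add: r_def)
  obtain T where T: "Hs s T" "\<And>x. r \<le> norm x \<Longrightarrow> T x = \<Gamma> x" using trunc[OF r] by blast
  have near: "\<forall>\<^sub>F n in sequentially. dist (ys n) y < r" using ys r by (intro tendstoD) auto
  show "(\<lambda>n. LINT x|lborel. H x (ys n) * g x) \<longlonglongrightarrow> (LINT x|lborel. H x y * g x)"
  proof (rule LIM_zero_cancel, rule Lim_null_comparison)
    show "(\<lambda>n. enorm s (\<lambda>x. T (x - ys n) - T (x - y)) * l2norm g) \<longlonglongrightarrow> 0"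
      using ys by (intro tendsto_mult_left_zero enorm_translate_tendsto_0 T) auto
    show "\<forall>\<^sub>F n in sequentially. norm ((LINT x|lborel. H x (ys n) * g x) - (LINT x|lborel. H x y * g x)) \<le> enorm s (\<lambda>x. T (x - ys n) - T (x - y)) * l2norm g"
      using near
    proof eventually_elim
      case (elim n)
      have yn: "ys n \<in> U" using ys by simp
      note un = regular_part_Hs[OF U H yn] and u = regular_part_Hs[OF U H y]
      let ?w = "\<lambda>x. H x (ys n) - H x y"
      have w: "Hs s ?w" by (rule Hs_diff[OF un(1) u(1)])
      have far: "r \<le> norm (x - ys n)" "r \<le> norm (x - y)" if "x \<notin> U" for x
      proof -
        have "R \<le> dist y x" using that R(2) by (auto simp: not_less[symmetric])
        moreover have "dist y x \<le> dist (ys n) y + dist (ys n) x" using dist_triangle3[of y x "ys n"] by (simp add: dist_commute)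
        ultimately show "r \<le> norm (x - ys n)" "r \<le> norm (x - y)"
          using elim r by (auto simp: r_def dist_norm norm_minus_commute)
      qed
      have "enorm s ?w \<le> enorm s (\<lambda>x. T (x - ys n) - T (x - y))"
      proof (rule enorm_minimal[OF w, where U=U])
        show "Hs s (\<lambda>x. T (x - ys n) - T (x - y))" by (intro Hs_diff Hs_translate T)
        show "?w x = T (x - ys n) - T (x - y)" if "x \<notin> U" for x
          using T(2)[OF far(1)[OF that]] T(2)[OF far(2)[OF that]] regular_part_exterior[OF H yn that] regular_part_exterior[OF H y that]
          by simp
        show "eform s ?w v = 0" if "Hs s v" "\<And>x. x \<notin> U \<Longrightarrow> v x = 0" for v :: "'a \<Rightarrow> real"
          using eform_diff_left[OF un(1) u(1) that(1)] un(2)[OF that] u(2)[OF that] by simp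
      qed
      then have le: "l2norm ?w \<le> enorm s (\<lambda>x. T (x - ys n) - T (x - y))" using l2norm_le_enorm[OF w] by simp
      note l2 = L12D(2)[OF Hs_L12[OF un(1)]] L12D(2)[OF Hs_L12[OF u(1)]] L12D(2)[OF Hs_L12[OF w]]
      have "(LINT x|lborel. H x (ys n) * g x) - (LINT x|lborel. H x y * g x) = (LINT x|lborel. ?w x * g x)"
        using integrable_l2_mult[OF l2(1) g] integrable_l2_mult[OF l2(2) g] by (simp add: left_diff_distrib)
      also have "norm \<dots> \<le> l2norm ?w * l2norm g" by (rule l2_Cauchy_Schwarz[OF l2(3) g])
      also have "\<dots> \<le> enorm s (\<lambda>x. T (x - ys n) - T (x - y)) * l2norm g" by (intro mult_right_mono le) simp
      finally show ?case .
    qed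
  qed
qed

text \<open>The comparison function is \<open>conv \<Gamma> (h m)\<close>, with h m a mollifier
  centred at y: it has finite energy, total integral 1 and nonnegative right side. Outside U it
  falls short of \<Gamma>(x - y) by the error \<open>e m\<close> of mollifying the truncated
  \<Gamma>. Subtracting \<open>e m\<close> corrects the exterior values and costs only
  \<open>enorm s (e m)\<close> in the maximum principle, which tends to 0.\<close>

lemma integral_H_upper_bound:
  assumes trunc: "\<And>r. r > 0 \<Longrightarrow> \<exists>T. Hs s T \<and> (\<forall>x. r \<le> norm x \<longrightarrow> T x = \<Gamma> x)"
    and U: "open U" "bounded U" and H: "regular_part s U \<Gamma> H" and y: "y \<in> U"
    and g: "l2 g" "\<And>x. 0 \<le> g x" "\<And>x. g x \<le> M"
  shows "(LINT x|lborel. H x y * g x) \<le> M"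
proof -
  obtain R where R: "R > 0" "ball y R \<subseteq> U" using U(1) y unfolding open_contains_ball by blast
  define r where "r = R / 2"
  have r: "r > 0" using R by (simp add: r_def)
  have far: "2 * r \<le> norm (x - y)" if "x \<notin> U" for x
  proof -
    have "\<not> dist y x < R" using that R(2) by auto
    then show ?thesis by (simp add: r_def dist_norm norm_minus_commute)
  qed
  obtain T where T: "Hs s T" "\<And>x. r \<le> norm x \<Longrightarrow> T x = \<Gamma> x" using trunc[OF r] by blast
  let ?T = "\<lambda>x. T (x - y)"
  define e where "e m x = ?T x - conv (mollifier m) ?T x" for m x
  define h where "h m x = mollifier m (x - y)" for m and x :: 'a
  note u = regular_part_Hs[OF U H y]
  have HT: "Hs s ?T" by (rule Hs_translate[OF T(1)])
  have He: "Hs s (e m)" for m unfolding e_def by (intro Hs_diff HT Hs_conv_mollifier)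
  have e0: "(\<lambda>m. enorm s (e m)) \<longlonglongrightarrow> 0" unfolding e_def by (rule enorm_mollify_tendsto_0[OF HT])
  have hL: "L12 (h m)" for m unfolding h_def by (rule L12_translate[OF L12_mollifier])
  have hi: "(LINT x|lborel. h m x) = 1" for m unfolding h_def using integral_mollifier[of m, where 'a='a] by simp
  have h0: "0 \<le> h m x" for m x unfolding h_def by (rule mollifier_nonneg)
  have Hc: "Hs s (conv \<Gamma> (h m))" for m by (rule Hs_conv[OF hL])
  \<comment> \<open>The integral of a function is its transform at frequency 0, where convolution
    becomes a product.\<close>
  have ci: "(LINT x|lborel. conv \<Gamma> (h m) x) = 1" for m
  proof -
    have f0: "fourier v 0 = of_real (LINT x|lborel. v x)" for v :: "'a \<Rightarrow> real"
      by (simp add: fourier_eq_ft ft_def)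
    have "fourier (conv \<Gamma> (h m)) 0 = fourier \<Gamma> 0 * fourier (h m) 0" by (rule fourier_conv[OF integrable L12D(1)[OF hL]])
    then show ?thesis unfolding f0 integral hi by simp
  qed
  have bound: "(LINT x|lborel. H x y * g x) \<le> M + 2 * (enorm s (e m) * l2norm g)" if m: "1 / real (Suc m) \<le> r" for m
  proof -
    let ?z = "\<lambda>x. H x y - conv \<Gamma> (h m) x - e m x"
    have z: "Hs s ?z" by (intro Hs_diff u Hc He)
    have zext: "?z x = 0" if x: "x \<notin> U" for x
    proof -
      \<comment> \<open>For x outside U the mollifier reaches only points at distance at least r
        from y, where T agrees with \<Gamma>; truncation is invisible there.\<close>
      have "conv (mollifier m) ?T x = (LINT w|lborel. mollifier m (x - w) * \<Gamma> (w - y))"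
        unfolding conv_def
      proof (intro Bochner_Integration.integral_cong refl)
        fix w
        show "mollifier m (x - w) * T (w - y) = mollifier m (x - w) * \<Gamma> (w - y)"
        proof (cases "1 / real (Suc m) \<le> norm (x - w)")
          case True
          then show ?thesis by (simp add: mollifier_eq_0 del: of_nat_Suc)
        next
          case False
          then have "norm (x - w) < r" using m by linarith
          moreover have "norm (x - y) \<le> norm (x - w) + norm (w - y)" using norm_triangle_ineq[of "x - w" "w - y"] by simp
          ultimately have "r \<le> norm (w - y)" using far[OF x] by linarith
          then show ?thesis using T(2) by simp
        qed
      qed
      also have "\<dots> = (LINT w|lborel. mollifier m (x - (x + y - w)) * \<Gamma> (x + y - w - y))"
        by (rule integral_lborel_translate(3)[symmetric])
      also have "\<dots> = conv \<Gamma> (h m) x" unfolding conv_def h_def by (simp add: mult.commute algebra_simps)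
      finally have "conv (mollifier m) ?T x = conv \<Gamma> (h m) x" .
      moreover have "?T x = \<Gamma> (x - y)" using T(2)[of "x - y"] far[OF x] r by simp
      ultimately show ?thesis using regular_part_exterior[OF H y x] by (simp add: e_def)
    qed
    have zp: "Hs s (\<lambda>x. max (?z x) 0)" "enorm s (\<lambda>x. max (?z x) 0) \<le> enorm s (e m)"
    proof -
      have "eform s ?z v \<le> enorm s (e m) * enorm s v" if v: "Hs s v" "\<And>x. 0 \<le> v x" "\<And>x. x \<notin> U \<Longrightarrow> v x = 0" for v
      proof -
        have "eform s ?z v = eform s (\<lambda>x. H x y) v - eform s (conv \<Gamma> (h m)) v - eform s (e m) v"
          using eform_diff_left[OF Hs_diff[OF u(1) Hc[of m]] He[of m] v(1)] eform_diff_left[OF u(1) Hc[of m] v(1)] by simp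
        also have "\<dots> = - (LINT x|lborel. h m x * v x) - eform s (e m) v"
          using u(2)[OF v(1,3)] eform_conv[OF hL v(1)] by simp
        also have "\<dots> \<le> - eform s (e m) v"
          using h0 v(2) by (simp add: Bochner_Integration.integral_nonneg)
        also have "\<dots> \<le> enorm s (e m) * enorm s v" using eform_Cauchy_Schwarz[OF He[of m] v(1)] by linarith
        finally show ?thesis .
      qed
      then show "Hs s (\<lambda>x. max (?z x) 0)" "enorm s (\<lambda>x. max (?z x) 0) \<le> enorm s (e m)"
        using max_principle[OF z, of U "enorm s (e m)"] zext by auto
    qed
    note l2 = L12D(2)[OF Hs_L12[OF Hc[of m]]] L12D(2)[OF Hs_L12[OF He[of m]]] L12D(2)[OF Hs_L12[OF zp(1)]] L12D(2)[OF Hs_L12[OF u(1)]]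
    have i: "Bochner_Integration.integrable lborel (\<lambda>x. conv \<Gamma> (h m) x * g x)" "Bochner_Integration.integrable lborel (\<lambda>x. e m x * g x)"
      "Bochner_Integration.integrable lborel (\<lambda>x. max (?z x) 0 * g x)" "Bochner_Integration.integrable lborel (\<lambda>x. H x y * g x)"
      by (intro integrable_l2_mult l2 g)+
    have "(LINT x|lborel. H x y * g x) \<le> (LINT x|lborel. conv \<Gamma> (h m) x * g x + (e m x * g x + max (?z x) 0 * g x))"
    proof (rule integral_mono)
      fix x
      have "H x y \<le> conv \<Gamma> (h m) x + (e m x + max (?z x) 0)" by simp
      from mult_right_mono[OF this g(2)[of x]]
      show "H x y * g x \<le> conv \<Gamma> (h m) x * g x + (e m x * g x + max (?z x) 0 * g x)"
        by (simp only: distrib_right)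
    qed (use i in auto)
    also have "\<dots> = (LINT x|lborel. conv \<Gamma> (h m) x * g x) + ((LINT x|lborel. e m x * g x) + (LINT x|lborel. max (?z x) 0 * g x))"
      using i by (simp only: Bochner_Integration.integral_add Bochner_Integration.integrable_add)
    also have "\<dots> \<le> M + (enorm s (e m) * l2norm g + enorm s (e m) * l2norm g)"
    proof (intro add_mono)
      have "(LINT x|lborel. conv \<Gamma> (h m) x * g x) \<le> (LINT x|lborel. conv \<Gamma> (h m) x * M)"
        using conv_nonneg[of "h m", OF h0] g L12D(1)[OF Hs_L12[OF Hc[of m]]] i(1)
        by (intro integral_mono mult_left_mono) auto
      also have "\<dots> = M" using ci by simp
      finally show "(LINT x|lborel. conv \<Gamma> (h m) x * g x) \<le> M" .
      have "(LINT x|lborel. e m x * g x) \<le> l2norm (e m) * l2norm g" using l2_Cauchy_Schwarz[OF l2(2) g(1)] by simp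
      also have "\<dots> \<le> enorm s (e m) * l2norm g" by (intro mult_right_mono l2norm_le_enorm He) simp
      finally show "(LINT x|lborel. e m x * g x) \<le> enorm s (e m) * l2norm g" .
      have "(LINT x|lborel. max (?z x) 0 * g x) \<le> l2norm (\<lambda>x. max (?z x) 0) * l2norm g" using l2_Cauchy_Schwarz[OF l2(3) g(1)] by simp
      also have "\<dots> \<le> enorm s (e m) * l2norm g"
        using l2norm_le_enorm[OF zp(1)] zp(2) by (intro mult_right_mono) auto
      finally show "(LINT x|lborel. max (?z x) 0 * g x) \<le> enorm s (e m) * l2norm g" .
    qed
    finally show ?thesis by linarith
  qed
  have "(\<lambda>m. M + 2 * (enorm s (e m) * l2norm g)) \<longlonglongrightarrow> M + 2 * (0 * l2norm g)"
    by (intro tendsto_intros e0)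
  then have lim: "(\<lambda>m. M + 2 * (enorm s (e m) * l2norm g)) \<longlonglongrightarrow> M" by simp
  obtain n where n: "inverse (real (Suc n)) < r" using reals_Archimedean[OF r] by blast
  have "(LINT x|lborel. H x y * g x) \<le> M + 2 * (enorm s (e m) * l2norm g)" if "m \<ge> n" for m
  proof (rule bound)
    have "1 / real (Suc m) \<le> 1 / real (Suc n)" using that by (simp add: field_simps)
    then show "1 / real (Suc m) \<le> r" using n unfolding divide_inverse mult_1_left by linarith
  qed
  then show ?thesis by (intro LIMSEQ_le_const[OF lim]) blast
qed

text \<open>All integrands are nonnegative almost everywhere, so both integrals may be restricted to
  the unit ball around \<xi>, where H is at least L and each weight at least \<mu>.\<close>

lemma reduced_functional_lower_bound:
  assumes trunc: "\<And>r. r > 0 \<Longrightarrow> \<exists>T. Hs s T \<and> (\<forall>x. r \<le> norm x \<longrightarrow> T x = \<Gamma> x)"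
    and U: "open U" "bounded U" and H: "regular_part s U \<Gamma> H"
    and w: "continuous_on UNIV w" "\<And>x. 0 < w x"
    and \<mu>: "0 \<le> \<mu>" "\<And>x. norm x \<le> 1 \<Longrightarrow> \<mu> \<le> w x powr p"
    and ball: "ball \<xi> 1 \<subseteq> U" and L: "0 \<le> L"
    and low: "\<And>y. y \<in> ball \<xi> 1 \<Longrightarrow> AE x in lborel. x \<in> ball \<xi> 1 \<longrightarrow> L \<le> H x y"
  shows "L * (\<mu> * measure lborel (ball \<xi> 1))\<^sup>2 \<le> reduced_functional p w U H \<xi>"
proof -
  define f where "f x = w (x - \<xi>) powr p" for x
  have fc: "continuous_on UNIV f"
  proof -
    have "continuous_on UNIV (\<lambda>x. w (x - \<xi>))" by (intro continuous_on_compose2[OF w(1)] continuous_intros) auto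
    then show ?thesis unfolding f_def using w(2) by (intro continuous_on_powr continuous_on_const) (auto simp: less_imp_neq[symmetric])
  qed
  have [measurable]: "f \<in> borel_measurable borel" by (rule borel_measurable_continuous_onI[OF fc])
  have [measurable]: "U \<in> sets borel" using U by auto
  have f0: "0 \<le> f x" for x by (simp add: f_def)
  have "compact (f ` closure U)"
    using U by (intro compact_continuous_image continuous_on_subset[OF fc]) auto
  then obtain M where M: "\<And>v. v \<in> f ` closure U \<Longrightarrow> norm v \<le> M" using compact_imp_bounded bounded_iff by metis
  have fM: "f x \<le> M" if "x \<in> U" for x using M[of "f x"] closure_subset that by fastforce
  have M0: "0 \<le> M" using fM[of \<xi>] f0[of \<xi>] ball by (meson centre_in_ball order_trans subsetD zero_less_one)
  \<comment> \<open>The restriction to U is absorbed into the weight. This makes g bounded and L2,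
    so the inner integral is of the form treated in the two preceding lemmas.\<close>
  define g where "g x = indicator U x * f x" for x
  have g: "0 \<le> g x" "g x \<le> M" for x using f0[of x] fM[of x] M0 by (auto simp: g_def indicator_def)
  have gm[measurable]: "g \<in> borel_measurable borel" unfolding g_def by measurable
  have gl2: "l2 g"
  proof (rule l2_bound)
    show "l2 (\<lambda>x. M * indicator U x :: real)" by (intro l2_cmult l2_indicator U) auto
    show "AE x in lborel. norm (g x) \<le> norm (M * indicator U x :: real)"
      using fM f0 M0 by (intro always_eventually allI) (auto simp: g_def indicator_def)
  qed measurable
  define I where "I y = (LINT x|lborel. H x y * g x)" for y
  have Ic: "continuous_on U I" unfolding I_def by (rule integral_H_continuous[OF trunc U H gl2])
  have IM: "I y \<le> M" if "y \<in> U" for y unfolding I_def by (rule integral_H_upper_bound[OF trunc U H that gl2 g])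
  have Hl2: "l2 (\<lambda>x. H x y)" if "y \<in> U" for y using L12D(2)[OF regular_part_L12[OF U H that]] .
  have I0: "0 \<le> I y" if y: "y \<in> U" for y
    unfolding I_def
  proof (rule integral_nonneg_AE)
    show "AE x in lborel. 0 \<le> H x y * g x"
      using regular_part_nonneg[OF U H y] by eventually_elim (use g in auto)
  qed
  let ?V = "measure lborel (ball \<xi> 1)"
  have Bi: "Bochner_Integration.integrable lborel (indicator (ball \<xi> 1) :: 'a \<Rightarrow> real)"
    by (intro integrable_real_indicator) (use emeasure_bounded_finite[OF bounded_ball[of \<xi> 1]] in auto)
  have f\<mu>: "\<mu> \<le> f x" if "x \<in> ball \<xi> 1" for x
    unfolding f_def using that by (intro \<mu>) (auto simp: dist_norm norm_minus_commute)
  have Ilow: "L * \<mu> * ?V \<le> I y" if y: "y \<in> ball \<xi> 1" for y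
  proof -
    have yU: "y \<in> U" using y ball by blast
    have "L * \<mu> * ?V = (LINT x|lborel. indicator (ball \<xi> 1) x * (L * \<mu>))" by simp
    also have "\<dots> \<le> I y" unfolding I_def
    proof (rule integral_mono_AE)
      show "Bochner_Integration.integrable lborel (\<lambda>x. H x y * g x)" by (rule integrable_l2_mult[OF Hl2[OF yU] gl2])
      show "AE x in lborel. indicator (ball \<xi> 1) x * (L * \<mu>) \<le> H x y * g x"
        using low[OF y] regular_part_nonneg[OF U H yU]
      proof eventually_elim
        case (elim x)
        show ?case
        proof (cases "x \<in> ball \<xi> 1")
          case True
          then have "x \<in> U" using ball by blast
          then show ?thesis using True elim f\<mu>[OF True] L \<mu>(1) by (auto simp: g_def intro!: mult_mono)
        qed (use elim g in auto)
      qed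
    qed (use Bi in auto)
    finally show ?thesis .
  qed
  have eq: "reduced_functional p w U H \<xi> = (LINT y|lborel. indicator U y * I y * f y)"
  proof -
    have "(LINT x:U|lborel. H x y * w (x - \<xi>) powr p * w (y - \<xi>) powr p) = I y * f y" for y
    proof -
      have "(LINT x:U|lborel. H x y * w (x - \<xi>) powr p * w (y - \<xi>) powr p) = (LINT x|lborel. (H x y * g x) * f y)"
        unfolding set_lebesgue_integral_def by (intro Bochner_Integration.integral_cong refl) (simp add: g_def f_def mult_ac)
      then show ?thesis by (simp add: I_def)
    qed
    then show ?thesis unfolding reduced_functional_def by (simp add: set_lebesgue_integral_def mult_ac)
  qed
  have Im: "(\<lambda>y. indicator U y * I y) \<in> borel_measurable borel"
    using borel_measurable_continuous_on_indicator[OF _ Ic] by simp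
  have bd: "0 \<le> indicator U y * I y * f y \<and> indicator U y * I y * f y \<le> M * M * indicator U y" for y
    using I0[of y] IM[of y] f0[of y] fM[of y] M0 by (auto simp: indicator_def intro!: mult_mono)
  have Fi: "Bochner_Integration.integrable lborel (\<lambda>y. indicator U y * I y * f y)"
  proof (rule Bochner_Integration.integrable_bound)
    show "Bochner_Integration.integrable lborel (\<lambda>y. M * M * indicator U y :: real)"
      by (intro integrable_mult_right integrable_real_indicator) (use emeasure_bounded_finite[OF U(2)] in auto)
    show "AE y in lborel. norm (indicator U y * I y * f y) \<le> norm (M * M * indicator U y)"
    proof (intro always_eventually allI)
      fix y show "norm (indicator U y * I y * f y) \<le> norm (M * M * indicator U y)"
        unfolding real_norm_def using bd[of y] by linarith
    qed
    show "(\<lambda>y. indicator U y * I y * f y) \<in> borel_measurable lborel" using Im by measurable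
  qed
  have "L * (\<mu> * ?V)\<^sup>2 = (LINT y|lborel. indicator (ball \<xi> 1) y * (L * \<mu> * ?V * \<mu>))"
    by (simp add: power2_eq_square)
  also have "\<dots> \<le> (LINT y|lborel. indicator U y * I y * f y)"
  proof (rule integral_mono)
    fix y
    show "indicator (ball \<xi> 1) y * (L * \<mu> * ?V * \<mu>) \<le> indicator U y * I y * f y"
    proof (cases "y \<in> ball \<xi> 1")
      case True
      then have "y \<in> U" using ball by blast
      then show ?thesis using True Ilow[OF True] f\<mu>[OF True] L \<mu>(1) I0[of y] by (auto intro!: mult_mono)
    next
      case False
      then show ?thesis using bd[of y] by simp
    qed
  qed (use Bi Fi in auto)
  finally show ?thesis unfolding eq .
qed

end

theorem corollary2p6:
  fixes s p :: real
    and \<Omega> :: "'a::euclidean_space set"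
    and w \<Gamma> :: "'a \<Rightarrow> real"
    and H :: "real \<Rightarrow> 'a \<Rightarrow> 'a \<Rightarrow> real"
  assumes s: "0 < s" "s < 1"
    and dim: "real DIM('a) > 2 * s"
    and p: "1 < p" "p < (real DIM('a) + 2 * s) / (real DIM('a) - 2 * s)"
    and domain: "smooth_bounded_domain \<Omega>"
    and w: "least_energy_solution s p w" "radial w" "\<forall>x. w x > 0"
    and w_known: "smooth_on UNIV w" "two_sided_decay s w"
    and \<Gamma>: "decaying_fundamental_solution s \<Gamma>"
    and \<Gamma>_known: "radial \<Gamma>" "\<forall>x. x \<noteq> 0 \<longrightarrow> \<Gamma> x > 0"
      "has_bochner_integral lborel \<Gamma> 1" "two_sided_decay s \<Gamma>"
    and H: "\<forall>\<epsilon>>0. regular_part s (rescaled \<epsilon> \<Omega>) \<Gamma> (H \<epsilon>)"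
  shows "\<exists>\<delta>\<^sub>0 c :: real. 0 < \<delta>\<^sub>0 \<and> \<delta>\<^sub>0 < 1 \<and> 0 < c \<and>
    (\<forall>\<delta> \<epsilon> \<xi>. 0 < \<delta> \<and> \<delta> \<le> \<delta>\<^sub>0 \<and> 0 < \<epsilon> \<and> \<xi> \<in> rescaled \<epsilon> \<Omega> \<longrightarrow>
      (let d = infdist \<xi> (frontier (rescaled \<epsilon> \<Omega>)) in
        2 \<le> d \<and> d \<le> \<delta> / \<epsilon> \<longrightarrow>
          reduced_functional p w (rescaled \<epsilon> \<Omega>) (H \<epsilon>) \<xi> \<ge> c / d powr (real DIM('a) + 4 * s)))"
proof -
  interpret fundamental_solution s \<Gamma>
    by unfold_locales (use s \<Gamma> \<Gamma>_known in auto)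
  have \<Omega>: "open \<Omega>" "bounded \<Omega>" "\<Omega> \<noteq> {}" using domain by (auto simp: smooth_bounded_domain_def)
  have H': "regular_part s (rescaled \<epsilon> \<Omega>) \<Gamma> (H \<epsilon>)" if "\<epsilon> > 0" for \<epsilon> using H that by blast
  note trunc = truncated_fundamental_solution[OF \<Omega> H']
  have wc: "continuous_on UNIV w"
    using w_known(1) times_differentiable_on.simps(1) unfolding smooth_on_def by blast
  \<comment> \<open>Positivity and continuity give \<open>w powr p\<close> a positive minimum \<mu>
    on the closed unit ball, independent of \<epsilon> and \<xi>.\<close>
  have "continuous_on (cball 0 1) (\<lambda>x. w x powr p)"
    using w(3) by (intro continuous_on_powr continuous_on_const continuous_on_subset[OF wc]) (auto simp: less_imp_neq[symmetric])
  then obtain x0 where x0: "x0 \<in> cball 0 1" "\<And>x. x \<in> cball 0 1 \<Longrightarrow> w x0 powr p \<le> w x powr p"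
    using continuous_attains_inf[of "cball 0 1" "\<lambda>x. w x powr p"] by auto
  define \<mu> where "\<mu> = w x0 powr p"
  have \<mu>: "\<mu> > 0" "\<And>x. norm x \<le> 1 \<Longrightarrow> \<mu> \<le> w x powr p"
    using w(3) x0(2) by (auto simp: \<mu>_def dest: spec[of _ x0])
  obtain \<kappa> t0 K where ext: "\<kappa> > 0" "t0 > 0" "K \<ge> 0"
    "\<And>\<epsilon> \<xi>. 0 < \<epsilon> \<Longrightarrow> 0 < infdist \<xi> (frontier (rescaled \<epsilon> \<Omega>)) \<Longrightarrow> infdist \<xi> (frontier (rescaled \<epsilon> \<Omega>)) \<le> t0 / \<epsilon> \<Longrightarrow>
    (\<exists>p. norm (p - \<xi>) \<le> K * infdist \<xi> (frontier (rescaled \<epsilon> \<Omega>)) \<and>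
      ball p (\<kappa> * infdist \<xi> (frontier (rescaled \<epsilon> \<Omega>))) \<inter> rescaled \<epsilon> \<Omega> = {})"
    using exterior_ball_rescaled[OF domain] by blast
  obtain c1 where c1: "c1 > 0" "\<And>U H y. open U \<Longrightarrow> bounded U \<Longrightarrow> regular_part s U \<Gamma> H \<Longrightarrow> ball y 1 \<subseteq> U \<Longrightarrow>
     (AE x in lborel. c1 * conv \<Gamma> (\<lambda>z. indicator (- U) z * \<Gamma> (z - y)) x \<le> H x y)"
    using regular_part_lower_bound by blast
  obtain c2 where c2: "c2 > 0" "\<And>U \<xi> d p x y. open U \<Longrightarrow> 2 \<le> d \<Longrightarrow> ball \<xi> d \<subseteq> U \<Longrightarrow> norm (p - \<xi>) \<le> K * d \<Longrightarrow>
     ball p (\<kappa> * d) \<inter> U = {} \<Longrightarrow> x \<in> ball \<xi> 1 \<Longrightarrow> y \<in> ball \<xi> 1 \<Longrightarrow>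
     c2 * d powr (- (real DIM('a) + 4 * s)) \<le> conv \<Gamma> (\<lambda>z. indicator (- U) z * \<Gamma> (z - y)) x"
    using conv_exterior_lower_bound[OF ext(1,3)] by blast
  define V where "V = measure lborel (ball (0::'a) 1)"
  have V: "V > 0" unfolding V_def by (rule measure_unit_ball_pos)
  \<comment> \<open>c1 compares H with the convolution, c2 bounds the convolution from below, and
    each of the two integrations contributes a factor \<mu> V.\<close>
  define c where "c = c1 * c2 * (\<mu> * V)\<^sup>2"
  have c: "c > 0" using c1 c2 \<mu> V by (simp add: c_def)
  \<comment> \<open>t0 guarantees the exterior ball after rescaling; 1/2 only keeps the threshold
    below 1.\<close>
  define \<delta>0 where "\<delta>0 = min t0 (1/2)"
  have main: "c / d powr (real DIM('a) + 4 * s) \<le> reduced_functional p w (rescaled \<epsilon> \<Omega>) (H \<epsilon>) \<xi>"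
    if \<delta>: "\<delta> \<le> \<delta>0" and e: "0 < \<epsilon>" and \<xi>: "\<xi> \<in> rescaled \<epsilon> \<Omega>"
      and d_def: "d = infdist \<xi> (frontier (rescaled \<epsilon> \<Omega>))" and d: "2 \<le> d" "d \<le> \<delta> / \<epsilon>" for \<delta> \<epsilon> \<xi> d
  proof -
    let ?U = "rescaled \<epsilon> \<Omega>"
    have U: "open ?U" "bounded ?U" using open_rescaled[OF e \<Omega>(1)] bounded_rescaled[OF \<Omega>(2)] .
    have bU: "ball \<xi> d \<subseteq> ?U" unfolding d_def by (rule ball_infdist_frontier_subset[OF \<xi>])
    have "\<delta> / \<epsilon> \<le> t0 / \<epsilon>" using \<delta> e by (intro divide_right_mono) (auto simp: \<delta>0_def)
    then have "d \<le> t0 / \<epsilon>" using d by simp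
    then obtain q where q: "norm (q - \<xi>) \<le> K * d" "ball q (\<kappa> * d) \<inter> ?U = {}"
      using ext(4)[OF e, of \<xi>] d(1) unfolding d_def by auto
    let ?L = "c1 * (c2 * d powr (- (real DIM('a) + 4 * s)))"
    have "?L * (\<mu> * measure lborel (ball \<xi> 1))\<^sup>2 \<le> reduced_functional p w ?U (H \<epsilon>) \<xi>"
    proof (rule reduced_functional_lower_bound[OF trunc U H'[OF e] wc])
      show "ball \<xi> 1 \<subseteq> ?U" using bU d(1) subset_ball[of 1 d \<xi>] by auto
      fix y assume y: "y \<in> ball \<xi> 1"
      \<comment> \<open>Here d \<ge> 2 enters: the unit ball around any point of the unit ball of
        \<xi> still fits into U.\<close>
      have "ball y 1 \<subseteq> ball \<xi> d"
      proof
        fix x assume "x \<in> ball y 1"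
        then show "x \<in> ball \<xi> d" using y d(1) dist_triangle[of \<xi> x y] by simp
      qed
      then have "ball y 1 \<subseteq> ?U" using bU by blast
      from c1(2)[OF U H'[OF e] this]
      show "AE x in lborel. x \<in> ball \<xi> 1 \<longrightarrow> ?L \<le> H \<epsilon> x y"
      proof eventually_elim
        case (elim x)
        show ?case
        proof
          assume x: "x \<in> ball \<xi> 1"
          have "?L \<le> c1 * conv \<Gamma> (\<lambda>z. indicator (- ?U) z * \<Gamma> (z - y)) x"
            using c2(2)[OF U(1) d(1) bU q x y] c1(1) by (intro mult_left_mono) auto
          then show "?L \<le> H \<epsilon> x y" using elim by simp
        qed
      qed
    qed (use w \<mu> c1(1) c2(1) in auto)
    moreover have "measure lborel (ball \<xi> 1) = V"
      unfolding V_def using content_ball[of 1 \<xi>] content_ball[of 1 "0::'a"] by simp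
    moreover have "c / d powr (real DIM('a) + 4 * s) = ?L * (\<mu> * V)\<^sup>2"
      unfolding c_def powr_minus divide_inverse by (simp only: mult_ac)
    ultimately show ?thesis by simp
  qed
  show ?thesis
    unfolding Let_def
  proof (rule exI[of _ \<delta>0], rule exI[of _ c], intro conjI allI impI)
    show "0 < \<delta>0" "\<delta>0 < 1" using ext(2) by (auto simp: \<delta>0_def)
    show "0 < c" by (rule c)
    fix \<delta> \<epsilon> :: real and \<xi> :: 'a
    assume "0 < \<delta> \<and> \<delta> \<le> \<delta>0 \<and> 0 < \<epsilon> \<and> \<xi> \<in> rescaled \<epsilon> \<Omega>"
      and "2 \<le> infdist \<xi> (frontier (rescaled \<epsilon> \<Omega>)) \<and> infdist \<xi> (frontier (rescaled \<epsilon> \<Omega>)) \<le> \<delta> / \<epsilon>"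
    then show "c / infdist \<xi> (frontier (rescaled \<epsilon> \<Omega>)) powr (real DIM('a) + 4 * s) \<le> reduced_functional p w (rescaled \<epsilon> \<Omega>) (H \<epsilon>) \<xi>"
      by (intro main[where \<delta>=\<delta>]) auto
  qed
qed

end
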